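(* Let $\omega$ be a radial weight and let $T\in\{H_\omega,\widetilde{H_\omega}\}$. Then the following statements are equivalent: (i) $T:H^\infty\to HL(\infty)$ is bounded; (ii) $T:H^\infty\to\mathrm{BMOA}$ is bounded; (iii) $T:H^\infty\to\mathcal{B}$ is bounded; (iv) $\omega\in\widehat{\mathcal{D}}$.
   Context: $\mathbb{D}$ is the open unit disc of $\mathbb{C}$, $\mathcal{H}(\mathbb{D})$ the space of analytic functions on $\mathbb{D}$, $dA=\frac{dx\,dy}{\pi}$. Radial weights: a radial weight is a nonnegative $\omega\in L^1([0,1))$, extended to $\mathbb{D}$ by $\omega(z)=\omega(|z|)$; standing assumption: $\widehat{\omega}(r)=\int_r^1\omega(s)\,ds>0$ for all $0\le r<1$. Moments: $\omega_x=\int_0^1 r^x\omega(r)\,dr$, $x\ge0$. $\omega\in\widehat{\mathcal{D}}$ if there is $C>1$ with $\widehat{\omega}(r)\le C\,\widehat{\omega}(\frac{1+r}{2})$ for all $0\le r<1$. Operators: $B^\omega_z(\zeta)=\sum_{n\ge0}\frac{(\overline{z}\zeta)^n}{2\omega_{2n+1}}$ is the reproducing kernel of the Bergman space $A^2_\omega=\{f\in\mathcal{H}(\mathbb{D}):\int_{\mathbb{D}}|f|^2\omega\,dA<\infty\}$, and $$H_\omega(f)(z)=\int_0^1 f(t)\left(\frac1z\int_0^zB^\omega_t(\zeta)\,d\zeta\right)\omega(t)\,dt,\qquad \widetilde{H_\omega}(f)(z)=\int_0^1|f(t)|\left(\frac1z\int_0^zB^\omega_t(\zeta)\,d\zeta\right)\omega(t)\,dt.$$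 $T:X\to Y$ is bounded if $T(f)$ is well defined and belongs to $Y$ for every $f\in X$, and $\sup_{\|f\|_X\le1}\|T(f)\|_Y<\infty$. Spaces: $H^\infty$ is the space of bounded analytic functions on $\mathbb{D}$ with the sup norm. $HL(\infty)$ consists of $f(z)=\sum_{n\ge 0}\widehat f(n)z^n\in\mathcal{H}(\mathbb{D})$ with $\|f\|_{HL(\infty)}=\sup_{n\ge0}(n+1)|\widehat f(n)|<\infty$. $\mathrm{BMOA}$ is the space of functions in the Hardy space $H^1$ whose boundary values have bounded mean oscillation on $\partial\mathbb{D}$; up to equivalence its norm is given by $\|f\|^2=|f(0)|^2+\sup_{a\in\mathbb{D}}\int_{\mathbb{D}}|f'(z)|^2(1-|\varphi_a(z)|^2)\,dA(z)$, $\varphi_a(z)=\frac{a-z}{1-\overline{a}z}$. The Bloch space $\mathcal{B}$ consists of $f\in\mathcal{H}(\mathbb{D})$ with $\|f\|_{\mathcal{B}}=|f(0)|+\sup_{z\in\mathbb{D}}(1-|z|^2)|f'(z)|<\infty$. *)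

theory Defs
  imports "HOL-Complex_Analysis.Complex_Analysis"
begin

abbreviation unit_disc :: "complex set" where
  "unit_disc \<equiv> ball 0 1"


section \<open>Radial weights\<close>

definition weight_tail :: "(real \<Rightarrow> real) \<Rightarrow> real \<Rightarrow> real" where
  "weight_tail \<omega> r = (LINT s:{r..<1}|lebesgue. \<omega> s)"

text \<open>A weight is represented by its radial profile; only its values on \<open>[0,1)\<close> matter.\<close>

definition radial_weight :: "(real \<Rightarrow> real) \<Rightarrow> bool" where
  "radial_weight \<omega> \<longleftrightarrow>
     (\<forall>r\<in>{0..<1}. 0 \<le> \<omega> r) \<and>
     set_integrable lebesgue {0..<1} \<omega> \<and>
     (\<forall>r\<in>{0..<1}. 0 < weight_tail \<omega> r)"

text \<open>The convention \<open>0 powr 0 = 0\<close> affects the integrand only at the null set \<open>{0}\<close>.\<close>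

definition weight_moment :: "(real \<Rightarrow> real) \<Rightarrow> real \<Rightarrow> real" where
  "weight_moment \<omega> x = (LINT r:{0..<1}|lebesgue. r powr x * \<omega> r)"

definition doubling_weights :: "(real \<Rightarrow> real) set" where
  "doubling_weights =
     {\<omega>. \<exists>C>1. \<forall>r\<in>{0..<1}. weight_tail \<omega> r \<le> C * weight_tail \<omega> ((1 + r) / 2)}"


section \<open>The Hilbert-type operators\<close>

definition bergman_kernel :: "(real \<Rightarrow> real) \<Rightarrow> complex \<Rightarrow> complex \<Rightarrow> complex" where
  "bergman_kernel \<omega> z \<zeta> =
     (\<Sum>n. (cnj z * \<zeta>) ^ n / of_real (2 * weight_moment \<omega> (real (2 * n + 1))))"

text \<open>The average \<open>(1/z) \<integral>\<^sub>0\<^sup>z B\<^sub>t(\<zeta>) d\<zeta>\<close> has a removable singularity at \<open>z = 0\<close>,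
  where it takes the value \<open>B\<^sub>t(0)\<close>.\<close>

definition kernel_average :: "(real \<Rightarrow> real) \<Rightarrow> real \<Rightarrow> complex \<Rightarrow> complex" where
  "kernel_average \<omega> t z =
     (if z = 0 then bergman_kernel \<omega> (of_real t) 0
      else 1 / z * contour_integral (linepath 0 z) (bergman_kernel \<omega> (of_real t)))"

text \<open>Each operator comes with its domain: the functions for which the defining integral
  converges absolutely at every point of the disc.\<close>

definition hilbert_op :: "(real \<Rightarrow> real) \<Rightarrow> (complex \<Rightarrow> complex) \<Rightarrow> complex \<Rightarrow> complex" where
  "hilbert_op \<omega> f z =
     (LINT t:{0..<1}|lebesgue. f (of_real t) * kernel_average \<omega> t z * of_real (\<omega> t))"

definition hilbert_dom :: "(real \<Rightarrow> real) \<Rightarrow> (complex \<Rightarrow> complex) set" where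
  "hilbert_dom \<omega> =
     {f. \<forall>z\<in>unit_disc. set_integrable lebesgue {0..<1}
            (\<lambda>t. f (of_real t) * kernel_average \<omega> t z * of_real (\<omega> t))}"

definition hilbert_abs_op :: "(real \<Rightarrow> real) \<Rightarrow> (complex \<Rightarrow> complex) \<Rightarrow> complex \<Rightarrow> complex" where
  "hilbert_abs_op \<omega> f z =
     (LINT t:{0..<1}|lebesgue.
        of_real (norm (f (of_real t))) * kernel_average \<omega> t z * of_real (\<omega> t))"

definition hilbert_abs_dom :: "(real \<Rightarrow> real) \<Rightarrow> (complex \<Rightarrow> complex) set" where
  "hilbert_abs_dom \<omega> =
     {f. \<forall>z\<in>unit_disc. set_integrable lebesgue {0..<1}
            (\<lambda>t. of_real (norm (f (of_real t))) * kernel_average \<omega> t z * of_real (\<omega> t))}"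

text \<open>Spaces are given by a carrier set and an extended-valued norm. Operators need not be
  linear.\<close>

definition bounded_operator ::
  "((complex \<Rightarrow> complex) \<Rightarrow> complex \<Rightarrow> complex) \<Rightarrow> (complex \<Rightarrow> complex) set \<Rightarrow>
   (complex \<Rightarrow> complex) set \<Rightarrow> ((complex \<Rightarrow> complex) \<Rightarrow> ennreal) \<Rightarrow>
   (complex \<Rightarrow> complex) set \<Rightarrow> ((complex \<Rightarrow> complex) \<Rightarrow> ennreal) \<Rightarrow> bool" where
  "bounded_operator T D X normX Y normY \<longleftrightarrow>
     X \<subseteq> D \<and> T ` X \<subseteq> Y \<and> (SUP f\<in>{f\<in>X. normX f \<le> 1}. normY (T f)) < top"


section \<open>Function spaces on the disc\<close>

definition Hinf_norm :: "(complex \<Rightarrow> complex) \<Rightarrow> ennreal" where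
  "Hinf_norm f = (SUP z\<in>unit_disc. ennreal (norm (f z)))"

definition Hinf :: "(complex \<Rightarrow> complex) set" where
  "Hinf = {f. f holomorphic_on unit_disc \<and> Hinf_norm f < top}"

definition HLinf_norm :: "(complex \<Rightarrow> complex) \<Rightarrow> ennreal" where
  "HLinf_norm f = (SUP n. ennreal (real (n + 1) * norm (fps_nth (fps_expansion f 0) n)))"

definition HLinf :: "(complex \<Rightarrow> complex) set" where
  "HLinf = {f. f holomorphic_on unit_disc \<and> HLinf_norm f < top}"

definition bloch_norm :: "(complex \<Rightarrow> complex) \<Rightarrow> ennreal" where
  "bloch_norm f =
     ennreal (norm (f 0)) + (SUP z\<in>unit_disc. ennreal ((1 - (norm z)\<^sup>2) * norm (deriv f z)))"

definition bloch_space :: "(complex \<Rightarrow> complex) set" where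
  "bloch_space = {f. f holomorphic_on unit_disc \<and> bloch_norm f < top}"

definition hardy_H1 :: "(complex \<Rightarrow> complex) set" where
  "hardy_H1 = {f. f holomorphic_on unit_disc \<and>
     (SUP r\<in>{0..<1}. \<integral>\<^sup>+ \<theta>\<in>{0..2*pi}. ennreal (norm (f (of_real r * cis \<theta>)) / (2*pi)) \<partial>lebesgue) < top}"

text \<open>For \<open>f\<close> in the Hardy space the radial limit exists at almost every point of the circle
  (Fatou); elsewhere \<open>Lim\<close> returns an unspecified value.\<close>

definition boundary_value :: "(complex \<Rightarrow> complex) \<Rightarrow> complex \<Rightarrow> complex" where
  "boundary_value f \<xi> = Lim (at_left 1) (\<lambda>r::real. f (of_real r * \<xi>))"

definition arc_mean :: "(complex \<Rightarrow> complex) \<Rightarrow> real \<Rightarrow> real \<Rightarrow> complex" where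
  "arc_mean u a b = (LINT \<theta>:{a..b}|lebesgue. u (cis \<theta>)) / of_real (b - a)"

text \<open>Arcs of the circle are the images of \<open>[a,b]\<close> under \<open>cis\<close> with \<open>a < b \<le> a + 2\<pi>\<close>.\<close>

definition circle_BMO :: "(complex \<Rightarrow> complex) set" where
  "circle_BMO =
     {u. set_integrable lebesgue {0..2*pi} (\<lambda>\<theta>. u (cis \<theta>)) \<and>
         (\<exists>C. \<forall>a b. a < b \<longrightarrow> b \<le> a + 2*pi \<longrightarrow>
            (LINT \<theta>:{a..b}|lebesgue. norm (u (cis \<theta>) - arc_mean u a b)) / (b - a) \<le> C)}"

definition BMOA :: "(complex \<Rightarrow> complex) set" where
  "BMOA = {f\<in>hardy_H1. boundary_value f \<in> circle_BMO}"

definition disc_aut :: "complex \<Rightarrow> complex \<Rightarrow> complex" where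
  "disc_aut a z = (a - z) / (1 - cnj a * z)"

definition BMOA_norm_sq :: "(complex \<Rightarrow> complex) \<Rightarrow> ennreal" where
  "BMOA_norm_sq f =
     ennreal ((norm (f 0))\<^sup>2) +
     (SUP a\<in>unit_disc. \<integral>\<^sup>+ z\<in>unit_disc.
        ennreal ((norm (deriv f z))\<^sup>2 * (1 - (norm (disc_aut a z))\<^sup>2) / pi) \<partial>lebesgue)"

definition BMOA_norm :: "(complex \<Rightarrow> complex) \<Rightarrow> ennreal" where
  "BMOA_norm f =
     (if BMOA_norm_sq f = top then top else ennreal (sqrt (enn2real (BMOA_norm_sq f))))"

end

theory Submission
  imports Defs "HOL-Real_Asymp.Real_Asymp"
begin

text \<open>
  Write \<open>m\<^sub>n = \<integral>\<^sub>0\<^sup>1 t\<^sup>n \<omega>(t) dt\<close>. Integrating the kernel series term by term shows that \<open>T f\<close> has Taylor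
  coefficients of modulus at most \<open>\<parallel>f\<parallel> m\<^sub>n / (2 (n + 1) m\<^sub>2\<^sub>n\<^sub>+\<^sub>1)\<close>, with equality for \<open>f = 1\<close>. If \<open>\<omega>\<close> is
  doubling, then \<open>m\<^sub>n / m\<^sub>2\<^sub>n\<^sub>+\<^sub>1\<close> is bounded, because \<open>m\<^sub>n\<close> is the integral of \<open>n s\<^sup>n\<^sup>-\<^sup>1\<close> against the tail
  and \<open>2s - 1 \<le> s\<^sup>2\<close>; so \<open>T\<close> maps into \<open>HL(\<infinity>)\<close>, which embeds continuously into the Bloch space and into
  BMOA. Conversely, each of the three boundedness statements puts \<open>T 1\<close> into the Bloch space; its
  coefficients are positive, so a partial sum of the derivative gives \<open>m\<^sub>4\<^sub>k \<le> C m\<^sub>6\<^sub>k\<close>, and iterating this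
  inequality gives the doubling property.

  The embedding \<open>HL(\<infinity>) \<subseteq> BMOA\<close> is elementary: the coefficients of \<open>f'\<close> are bounded, so the mean of
  \<open>|f'|\<close> over an arc of length \<open>h\<close> of the circle of radius \<open>s\<close> is at most a constant times
  \<open>(h (1 - s))\<^sup>-\<^sup>1\<^sup>/\<^sup>2\<close>, which is integrable in \<open>s\<close>. Hence \<open>f\<close> has finite radial variation almost
  everywhere, which yields the boundary values and their mean oscillation at once.
\<close>

section \<open>Moments of a radial weight\<close>

text \<open>BMOA enters in two guises: its carrier asks for boundary values of bounded mean
  oscillation, its norm is a Garsia integral over the disc, and each gets its own estimate. Radial
  variation settles membership. For the norm, the denominator of the Moebius weight is attached to
  the derivative: \<open>f' / (1 - cnj \<alpha> z)\<close> has Taylor coefficients bounded by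
  \<open>C\<close> times both \<open>n + 1\<close> and \<open>1 / (1 - |\<alpha>|)\<close>, so its
  weighted square sum is of order \<open>1 / (1 - |\<alpha>|)\<close>, which the remaining factor
  \<open>1 - |\<alpha>|\<^sup>2\<close> cancels. Conversely, the Garsia norm controls the Bloch
  seminorm because the Moebius weight is at least 3/4 on a disc about \<open>a\<close> of radius
  \<open>(1 - |a|) / 2\<close>.

  The exponents \<open>4k\<close> and \<open>6k\<close> come from a block of \<open>k\<close>
  consecutive coefficients: a block long enough to balance the Bloch factor of order
  \<open>1/k\<close> spreads the indices, so monotonicity of the moments yields the ratio 3/2
  instead of 2. Any fixed ratio above 1 can be iterated: \<open>k\<close> doublings of the exponent
  cost \<open>B ^ k\<close>, whereas the part of the moment away from the boundary decays like
  \<open>exp (- (2 ^ k - 1) / 2)\<close>.\<close>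

definition moment :: "(real \<Rightarrow> real) \<Rightarrow> nat \<Rightarrow> real" where
  "moment \<omega> n = (LINT r:{0..<1}|lebesgue. r ^ n * \<omega> r)"

text \<open>The product is dominated by \<open>B * \<omega>\<close>. Measurability is known only on
  \<open>A\<close>, so the product is formed after both factors have been cut off to
  \<open>A\<close>.\<close>

lemma set_integrable_bounded_mult_weight:
  fixes g :: "real \<Rightarrow> 'b::{real_normed_field, banach, second_countable_topology}"
  assumes "set_integrable lebesgue A \<omega>"
    and "set_borel_measurable lebesgue A g"
    and "\<And>t. t \<in> A \<Longrightarrow> norm (g t) \<le> B"
  shows "set_integrable lebesgue A (\<lambda>t. g t * of_real (\<omega> t))"
proof -
  have 1: "integrable lebesgue (\<lambda>t. B * (indicator A t *\<^sub>R \<omega> t))"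
    using assms(1) unfolding set_integrable_def by (rule integrable_mult_right)
  have 2: "(\<lambda>t. indicator A t *\<^sub>R \<omega> t) \<in> borel_measurable lebesgue"
    using assms(1) unfolding set_integrable_def by (rule borel_measurable_integrable)
  have "(\<lambda>t. (indicator A t *\<^sub>R g t) * of_real (indicator A t *\<^sub>R \<omega> t)) \<in> borel_measurable lebesgue"
    using assms(2) 2 unfolding set_borel_measurable_def by measurable
  also have "(\<lambda>t. (indicator A t *\<^sub>R g t) * of_real (indicator A t *\<^sub>R \<omega> t))
      = (\<lambda>t. indicator A t *\<^sub>R (g t * of_real (\<omega> t)))"
    by (auto simp: indicator_def fun_eq_iff)
  finally show ?thesis
    unfolding set_integrable_def
    by (intro Bochner_Integration.integrable_bound[OF 1])
      (auto simp: indicator_def norm_mult abs_mult intro!: mult_right_mono assms(3) 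
        intro: order_trans[OF assms(3) abs_ge_self])
qed

lemma set_borel_measurable_continuous_lebesgue:
  fixes g :: "real \<Rightarrow> 'b::real_normed_vector"
  assumes "continuous_on A g" "A \<in> sets borel"
  shows "set_borel_measurable lebesgue A g"
proof -
  have "set_borel_measurable borel A g"
    using assms set_measurable_continuous_on by blast
  then show ?thesis
    unfolding set_borel_measurable_def by (simp add: measurable_completion)
qed

locale weight =
  fixes \<omega> :: "real \<Rightarrow> real"
  assumes radial: "radial_weight \<omega>"
begin

lemma nonneg: "0 \<le> r \<Longrightarrow> r < 1 \<Longrightarrow> 0 \<le> \<omega> r"
  and integrable: "set_integrable lebesgue {0..<1} \<omega>"
  and tail_pos: "0 \<le> r \<Longrightarrow> r < 1 \<Longrightarrow> 0 < weight_tail \<omega> r"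
  using radial by (auto simp: radial_weight_def)

lemma power_integrable: "set_integrable lebesgue {0..<1} (\<lambda>r. r ^ n * \<omega> r)"
proof -
  have "set_integrable lebesgue {0..<1} (\<lambda>r. r ^ n * of_real (\<omega> r))"
    by (rule set_integrable_bounded_mult_weight[OF integrable, where B = 1])
      (auto intro!: set_borel_measurable_continuous_lebesgue continuous_intros power_le_one)
  then show ?thesis by simp
qed

text \<open>The exponent is a successor because at \<open>r = 0\<close> the two powers agree only
  for positive exponents: \<open>0 powr 0 = 0\<close>, but \<open>0 ^ 0 = 1\<close>.\<close>

lemma moment_conv_weight_moment: "weight_moment \<omega> (real (Suc n)) = moment \<omega> (Suc n)"
  unfolding weight_moment_def moment_def
proof (rule set_lebesgue_integral_cong)
  show "\<forall>r. r \<in> {0..<1} \<longrightarrow> r powr real (Suc n) * \<omega> r = r ^ Suc n * \<omega> r"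
  proof (intro allI impI)
    fix r :: real assume "r \<in> {0..<1}"
    then have "r = 0 \<or> 0 < r" by auto
    then show "r powr real (Suc n) * \<omega> r = r ^ Suc n * \<omega> r"
      using powr_realpow[of r "Suc n"] by auto
  qed
qed simp

text \<open>On \<open>[r, 1)\<close> the power is at least \<open>r ^ n\<close>. This gives
  positivity of the moments, convergence of the kernel series in the disc and, for \<open>n\<close>
  of order \<open>1 / (1 - r)\<close>, control of the tail by a moment.\<close>

lemma power_tail_le_moment:
  assumes "0 \<le> r" "r < 1"
  shows "r ^ n * weight_tail \<omega> r \<le> moment \<omega> n"
proof -
  have i: "set_integrable lebesgue {r..<1} \<omega>"
    by (rule set_integrable_subset[OF integrable]) (use assms in auto)
  have "r ^ n * weight_tail \<omega> r = (LINT t:{r..<1}|lebesgue. r ^ n * \<omega> t)"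
    by (simp add: weight_tail_def)
  also have "\<dots> \<le> (LINT t:{0..<1}|lebesgue. t ^ n * \<omega> t)"
    unfolding set_lebesgue_integral_def
  proof (rule integral_mono)
    show "integrable lebesgue (\<lambda>t. indicat_real {r..<1} t *\<^sub>R (r ^ n * \<omega> t))"
      using set_integrable_mult_right[of "r^n", OF i] by (simp add: set_integrable_def)
    show "integrable lebesgue (\<lambda>t. indicat_real {0..<1} t *\<^sub>R (t ^ n * \<omega> t))"
      using power_integrable by (simp add: set_integrable_def)
  qed (use assms in \<open>auto simp: indicator_def intro!: mult_right_mono power_mono mult_nonneg_nonneg nonneg\<close>)
  finally show ?thesis by (simp add: moment_def)
qed

lemma moment_pos: "0 < moment \<omega> n"
proof -
  have "0 < (1/2) ^ n * weight_tail \<omega> (1/2)"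
    by (intro mult_pos_pos tail_pos) auto
  also have "\<dots> \<le> moment \<omega> n" by (rule power_tail_le_moment) auto
  finally show ?thesis .
qed

lemma moment_antimono: "m \<le> n \<Longrightarrow> moment \<omega> n \<le> moment \<omega> m"
  unfolding moment_def
  by (rule set_integral_mono[OF power_integrable power_integrable])
    (auto intro!: mult_right_mono power_decreasing nonneg)

section \<open>Comparison of moments with tails\<close>

lemma tail_antimono:
  assumes "0 \<le> r" "r \<le> s" "s < 1"
  shows "weight_tail \<omega> s \<le> weight_tail \<omega> r"
proof -
  have i: "set_integrable lebesgue {r..<1} \<omega>" "set_integrable lebesgue {s..<1} \<omega>"
    by (rule set_integrable_subset[OF integrable]; use assms in auto)+
  show ?thesis
    unfolding weight_tail_def set_lebesgue_integral_def
    by (rule integral_mono) (use assms i in \<open>auto simp: indicator_def set_integrable_def intro!: nonneg\<close>)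
qed

text \<open>Split the integral at \<open>s\<close>: below \<open>s\<close> the extra factor
  \<open>t ^ k\<close> is at most \<open>s ^ k\<close>, above it the whole power is at most
  1.\<close>

lemma moment_add_le:
  assumes "0 \<le> s" "s < 1"
  shows "moment \<omega> (n + k) \<le> s ^ k * moment \<omega> n + weight_tail \<omega> s"
proof -
  have i: "set_integrable lebesgue {s..<1} \<omega>"
    by (rule set_integrable_subset[OF integrable]) (use assms in auto)
  have *: "t ^ (n + k) * \<omega> t \<le> s ^ k * (t ^ n * \<omega> t) + indicator {s..<1} t * \<omega> t"
    if "0 \<le> t" "t < 1" for t
  proof (cases "t < s")
    case True
    then have "t ^ k \<le> s ^ k" using that by (intro power_mono) auto
    then have "t ^ k * (t ^ n * \<omega> t) \<le> s ^ k * (t ^ n * \<omega> t)"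
      using that by (intro mult_right_mono mult_nonneg_nonneg nonneg) auto
    then show ?thesis using True by (simp add: power_add mult_ac)
  next
    case False
    have "t ^ (n + k) * \<omega> t \<le> 1 * \<omega> t"
      using that by (intro mult_right_mono power_le_one nonneg) auto
    moreover have "0 \<le> s ^ k * (t ^ n * \<omega> t)" using that assms by (intro mult_nonneg_nonneg nonneg) auto
    ultimately show ?thesis using False that by (simp add: indicator_def)
  qed
  have "moment \<omega> (n + k) \<le> (LINT t|lebesgue. s ^ k * (indicator {0..<1} t *\<^sub>R (t ^ n * \<omega> t))
     + indicator {s..<1} t *\<^sub>R \<omega> t)"
    unfolding moment_def set_lebesgue_integral_def
    by (rule integral_mono) (use assms i power_integrable * in 
      \<open>auto simp: indicator_def set_integrable_def intro!: nonneg Bochner_Integration.integrable_add integrable_mult_right split: if_splits\<close>)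
  also have "\<dots> = s ^ k * moment \<omega> n + weight_tail \<omega> s"
    unfolding moment_def weight_tail_def set_lebesgue_integral_def
    by (subst Bochner_Integration.integral_add) (use i power_integrable in \<open>auto simp: set_integrable_def\<close>)
  finally show ?thesis .
qed

text \<open>Tonelli on the triangle \<open>0 \<le> s \<le> t < 1\<close>, with \<open>t ^ n\<close>
  written as the integral of its derivative. It converts a pointwise condition on tails into one on
  moments.\<close>

lemma moment_layer_cake:
  assumes "n \<ge> 1"
  shows "ennreal (moment \<omega> n) =
    (\<integral>\<^sup>+ s\<in>{0..<1}. ennreal (real n * s ^ (n - 1) * weight_tail \<omega> s) \<partial>lborel)"
proof -
  \<comment> \<open>Tonelli is used on Borel functions while \<open>\<omega>\<close> is only
    Lebesgue measurable, so it is replaced by a Borel function that agrees with it almost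
    everywhere.\<close>
  obtain w where w[measurable]: "w \<in> borel_measurable lborel"
    and ae: "AE t in lborel. indicator {0..<1} t *\<^sub>R \<omega> t = w t"
    using completion_ex_borel_measurable_real[of "\<lambda>t. indicator {0..<1} t *\<^sub>R \<omega> t" lborel]
      integrable[unfolded set_integrable_def] by auto
  define W where "W t = ennreal (w t) * indicator {0..<1} t" for t
  have W[measurable]: "W \<in> borel_measurable borel" unfolding W_def using w by simp
  have key: "ennreal (LINT t:A|lebesgue. g t * \<omega> t) = (\<integral>\<^sup>+ t\<in>A. ennreal (g t) * W t \<partial>lborel)"
    if A[measurable]: "A \<in> sets borel" "A \<subseteq> {0..<1}"
      and gm[measurable]: "g \<in> borel_measurable borel"
      and g: "\<And>t. t \<in> A \<Longrightarrow> 0 \<le> g t" and gi: "set_integrable lebesgue A (\<lambda>t. g t * \<omega> t)"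
    for A g
  proof -
    have "ennreal (LINT t:A|lebesgue. g t * \<omega> t)
        = (\<integral>\<^sup>+ t. ennreal (indicator A t *\<^sub>R (g t * \<omega> t)) \<partial>lebesgue)"
      unfolding set_lebesgue_integral_def
      by (rule nn_integral_eq_integral[symmetric])
        (use gi g that(2) in \<open>auto simp: set_integrable_def indicator_def intro!: AE_I2 mult_nonneg_nonneg nonneg\<close>)
    also have "\<dots> = (\<integral>\<^sup>+ t. ennreal (g t) * W t * indicator A t \<partial>lebesgue)"
      using AE_completion[OF ae] 
    proof (intro nn_integral_cong_AE, eventually_elim)
      case (elim t)
      show ?case
      proof (cases "t \<in> A")
        case True
        then have "t \<in> {0..<1}" using that(2) by auto
        then show ?thesis using True elim g[of t] nonneg[of t]
          by (auto simp: W_def ennreal_mult)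
      qed auto
    qed
    also have "\<dots> = (\<integral>\<^sup>+ t\<in>A. ennreal (g t) * W t \<partial>lborel)"
      by (rule nn_integral_completion) measurable
    finally show ?thesis .
  qed
  have tail: "ennreal (weight_tail \<omega> s) = (\<integral>\<^sup>+ t. W t * indicator {s..} t \<partial>lborel)"
    if "0 \<le> s" "s < 1" for s
  proof -
    have i: "set_integrable lebesgue {s..<1} \<omega>"
      by (rule set_integrable_subset[OF integrable]) (use that in auto)
    have "ennreal (weight_tail \<omega> s) = (\<integral>\<^sup>+ t\<in>{s..<1}. ennreal 1 * W t \<partial>lborel)"
      unfolding weight_tail_def
      using key[of "{s..<1}" "\<lambda>_. 1"] that i by auto
    also have "\<dots> = (\<integral>\<^sup>+ t. W t * indicator {s..} t \<partial>lborel)"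
      by (intro nn_integral_cong) (auto simp: W_def indicator_def)
    finally show ?thesis .
  qed
  have pw: "ennreal (t ^ n) = (\<integral>\<^sup>+ s. ennreal (real n * s ^ (n - 1)) * indicator {0..t} s \<partial>lborel)"
    if "0 \<le> t" for t :: real
  proof -
    have "(\<integral>\<^sup>+ s. ennreal (real n * s ^ (n - 1)) * indicator {0..t} s \<partial>lborel) = ennreal (t ^ n - 0 ^ n)"
      using that by (intro nn_integral_FTC_Icc) (auto intro!: derivative_eq_intros)
    then show ?thesis using assms by (simp add: power_0_left)
  qed
  have "ennreal (moment \<omega> n) = (\<integral>\<^sup>+ t\<in>{0..<1}. ennreal (t ^ n) * W t \<partial>lborel)"
    unfolding moment_def by (rule key) (use power_integrable in auto)
  also have "\<dots> = (\<integral>\<^sup>+ t. (\<integral>\<^sup>+ s. ennreal (real n * s ^ (n - 1)) * indicator {0..t} s * W t \<partial>lborel) \<partial>lborel)"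
  proof (intro nn_integral_cong, subst nn_integral_multc)
    fix t :: real
    show "ennreal (t ^ n) * W t * indicator {0..<1} t
        = (\<integral>\<^sup>+ s. ennreal (real n * s ^ (n - 1)) * indicator {0..t} s \<partial>lborel) * W t"
    proof (cases "t \<in> {0..<1}")
      case True
      then show ?thesis using pw[of t] by simp
    qed (simp add: W_def)
  qed simp
  \<comment> \<open>The condition \<open>s \<le> t\<close> becomes an indicator on the plane; both
    integrals then run over the whole line and can be exchanged.\<close>
  also have "\<dots> = (\<integral>\<^sup>+ t. (\<integral>\<^sup>+ s. ennreal (real n * s ^ (n - 1)) * indicator {0..} s * (W t * indicator {p. fst p \<le> snd p} (s, t)) \<partial>lborel) \<partial>lborel)"
    by (intro nn_integral_cong) (auto simp: indicator_def)
  also have "\<dots> = (\<integral>\<^sup>+ s. (\<integral>\<^sup>+ t. ennreal (real n * s ^ (n - 1)) * indicator {0..} s * (W t * indicator {p. fst p \<le> snd p} (s, t)) \<partial>lborel) \<partial>lborel)"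
    by (rule lborel_pair.Fubini') measurable
  also have "\<dots> = (\<integral>\<^sup>+ s. ennreal (real n * s ^ (n - 1)) * indicator {0..} s * (\<integral>\<^sup>+ t. W t * indicator {s..} t \<partial>lborel) \<partial>lborel)"
    by (intro nn_integral_cong, subst nn_integral_cmult[symmetric]) (auto simp: indicator_def intro!: nn_integral_cong)
  also have "\<dots> = (\<integral>\<^sup>+ s\<in>{0..<1}. ennreal (real n * s ^ (n - 1) * weight_tail \<omega> s) \<partial>lborel)"
  proof (intro nn_integral_cong)
    fix s :: real
    have z: "(\<integral>\<^sup>+ t. W t * indicator {s..} t \<partial>lborel) = 0" if "s \<ge> 1"
    proof -
      have "(\<integral>\<^sup>+ t. W t * indicator {s..} t \<partial>lborel) = (\<integral>\<^sup>+ t. 0 \<partial>(lborel :: real measure))"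
        using that by (intro nn_integral_cong) (auto simp: W_def indicator_def)
      then show ?thesis by simp
    qed
    show "ennreal (real n * s ^ (n - 1)) * indicator {0..} s * (\<integral>\<^sup>+ t. W t * indicator {s..} t \<partial>lborel)
       = ennreal (real n * s ^ (n - 1) * weight_tail \<omega> s) * indicator {0..<1} s"
      using z tail[of s] tail_pos[of s] by (auto simp: indicator_def ennreal_mult)
  qed
  finally show ?thesis .
qed

text \<open>Substitute \<open>r = (1 + s) / 2\<close> in the layer-cake formula: the hypothesis
  replaces the tail at \<open>s\<close> by \<open>C\<close> times the tail at \<open>r\<close>, the
  Jacobian gives the factor 2, and \<open>(2 * r - 1) ^ (n - 1) \<le> r ^ (2 * n - 2)\<close> raises
  the exponent.\<close>

lemma doubling_step:
  assumes C: "\<And>r. r \<in> {0..<1} \<Longrightarrow> weight_tail \<omega> r \<le> C * weight_tail \<omega> ((1 + r) / 2)" "C > 1"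
    and n: "n \<ge> 1"
  shows "moment \<omega> n \<le> 2 * C * moment \<omega> (2 * n - 1)"
proof -
  have tm: "(\<lambda>s. ennreal (weight_tail \<omega> s) * indicator {0..<1} s) \<in> borel_measurable borel"
  proof -
    \<comment> \<open>Tails decrease, so measurability is read off from the increasing function
      \<open>- weight_tail \<omega>\<close>.\<close>
    have "(\<lambda>s. if s < 0 then 0 else if s < 1 then - weight_tail \<omega> s else 0) \<in> borel_measurable borel"
    proof -
      have "mono_on {0..<1} (\<lambda>s. - weight_tail \<omega> s)"
        by (auto intro!: mono_onI tail_antimono)
      from borel_measurable_mono_on_fnc[OF this]
      have "(\<lambda>s. - weight_tail \<omega> s) \<in> borel_measurable (restrict_space borel {0..<1})" by simp
      then have "(\<lambda>s. if s \<in> {0..<1} then - weight_tail \<omega> s else 0) \<in> borel_measurable borel"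
        by (subst (asm) measurable_restrict_space_iff[where c = 0]) auto
      then show ?thesis by (rule back_subst[of "\<lambda>f. f \<in> borel_measurable borel"]) auto
    qed
    then have "(\<lambda>s. ennreal (- (if s < 0 then 0 else if s < 1 then - weight_tail \<omega> s else 0))) \<in> borel_measurable borel"
      by measurable
    then show ?thesis by (rule back_subst[of "\<lambda>f. f \<in> borel_measurable borel"]) (auto simp: indicator_def)
  qed
  \<comment> \<open>The integrand in the variable \<open>r\<close>. The image of
    \<open>[0, 1)\<close> is \<open>[1/2, 1)\<close>, where the base \<open>2 * r - 1\<close> is
    nonnegative.\<close>
  define G where "G r = ennreal (real n * (2 * r - 1) ^ (n - 1)) * indicator {1/2..} r * (ennreal (weight_tail \<omega> r) * indicator {0..<1} r)" for r
  have Gm[measurable]: "G \<in> borel_measurable borel" unfolding G_def using tm by measurable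
  have "ennreal (moment \<omega> n) = (\<integral>\<^sup>+ s\<in>{0..<1}. ennreal (real n * s ^ (n - 1) * weight_tail \<omega> s) \<partial>lborel)"
    by (rule moment_layer_cake[OF n])
  also have "\<dots> \<le> (\<integral>\<^sup>+ s. ennreal C * G (1/2 + (1/2) * s) \<partial>lborel)"
  proof (intro nn_integral_mono)
    fix s :: real
    show "ennreal (real n * s ^ (n - 1) * weight_tail \<omega> s) * indicator {0..<1} s \<le> ennreal C * G (1/2 + (1/2) * s)"
    proof (cases "s \<in> {0..<1}")
      case True
      have "real n * s ^ (n - 1) * weight_tail \<omega> s \<le> real n * s ^ (n - 1) * (C * weight_tail \<omega> ((1 + s) / 2))"
        using True by (intro mult_left_mono C) auto
      also have "\<dots> = C * (real n * s ^ (n - 1) * weight_tail \<omega> (1/2 + (1/2) * s))"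
        by (simp add: field_simps)
      finally have "ennreal (real n * s ^ (n - 1) * weight_tail \<omega> s) \<le> ennreal (C * (real n * s ^ (n - 1) * weight_tail \<omega> (1/2 + (1/2) * s)))"
        by (rule ennreal_leI)
      also have "\<dots> = ennreal C * G (1/2 + (1/2) * s)"
        using True C(2) tail_pos[of "1/2 + (1/2) * s"]
        by (auto simp: G_def ennreal_mult[symmetric] less_imp_le)
      finally show ?thesis using True by simp
    qed auto
  qed
  also have "\<dots> = ennreal C * (\<integral>\<^sup>+ s. G (1/2 + (1/2) * s) \<partial>lborel)"
    by (intro nn_integral_cmult) measurable
  also have "(\<integral>\<^sup>+ s. G (1/2 + (1/2) * s) \<partial>lborel) = 2 * (\<integral>\<^sup>+ r. G r \<partial>lborel)"
  proof -
    have "(\<integral>\<^sup>+ r. G r \<partial>lborel) = ennreal (1/2) * (\<integral>\<^sup>+ s. G (1/2 + (1/2) * s) \<partial>lborel)"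
      using nn_integral_real_affine[of G "1/2" "1/2"] by simp
    then have "2 * (\<integral>\<^sup>+ r. G r \<partial>lborel) = (ennreal 2 * ennreal (1/2)) * (\<integral>\<^sup>+ s. G (1/2 + (1/2) * s) \<partial>lborel)"
      by (simp add: mult.assoc)
    also have "ennreal 2 * ennreal (1/2) = 1"
      by (subst ennreal_mult[symmetric]) auto
    finally show ?thesis by simp
  qed
  also have "(\<integral>\<^sup>+ r. G r \<partial>lborel) \<le> (\<integral>\<^sup>+ s\<in>{0..<1}. ennreal (real (2*n-1) * s ^ (2*n-1 - 1) * weight_tail \<omega> s) \<partial>lborel)"
  proof (intro nn_integral_mono)
    fix r :: real
    show "G r \<le> ennreal (real (2*n-1) * r ^ (2*n-1 - 1) * weight_tail \<omega> r) * indicator {0..<1} r"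
    proof (cases "r \<in> {1/2..<1}")
      case True
      have "2 * r - 1 \<le> r\<^sup>2" using sum_squares_ge_zero[of "r - 1" 0] by (simp add: power2_eq_square algebra_simps)
      then have "(2 * r - 1) ^ (n - 1) \<le> (r\<^sup>2) ^ (n - 1)" using True by (intro power_mono) auto
      also have "\<dots> = r ^ (2*n-1 - 1)" by (simp only: power_mult[symmetric]) (rule arg_cong[where f = "power r"], simp)
      finally have "real n * (2 * r - 1) ^ (n - 1) * weight_tail \<omega> r \<le> real (2*n-1) * r ^ (2*n-1 - 1) * weight_tail \<omega> r"
        using True n tail_pos[of r] by (intro mult_mono) auto
      then show ?thesis using True tail_pos[of r] by (auto simp: G_def ennreal_mult[symmetric] ennreal_leI less_imp_le)
    qed (auto simp: G_def)
  qed
  also have "\<dots> = ennreal (moment \<omega> (2 * n - 1))"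
    using moment_layer_cake[of "2 * n - 1"] n by simp
  finally have "ennreal (moment \<omega> n) \<le> ennreal C * (2 * ennreal (moment \<omega> (2 * n - 1)))"
    by (simp add: mult_left_mono)
  also have "\<dots> = ennreal (2 * C * moment \<omega> (2 * n - 1))"
    using C(2) moment_pos[of "2*n-1"] by (simp add: ennreal_mult[symmetric] ennreal_mult mult_ac less_imp_le)
  finally show ?thesis using C(2) moment_pos[of "2*n-1"] by (subst (asm) ennreal_le_iff) auto
qed

text \<open>One doubling step ends at \<open>2n - 1\<close>, just short of \<open>2n + 1\<close>; a
  second one reaches \<open>4n - 3\<close>, which is at least \<open>2n + 1\<close> once
  \<open>n \<ge> 2\<close>.\<close>

lemma moment_ratio_bounded:
  assumes "\<omega> \<in> doubling_weights"
  obtains M where "M \<ge> 0" "\<And>n. moment \<omega> n \<le> M * moment \<omega> (2 * n + 1)"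
proof -
  from assms obtain C where C: "\<And>r. r \<in> {0..<1} \<Longrightarrow> weight_tail \<omega> r \<le> C * weight_tail \<omega> ((1 + r) / 2)" "C > 1"
    unfolding doubling_weights_def by blast
  define M where "M = max ((2 * C)\<^sup>2) (moment \<omega> 0 / moment \<omega> 3)"
  have "moment \<omega> n \<le> M * moment \<omega> (2 * n + 1)" for n
  proof (cases "n \<ge> 2")
    case True
    have "moment \<omega> n \<le> 2 * C * moment \<omega> (2 * n - 1)" using doubling_step[OF C] True by simp
    also have "\<dots> \<le> 2 * C * (2 * C * moment \<omega> (2 * (2 * n - 1) - 1))"
      using doubling_step[OF C, of "2 * n - 1"] True C(2) by (intro mult_left_mono) auto
    also have "\<dots> \<le> 2 * C * (2 * C * moment \<omega> (2 * n + 1))"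
      using True C(2) by (intro mult_left_mono moment_antimono) auto
    also have "\<dots> = (2 * C)\<^sup>2 * moment \<omega> (2 * n + 1)" by (simp add: power2_eq_square)
    also have "\<dots> \<le> M * moment \<omega> (2 * n + 1)"
      unfolding M_def using moment_pos[of "2 * n + 1"] by (intro mult_right_mono) auto
    finally show ?thesis .
  next
    case False
    \<comment> \<open>Here \<open>2 * n + 1 \<le> 3\<close>, so the quotient is at most
      \<open>moment \<omega> 0 / moment \<omega> 3\<close>.\<close>
    have "moment \<omega> n \<le> moment \<omega> 0" by (rule moment_antimono) simp
    also have "\<dots> = moment \<omega> 0 / moment \<omega> 3 * moment \<omega> 3" using moment_pos[of 3] by simp
    also have "\<dots> \<le> M * moment \<omega> (2 * n + 1)"
      unfolding M_def using False moment_pos by (intro mult_mono moment_antimono) (auto simp: less_imp_le le_max_iff_disj)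
    finally show ?thesis .
  qed
  moreover have "M \<ge> 0" unfolding M_def by (simp add: le_max_iff_disj)
  ultimately show ?thesis using that by blast
qed

text \<open>For \<open>n\<close> comparable to \<open>1 / (1 - r)\<close> the tail at
  \<open>r\<close> is at most a constant times \<open>moment \<omega> n\<close>, hence times
  \<open>B ^ k * moment \<omega> (2 ^ k * n)\<close>. For a suitable fixed \<open>k\<close>, the
  part of the last moment below \<open>s = (1 + r) / 2\<close> is so small that it can be absorbed,
  which leaves the tail at \<open>s\<close>.\<close>

lemma doubling_weightsI:
  assumes A: "\<And>m. m \<ge> 1 \<Longrightarrow> moment \<omega> (4 * m) \<le> A * moment \<omega> (6 * m)"
  shows "\<omega> \<in> doubling_weights"
proof -
  define B where "B = max (A\<^sup>2) 2"
  have A0: "A \<ge> 0"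
  proof -
    have "0 < A * moment \<omega> 6" using A[of 1] moment_pos[of 4] by simp
    then show ?thesis using moment_pos[of 6] by (simp add: zero_less_mult_iff)
  qed
  have B: "B \<ge> 1" "B > 1" "B > 0" by (auto simp: B_def less_max_iff_disj)
  \<comment> \<open>Two steps of ratio 3/2 give 9/4. Rounding \<open>3 * m / 2\<close> down loses at
    most 3 in the exponent, and \<open>9 * m - 3 \<ge> 8 * m\<close> is where
    \<open>m \<ge> 3\<close> enters.\<close>
  have dbl: "moment \<omega> (4 * m) \<le> B * moment \<omega> (8 * m)" if "m \<ge> 3" for m
  proof -
    have "moment \<omega> (4 * m) \<le> A * moment \<omega> (6 * m)" using A that by simp
    also have "\<dots> \<le> A * moment \<omega> (4 * (3 * m div 2))"
      using A0 by (intro mult_left_mono moment_antimono) auto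
    also have "\<dots> \<le> A * (A * moment \<omega> (6 * (3 * m div 2)))"
      using A0 that by (intro mult_left_mono A) auto
    also have "\<dots> \<le> A * (A * moment \<omega> (8 * m))"
      using A0 that by (intro mult_left_mono moment_antimono) auto
    also have "\<dots> = A\<^sup>2 * moment \<omega> (8 * m)" by (simp add: power2_eq_square)
    also have "\<dots> \<le> B * moment \<omega> (8 * m)"
      unfolding B_def using moment_pos[of "8 * m"] by (intro mult_right_mono) auto
    finally show ?thesis .
  qed
  have iter: "moment \<omega> (4 * m) \<le> B ^ k * moment \<omega> (2 ^ k * (4 * m))" if "m \<ge> 3" for m k
  proof (induction k)
    case (Suc k)
    have "m \<le> 2 ^ k * m" by simp
    then have "moment \<omega> (4 * (2 ^ k * m)) \<le> B * moment \<omega> (8 * (2 ^ k * m))"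
      using that by (intro dbl) linarith
    then have "B ^ k * moment \<omega> (2 ^ k * (4 * m)) \<le> B ^ k * (B * moment \<omega> (2 ^ Suc k * (4 * m)))"
      using B by (intro mult_left_mono) (auto simp: mult_ac)
    then show ?case using Suc by (simp add: mult_ac)
  qed simp
  obtain k :: nat where k: "B ^ k * exp (- (2 ^ k - 1) / 2) \<le> 1/2"
  proof -
    have "((\<lambda>k::nat. B ^ k * exp (- (2 ^ k - 1) / 2)) \<longlongrightarrow> 0) sequentially"
      using B(2) by real_asymp
    then have "eventually (\<lambda>k. B ^ k * exp (- (2 ^ k - 1) / 2) < 1/2) sequentially"
      by (rule order_tendstoD) simp
    then show ?thesis using that by (auto simp: eventually_at_top_linorder intro: less_imp_le)
  qed
  \<comment> \<open>The first entry serves \<open>r \<ge> 1/2\<close>, the second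
    \<open>r < 1/2\<close>, where \<open>(1 + r) / 2 \<le> 3/4\<close>; the added 1 ensures
    \<open>C > 1\<close>.\<close>
  define C where "C = max (exp 32 * (2 * B ^ k)) (weight_tail \<omega> 0 / weight_tail \<omega> (3/4)) + 1"
  have C0: "0 < exp 32 * (2 * B ^ k)" using B by simp
  have "weight_tail \<omega> r \<le> C * weight_tail \<omega> ((1 + r) / 2)" if r: "0 \<le> r" "r < 1" for r
  proof (cases "r < 1/2")
    case True
    have "weight_tail \<omega> r \<le> weight_tail \<omega> 0" using r by (intro tail_antimono) auto
    also have "\<dots> = weight_tail \<omega> 0 / weight_tail \<omega> (3/4) * weight_tail \<omega> (3/4)"
      using tail_pos[of "3/4"] by simp
    also have "\<dots> \<le> C * weight_tail \<omega> ((1 + r) / 2)"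
      unfolding C_def using True r tail_pos[of 0] tail_pos[of "3/4"] C0
      by (intro mult_mono tail_antimono) (auto simp: less_imp_le le_max_iff_disj)
    finally show ?thesis .
  next
    case False
    define s where "s = (1 + r) / 2"
    have s: "0 < s" "s < 1" "1 - s = (1 - r) / 2" using r by (auto simp: s_def field_simps)
    \<comment> \<open>The numerator 3 makes \<open>m \<ge> 3\<close>, as \<open>iter\<close>
      requires, and keeps \<open>n * (1 - r)\<close> between 1 and 16.\<close>
    define m where "m = nat \<lceil>3 / (1 - r)\<rceil>"
    define n where "n = 4 * m"
    have m1: "3 / (1 - r) \<le> real m" unfolding m_def by linarith
    have "3 / (1 - r) \<ge> 3" using r by (simp add: field_simps)
    then have m3: "m \<ge> 3" "real m \<le> 3 / (1 - r) + 1" using m1 unfolding m_def by linarith+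
    have nl: "1 \<le> real n * (1 - r)"
      using m1 r by (simp add: n_def field_simps)
    have nu: "real n * (1 - r) \<le> 16"
    proof -
      have "real m * (1 - r) \<le> (3 / (1 - r) + 1) * (1 - r)"
        using m3 r by (intro mult_right_mono) auto
      also have "\<dots> = 3 + (1 - r)" using r by (simp add: field_simps)
      finally have "real m * (1 - r) \<le> 4" using r by linarith
      then show ?thesis by (simp add: n_def mult.assoc)
    qed
    \<comment> \<open>For \<open>r \<ge> 1/2\<close> one has
      \<open>ln r \<ge> - (2 * (1 - r))\<close>; with \<open>n * (1 - r) \<le> 16\<close> this gives
      32.\<close>
    have "exp (- 32) \<le> r ^ n"
    proof -
      have "ln r \<ge> 1 - 1 / r" using ln_one_minus_pos_lower_bound r False ln_le_minus_one[of "1/r"]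
        by (simp add: ln_div)
      moreover have "1 - 1 / r \<ge> - (2 * (1 - r))"
        using False r mult_nonneg_nonneg[of "2 * r - 1" "1 - r"] by (simp add: field_simps)
      ultimately have "real n * ln r \<ge> real n * - (2 * (1 - r))"
        by (intro mult_left_mono) auto
      then have "real n * ln r \<ge> - 32" using nu by (simp add: algebra_simps)
      then have "exp (- 32) \<le> exp (real n * ln r)" by simp
      also have "\<dots> = r ^ n" using False by (simp add: exp_of_nat_mult)
      finally show ?thesis .
    qed
    then have "exp (- 32) * weight_tail \<omega> r \<le> r ^ n * weight_tail \<omega> r"
      using tail_pos[of r] r by (intro mult_right_mono) auto
    also have "\<dots> \<le> moment \<omega> n" using r by (rule power_tail_le_moment)
    finally have 1: "weight_tail \<omega> r \<le> exp 32 * moment \<omega> n"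
      by (simp add: exp_minus field_simps)
    have 2: "moment \<omega> n \<le> B ^ k * moment \<omega> (2 ^ k * n)"
      unfolding n_def by (rule iter[OF m3(1)])
    have "moment \<omega> (2 ^ k * n) = moment \<omega> (n + (2 ^ k - 1) * n)"
      by (simp add: algebra_simps)
    also have "\<dots> \<le> s ^ ((2 ^ k - 1) * n) * moment \<omega> n + weight_tail \<omega> s"
      using s by (intro moment_add_le) auto
    also have "s ^ ((2 ^ k - 1) * n) \<le> exp (- (2 ^ k - 1) / 2)"
    proof -
      have "ln s \<le> - ((1 - r) / 2)" using ln_le_minus_one[OF s(1)] s(3) by linarith
      then have "real ((2 ^ k - 1) * n) * ln s \<le> real ((2 ^ k - 1) * n) * - ((1 - r) / 2)"
        by (intro mult_left_mono) auto
      also have "\<dots> = - (2 ^ k - 1) / 2 * (real n * (1 - r))" by (simp add: of_nat_diff field_simps)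
      also have "\<dots> \<le> - (2 ^ k - 1) / 2 * 1"
        using nl by (intro mult_left_mono_neg) auto
      finally have "exp (real ((2 ^ k - 1) * n) * ln s) \<le> exp (- (2 ^ k - 1) / 2)" by simp
      moreover have "exp (real ((2 ^ k - 1) * n) * ln s) = s ^ ((2 ^ k - 1) * n)"
        using s by (simp only: exp_of_nat_mult exp_ln)
      ultimately show ?thesis by (simp only:)
    qed
    \<comment> \<open>Fact \<open>2\<close> bounds \<open>moment \<omega> n\<close> by the very
      moment being estimated. The choice of \<open>k\<close> makes the resulting coefficient at most
      1/2, so the term moves to the left-hand side.\<close>
    also have "exp (- (2 ^ k - 1) / 2) * moment \<omega> n
        \<le> exp (- (2 ^ k - 1) / 2) * (B ^ k * moment \<omega> (2 ^ k * n))"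
      using 2 by (intro mult_left_mono) auto
    also have "\<dots> = (B ^ k * exp (- (2 ^ k - 1) / 2)) * moment \<omega> (2 ^ k * n)"
      by (simp add: mult_ac)
    also have "\<dots> \<le> 1 / 2 * moment \<omega> (2 ^ k * n)"
      using k moment_pos[of "2 ^ k * n"] by (intro mult_right_mono) auto
    finally have 3: "moment \<omega> (2 ^ k * n) \<le> 2 * weight_tail \<omega> s"
      using moment_pos[of n] by (simp add: mult_right_mono)
    have "weight_tail \<omega> r \<le> exp 32 * (B ^ k * moment \<omega> (2 ^ k * n))"
      using 1 2 by (smt (verit) exp_gt_zero mult_le_cancel_left_pos)
    also have "\<dots> \<le> exp 32 * (B ^ k * (2 * weight_tail \<omega> s))"
      using 3 B by (intro mult_left_mono) auto
    also have "\<dots> = exp 32 * (2 * B ^ k) * weight_tail \<omega> s" by simp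
    also have "\<dots> \<le> C * weight_tail \<omega> s"
      using tail_pos[of s] s by (intro mult_right_mono) (auto simp: C_def)
    finally show ?thesis by (simp add: s_def)
  qed
  moreover have "C > 1" using C0 unfolding C_def by (simp add: less_max_iff_disj)
  ultimately show ?thesis unfolding doubling_weights_def by auto
qed

end

section \<open>The Taylor series of the operators\<close>

lemma power_series_on_unit_disc:
  fixes a :: "nat \<Rightarrow> complex"
  assumes "\<And>z. norm z < 1 \<Longrightarrow> (\<lambda>n. a n * z ^ n) sums f z"
  shows "f holomorphic_on unit_disc" "fps_nth (fps_expansion f 0) n = a n"
proof -
  show "f holomorphic_on unit_disc"
    by (rule power_series_holomorphic[where a = a]) (use assms in auto)
  have "f has_fps_expansion Abs_fps a"
  proof (rule has_fps_expansionI)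
    show "\<forall>\<^sub>F u in nhds 0. (\<lambda>n. fps_nth (Abs_fps a) n * u ^ n) sums f u"
      using assms by (intro eventually_mono[OF eventually_nhds_ball[of 1]]) auto
  qed
  from fps_nth_fps_expansion[OF this, of n]
  show "fps_nth (fps_expansion f 0) n = a n" by (simp add: fps_expansion_def)
qed

lemma fps_expansion_sums_on_unit_disc:
  assumes "f holomorphic_on unit_disc" "norm z < 1"
  shows "(\<lambda>n. fps_nth (fps_expansion f 0) n * z ^ n) sums f z"
  using holomorphic_power_series[OF assms(1), of z] assms(2)
  by (simp add: fps_expansion_def)

lemma deriv_sums_on_unit_disc:
  assumes hol: "f holomorphic_on unit_disc" and "norm z < 1"
  shows "(\<lambda>n. diffs (fps_nth (fps_expansion f 0)) n * z ^ n) sums deriv f z"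
proof -
  have "fps_nth (fps_expansion (deriv f) 0) n = diffs (fps_nth (fps_expansion f 0)) n" for n
  proof -
    have "fps_nth (fps_expansion (deriv f) 0) n = (deriv ^^ Suc n) f 0 / fact n"
      by (simp add: fps_expansion_def funpow_Suc_right del: funpow.simps)
    also have "\<dots> = diffs (fps_nth (fps_expansion f 0)) n"
      unfolding diffs_def fps_expansion_def by (simp add: field_simps del: funpow.simps of_nat_Suc)
    finally show ?thesis .
  qed
  then show ?thesis
    using fps_expansion_sums_on_unit_disc[OF holomorphic_deriv[OF hol] assms(2)] by simp
qed

section \<open>Convergence and averaging of the kernel series\<close>

context weight
begin

text \<open>Since the moments are at least \<open>r ^ (2 * n + 1) * weight_tail \<omega> r\<close>,
  the series is dominated by a geometric one of ratio \<open>x / r\<^sup>2\<close>. Taking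
  \<open>r\<^sup>2\<close> as the midpoint of \<open>x\<close> and 1 makes that ratio less than
  1.\<close>

lemma summable_power_div_moment:
  assumes "0 \<le> x" "x < 1"
  shows "summable (\<lambda>n. x ^ n / moment \<omega> (2 * n + 1))"
proof -
  define r where "r = sqrt ((1 + x) / 2)"
  have r: "0 < r" "r < 1" "r\<^sup>2 = (1 + x) / 2" using assms by (auto simp: r_def)
  define q where "q = x / r\<^sup>2"
  have q: "0 \<le> q" "q < 1" using assms r by (auto simp: q_def field_simps)
  have "norm (x ^ n / moment \<omega> (2 * n + 1)) \<le> q ^ n * (1 / (r * weight_tail \<omega> r))" for n
  proof -
    have "x ^ n / moment \<omega> (2 * n + 1) \<le> x ^ n / (r ^ (2 * n + 1) * weight_tail \<omega> r)"
      using assms r tail_pos[of r] moment_pos[of "2*n+1"] power_tail_le_moment[of r "2*n+1"]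
      by (intro divide_left_mono mult_pos_pos) auto
    also have "\<dots> = q ^ n * (1 / (r * weight_tail \<omega> r))"
      using r by (simp add: q_def power_divide power_mult)
    finally show ?thesis using assms moment_pos[of "2*n+1"] by simp
  qed
  moreover have "summable (\<lambda>n. q ^ n * (1 / (r * weight_tail \<omega> r)))"
    using q by (intro summable_mult2 summable_geometric) auto
  ultimately show ?thesis by (rule summable_comparison_test'[rotated])
qed

text \<open>The denominators of the averaged kernel: \<open>2 * moment \<omega> (2 * n + 1)\<close>
  is that of the Bergman kernel, and integrating \<open>\<zeta> ^ n\<close> brings in
  \<open>n + 1\<close>.\<close>

definition kernel_denom :: "nat \<Rightarrow> real" where
  "kernel_denom n = 2 * real (n + 1) * moment \<omega> (2 * n + 1)"

lemma kernel_denom_pos: "kernel_denom n > 0"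
  unfolding kernel_denom_def using moment_pos[of "2*n+1"] by simp

lemma summable_power_div_kernel_denom:
  assumes "0 \<le> x" "x < 1"
  shows "summable (\<lambda>n. x ^ n / kernel_denom n)"
proof (rule summable_comparison_test'[OF summable_power_div_moment[OF assms]])
  fix n :: nat
  have "moment \<omega> (2 * n + 1) \<le> kernel_denom n"
    unfolding kernel_denom_def using moment_pos[of "2*n+1"] by simp
  then show "norm (x ^ n / kernel_denom n) \<le> x ^ n / moment \<omega> (2 * n + 1)"
    using assms kernel_denom_pos[of n] moment_pos[of "2*n+1"]
    by (auto intro!: divide_left_mono mult_pos_pos)
qed

lemma bergman_kernel_conv_moment:
  "bergman_kernel \<omega> (of_real t) \<zeta>
    = (\<Sum>n. (of_real t ^ n / of_real (2 * moment \<omega> (2 * n + 1))) * \<zeta> ^ n)"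
proof -
  have "weight_moment \<omega> (real (2 * n + 1)) = moment \<omega> (2 * n + 1)" for n
    using moment_conv_weight_moment[of "2 * n"] by (simp only: Suc_eq_plus1)
  then show ?thesis unfolding bergman_kernel_def by (simp only: power_mult_distrib) simp
qed

text \<open>Integrating the power series of the kernel term by term gives a primitive in the disc;
  the contour integral along the segment is its increment.\<close>

lemma kernel_average_sums:
  fixes z :: complex
  assumes t: "0 \<le> t" "t < 1" and z: "norm z < 1"
  shows "(\<lambda>n. of_real (t ^ n) * z ^ n / of_real (kernel_denom n)) sums kernel_average \<omega> t z"
proof -
  define c where "c n = of_real t ^ n / (of_real (2 * moment \<omega> (2 * n + 1)) :: complex)" for n
  \<comment> \<open>Coefficients of the primitive that vanishes at 0; the shift by one index makes
    \<open>diffs p\<close> the coefficients of the kernel.\<close>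
  define p where "p n = (case n of 0 \<Rightarrow> 0 | Suc k \<Rightarrow> of_real (t ^ k) / (of_real (kernel_denom k) :: complex))" for n
  have dp: "diffs p n = c n" for n
  proof -
    have "of_real (kernel_denom n) = of_nat (Suc n) * (of_real (2 * moment \<omega> (2 * n + 1)) :: complex)"
      by (simp add: kernel_denom_def algebra_simps)
    moreover have "of_nat (Suc n) \<noteq> (0 :: complex)" by (simp only: of_nat_eq_0_iff)
    ultimately show ?thesis
      unfolding diffs_def p_def c_def nat.case by (simp del: of_nat_Suc)
  qed
  have sm: "summable (\<lambda>n. of_real (t ^ n) * w ^ n / of_real (kernel_denom n))" if "norm w < 1" for w :: complex
  proof (rule summable_comparison_test'[OF summable_power_div_kernel_denom[of "norm w"]])
    fix n
    show "norm (of_real (t ^ n) * w ^ n / of_real (kernel_denom n)) \<le> norm w ^ n / kernel_denom n"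
      using t kernel_denom_pos[of n]
      by (auto simp: norm_divide norm_mult norm_power intro!: divide_right_mono mult_left_le_one_le power_le_one)
  qed (use that in auto)
  have ps: "summable (\<lambda>n. p n * w ^ n)" if "norm w < 1" for w :: complex
  proof (subst summable_Suc_iff[symmetric])
    show "summable (\<lambda>n. p (Suc n) * w ^ Suc n)"
      using summable_mult[OF sm[OF that], of w] by (simp add: p_def mult_ac)
  qed
  define P where "P w = (\<Sum>n. p n * w ^ n)" for w :: complex
  have dP: "(P has_field_derivative bergman_kernel \<omega> (of_real t) w) (at w)" if "norm w < 1" for w
  proof -
    \<comment> \<open>Termwise differentiation at \<open>w\<close> asks for convergence at a point
      of larger modulus in the disc; the midpoint of \<open>norm w\<close> and 1 provides
      one.\<close>
    define K :: complex where "K = of_real ((1 + norm w) / 2)"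
    have K: "norm K = (1 + norm w) / 2" unfolding K_def by (simp only: norm_of_real) simp
    then have "summable (\<lambda>n. p n * K ^ n)" using that by (intro ps) (auto simp: K)
    from termdiffs_strong[OF this, of w] show ?thesis
      using that K by (simp add: P_def[abs_def] dp bergman_kernel_conv_moment c_def)
  qed
  show ?thesis
  proof (cases "z = 0")
    case True
    have "kernel_average \<omega> t z = c 0"
      using True by (simp only: kernel_average_def bergman_kernel_conv_moment if_True c_def[symmetric] powser_zero simp_thms)
    moreover have "(\<lambda>n. of_real (t ^ n) * z ^ n / of_real (kernel_denom n)) sums c 0"
      using True powser_sums_zero[of "\<lambda>n. of_real (t ^ n) / of_real (kernel_denom n) :: complex"]
      by (simp add: c_def kernel_denom_def)
    ultimately show ?thesis by simp
  next
    case False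
    have seg: "closed_segment 0 z \<subseteq> ball 0 1"
      using z by (intro closed_segment_subset) auto
    have "(bergman_kernel \<omega> (of_real t) has_contour_integral (P (pathfinish (linepath 0 z)) - P (pathstart (linepath 0 z)))) (linepath 0 z)"
    proof (rule contour_integral_primitive[where S = "ball 0 1"])
      show "(P has_field_derivative bergman_kernel \<omega> (of_real t) x) (at x within ball 0 1)" if "x \<in> ball 0 1" for x
        using dP[of x] that by (auto intro: has_field_derivative_at_within)
      show "path_image (linepath 0 z) \<subseteq> ball 0 1" using seg by (simp only: path_image_linepath)
    qed (rule valid_path_linepath)
    moreover have "P 0 = 0" by (simp add: P_def powser_zero p_def)
    ultimately have "contour_integral (linepath 0 z) (bergman_kernel \<omega> (of_real t)) = P z"
      by (auto dest: contour_integral_unique)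
    then have ka: "kernel_average \<omega> t z = P z / z" using False by (simp add: kernel_average_def)
    have "(\<lambda>n. p n * z ^ n) sums P z" unfolding P_def using ps[OF z] by (rule summable_sums)
    then have "(\<lambda>n. p (Suc n) * z ^ Suc n) sums P z"
      by (subst sums_Suc_iff) (simp add: p_def)
    from sums_divide[OF this, of z] show ?thesis
      using False by (simp add: ka p_def mult_ac)
  qed
qed

text \<open>\<open>F\<close> stands for \<open>f\<close> or \<open>norm f\<close> restricted to the
  radius, so that both operators share one computation.\<close>

definition op_coeff :: "(real \<Rightarrow> complex) \<Rightarrow> nat \<Rightarrow> complex" where
  "op_coeff F n = (LINT t:{0..<1}|lebesgue. F t * of_real (t ^ n) * of_real (\<omega> t)) / of_real (kernel_denom n)"

section \<open>Action on bounded measurable functions of the radius\<close>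

context
  fixes F :: "real \<Rightarrow> complex" and B :: real
  assumes F: "set_borel_measurable lebesgue {0..<1} F" "\<And>t. t \<in> {0..<1} \<Longrightarrow> norm (F t) \<le> B"
begin

lemma bound_nonneg: "B \<ge> 0"
  using order_trans[OF norm_ge_zero F(2)[of 0]] by simp

lemma times_power_integrable:
  "set_integrable lebesgue {0..<1} (\<lambda>t. F t * of_real (t ^ n) * of_real (\<omega> t))"
proof (rule set_integrable_bounded_mult_weight[OF integrable, where B = B])
  have "set_borel_measurable lebesgue {0..<1} (\<lambda>t::real. of_real (t ^ n) :: complex)"
    by (intro set_borel_measurable_continuous_lebesgue continuous_intros) auto
  from borel_measurable_times[OF F(1)[unfolded set_borel_measurable_def] this[unfolded set_borel_measurable_def]]
  show "set_borel_measurable lebesgue {0..<1} (\<lambda>t. F t * of_real (t ^ n))"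
    unfolding set_borel_measurable_def
    by (rule back_subst[of "\<lambda>f. f \<in> borel_measurable lebesgue"]) (auto simp: indicator_def)
  show "norm (F t * of_real (t ^ n)) \<le> B" if "t \<in> {0..<1}" for t
    using mult_mono[OF F(2)[OF that] power_le_one[of t n]] that bound_nonneg
    by (simp add: norm_mult norm_power)
qed

lemma norm_op_coeff_le: "norm (op_coeff F n) \<le> B * moment \<omega> n / kernel_denom n"
proof -
  have "norm (LINT t:{0..<1}|lebesgue. F t * of_real (t ^ n) * of_real (\<omega> t))
      \<le> (LINT t:{0..<1}|lebesgue. B * (t ^ n * \<omega> t))"
    unfolding set_lebesgue_integral_def
  proof (rule Bochner_Integration.integral_norm_bound_integral)
    show "integrable lebesgue (\<lambda>t. indicat_real {0..<1} t *\<^sub>R (B * (t ^ n * \<omega> t)))"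
      using set_integrable_mult_right[OF power_integrable, of B n] by (simp add: set_integrable_def)
    show "integrable lebesgue (\<lambda>t. indicat_real {0..<1} t *\<^sub>R (F t * of_real (t ^ n) * of_real (\<omega> t)))"
      using times_power_integrable by (simp add: set_integrable_def)
    show "norm (indicat_real {0..<1} t *\<^sub>R (F t * of_real (t ^ n) * of_real (\<omega> t)))
       \<le> indicat_real {0..<1} t *\<^sub>R (B * (t ^ n * \<omega> t))" for t
    proof (cases "t \<in> {0..<1}")
      case True
      then have "norm (F t) * (t ^ n * \<omega> t) \<le> B * (t ^ n * \<omega> t)"
        by (intro mult_right_mono F(2) mult_nonneg_nonneg nonneg) auto
      then show ?thesis using True by (simp add: norm_mult norm_power nonneg mult.assoc)
    qed auto
  qed
  also have "\<dots> = B * moment \<omega> n" by (simp add: moment_def)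
  finally show ?thesis using kernel_denom_pos[of n]
    by (simp add: op_coeff_def norm_divide divide_right_mono)
qed

text \<open>The terms are dominated by \<open>norm z ^ n / kernel_denom n * B * \<omega> t\<close>,
  which is summable after integration in \<open>t\<close>. This permits the exchange of series and
  integral and also yields absolute convergence of the defining integral.\<close>

lemma
  assumes z: "norm z < 1"
  shows op_integrable: "set_integrable lebesgue {0..<1} (\<lambda>t. F t * kernel_average \<omega> t z * of_real (\<omega> t))"
    and op_sums: "(\<lambda>n. op_coeff F n * z ^ n) sums
      (LINT t:{0..<1}|lebesgue. F t * kernel_average \<omega> t z * of_real (\<omega> t))"
proof -
  define h where "h n t = (z ^ n / of_real (kernel_denom n)) * (indicat_real {0..<1} t *\<^sub>R (F t * of_real (t ^ n) * of_real (\<omega> t)))" for n t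
  have hi: "integrable lebesgue (h n)" for n
    unfolding h_def using times_power_integrable[of n] by (intro integrable_mult_right) (simp add: set_integrable_def)
  have hs: "(\<lambda>n. h n t) sums (indicat_real {0..<1} t *\<^sub>R (F t * kernel_average \<omega> t z * of_real (\<omega> t)))" for t
  proof (cases "t \<in> {0..<1}")
    case True
    then show ?thesis using sums_mult[OF kernel_average_sums[of t z], of "F t * of_real (\<omega> t)"] z
      by (simp add: h_def mult_ac)
  qed (simp add: h_def)
  have hb: "norm (h n t) \<le> (norm z ^ n / kernel_denom n) * (B * (indicat_real {0..<1} t *\<^sub>R \<omega> t))" for n t
  proof (cases "t \<in> {0..<1}")
    case True
    have "norm (F t) * t ^ n \<le> B * 1"
      using True by (intro mult_mono F(2) power_le_one) (auto simp: bound_nonneg)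
    then have "norm (F t) * t ^ n * \<omega> t \<le> B * \<omega> t" using True
      by (intro mult_right_mono nonneg) auto
    then have "(norm z ^ n / kernel_denom n) * (norm (F t) * t ^ n * \<omega> t) \<le> (norm z ^ n / kernel_denom n) * (B * \<omega> t)"
      using kernel_denom_pos[of n] by (intro mult_left_mono) auto
    then show ?thesis using True kernel_denom_pos[of n]
      by (simp add: h_def norm_mult norm_divide norm_power nonneg mult_ac)
  qed (simp add: h_def)
  have sz: "summable (\<lambda>n. norm z ^ n / kernel_denom n)"
    using z by (intro summable_power_div_kernel_denom) auto
  have 1: "AE t in lebesgue. summable (\<lambda>n. norm (h n t))"
  proof (intro AE_I2)
    fix t
    show "summable (\<lambda>n. norm (h n t))"
      by (rule summable_comparison_test'[OF summable_mult2[OF sz]]) (use hb in simp)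
  qed
  have 2: "summable (\<lambda>n. \<integral>t. norm (h n t) \<partial>lebesgue)"
  proof (rule summable_comparison_test'[OF summable_mult2[OF sz, of "B * (LINT t:{0..<1}|lebesgue. \<omega> t)"]])
    fix n
    have "(\<integral>t. norm (h n t) \<partial>lebesgue) \<le> (\<integral>t. (norm z ^ n / kernel_denom n) * (B * (indicat_real {0..<1} t *\<^sub>R \<omega> t)) \<partial>lebesgue)"
      using integrable hi hb by (intro integral_mono integrable_norm integrable_mult_right) (auto simp: set_integrable_def)
    then show "norm (\<integral>t. norm (h n t) \<partial>lebesgue) \<le> norm z ^ n / kernel_denom n * (B * (LINT t:{0..<1}|lebesgue. \<omega> t))"
      by (simp add: set_lebesgue_integral_def)
  qed
  have eq: "(\<Sum>n. h n t) = indicat_real {0..<1} t *\<^sub>R (F t * kernel_average \<omega> t z * of_real (\<omega> t))" for t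
    using hs by (rule sums_unique[symmetric])
  show "set_integrable lebesgue {0..<1} (\<lambda>t. F t * kernel_average \<omega> t z * of_real (\<omega> t))"
    using integrable_suminf[OF hi 1 2] unfolding eq set_integrable_def .
  have "(\<lambda>n. integral\<^sup>L lebesgue (h n)) sums (LINT t:{0..<1}|lebesgue. F t * kernel_average \<omega> t z * of_real (\<omega> t))"
    using sums_integral[OF hi 1 2] unfolding eq set_lebesgue_integral_def .
  also have "(\<lambda>n. integral\<^sup>L lebesgue (h n)) = (\<lambda>n. op_coeff F n * z ^ n)"
    unfolding h_def op_coeff_def set_lebesgue_integral_def integral_mult_right_zero
    by (simp only: times_divide_eq_left times_divide_eq_right mult.commute)
  finally show "(\<lambda>n. op_coeff F n * z ^ n) sums
      (LINT t:{0..<1}|lebesgue. F t * kernel_average \<omega> t z * of_real (\<omega> t))" .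
qed

end

lemma op_coeff_one: "op_coeff (\<lambda>_. 1) n = of_real (moment \<omega> n / kernel_denom n)"
proof -
  have "(LINT t:{0..<1}|lebesgue. of_real (t ^ n) * of_real (\<omega> t) :: complex) = of_real (moment \<omega> n)"
    unfolding moment_def set_integral_complex_of_real[symmetric] by simp
  then show ?thesis unfolding op_coeff_def by simp
qed

end

section \<open>Area integrals on the disc\<close>

text \<open>The two measures agree on boxes. This opens the way to iterated integrals in the real
  and imaginary part, and so to shears.\<close>

lemma lborel_complex_prod:
  "distr (lborel \<Otimes>\<^sub>M lborel) borel (\<lambda>(x, y). Complex x y) = (lborel :: complex measure)"
proof (rule lborel_eqI[symmetric])
  have [measurable]: "(\<lambda>(x, y). Complex x y) \<in> lborel \<Otimes>\<^sub>M lborel \<rightarrow>\<^sub>M borel"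
    unfolding lborel_prod by (auto intro!: borel_measurable_continuous_onI continuous_intros simp: split_beta' Complex_eq)
  fix l u :: complex
  assume lu: "\<And>b. b \<in> Basis \<Longrightarrow> l \<bullet> b \<le> u \<bullet> b"
  have le: "Re l \<le> Re u" "Im l \<le> Im u"
    using lu[of 1] lu[of \<i>] by (auto simp: Basis_complex_def)
  have "(\<lambda>(x, y). Complex x y) -` box l u = {Re l<..<Re u} \<times> {Im l<..<Im u}"
    by (auto simp: in_box_complex_iff)
  then have "emeasure (distr (lborel \<Otimes>\<^sub>M lborel) borel (\<lambda>(x, y). Complex x y)) (box l u)
      = emeasure (lborel \<Otimes>\<^sub>M lborel) ({Re l<..<Re u} \<times> {Im l<..<Im u})"
    by (subst emeasure_distr) (auto simp: space_pair_measure)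
  also have "\<dots> = ennreal (Re u - Re l) * ennreal (Im u - Im l)"
    using le by (subst lborel.emeasure_pair_measure_Times) auto
  also have "\<dots> = (\<Prod>b\<in>Basis. (u - l) \<bullet> b)"
    using le by (simp add: Basis_complex_def ennreal_mult prod.insert)
  finally show "emeasure (distr (lborel \<Otimes>\<^sub>M lborel) borel (\<lambda>(x, y). Complex x y)) (box l u) = (\<Prod>b\<in>Basis. (u - l) \<bullet> b)" .
qed simp

lemma measurable_Complex [measurable]:
  assumes "f \<in> borel_measurable M" "g \<in> borel_measurable M"
  shows "(\<lambda>x. Complex (f x) (g x)) \<in> borel_measurable M"
proof -
  have "(\<lambda>x. complex_of_real (f x) + \<i> * complex_of_real (g x)) \<in> borel_measurable M"
    using assms by measurable
  then show ?thesis by (simp add: Complex_eq)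
qed

lemma
  fixes H :: "complex \<Rightarrow> ennreal"
  assumes H[measurable]: "H \<in> borel_measurable borel"
  shows nn_integral_complex: "(\<integral>\<^sup>+ z. H z \<partial>lborel) = (\<integral>\<^sup>+ x. \<integral>\<^sup>+ y. H (Complex x y) \<partial>lborel \<partial>lborel)"
    and nn_integral_complex': "(\<integral>\<^sup>+ z. H z \<partial>lborel) = (\<integral>\<^sup>+ y. \<integral>\<^sup>+ x. H (Complex x y) \<partial>lborel \<partial>lborel)"
proof -
  have "(\<integral>\<^sup>+ z. H z \<partial>lborel) = (\<integral>\<^sup>+ z. H z \<partial>distr (lborel \<Otimes>\<^sub>M lborel) borel (\<lambda>(x, y). Complex x y))"
    by (simp only: lborel_complex_prod)
  also have "\<dots> = (\<integral>\<^sup>+ p. H (Complex (fst p) (snd p)) \<partial>(lborel \<Otimes>\<^sub>M lborel))"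
    by (subst nn_integral_distr) (auto simp: split_beta')
  finally have *: "(\<integral>\<^sup>+ z. H z \<partial>lborel) = (\<integral>\<^sup>+ p. H (Complex (fst p) (snd p)) \<partial>(lborel \<Otimes>\<^sub>M lborel))" .
  show 1: "(\<integral>\<^sup>+ z. H z \<partial>lborel) = (\<integral>\<^sup>+ x. \<integral>\<^sup>+ y. H (Complex x y) \<partial>lborel \<partial>lborel)"
    unfolding * by (subst lborel.nn_integral_fst[symmetric]) auto
  show "(\<integral>\<^sup>+ z. H z \<partial>lborel) = (\<integral>\<^sup>+ y. \<integral>\<^sup>+ x. H (Complex x y) \<partial>lborel \<partial>lborel)"
    unfolding 1 by (rule lborel_pair.Fubini'[symmetric]) measurable
qed

section \<open>Invariance of area under shears and rotations\<close>

lemma nn_integral_shear_Re: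
  fixes H :: "complex \<Rightarrow> ennreal"
  assumes H[measurable]: "H \<in> borel_measurable borel"
  shows "(\<integral>\<^sup>+ z. H (Complex (Re z + t * Im z) (Im z)) \<partial>lborel) = (\<integral>\<^sup>+ z. H z \<partial>lborel)"
proof -
  have "(\<integral>\<^sup>+ z. H (Complex (Re z + t * Im z) (Im z)) \<partial>lborel) = (\<integral>\<^sup>+ y. \<integral>\<^sup>+ x. H (Complex (x + t * y) y) \<partial>lborel \<partial>lborel)"
    by (subst nn_integral_complex') simp_all
  also have "\<dots> = (\<integral>\<^sup>+ y. \<integral>\<^sup>+ x. H (Complex x y) \<partial>lborel \<partial>lborel)"
  proof (rule nn_integral_cong)
    fix y :: real
    show "(\<integral>\<^sup>+ x. H (Complex (x + t * y) y) \<partial>lborel) = (\<integral>\<^sup>+ x. H (Complex x y) \<partial>lborel)"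
      using nn_integral_real_affine[of "\<lambda>x. H (Complex x y)" 1 "t * y"] by (simp add: add.commute)
  qed
  finally show ?thesis by (simp add: nn_integral_complex')
qed

lemma nn_integral_shear_Im:
  fixes H :: "complex \<Rightarrow> ennreal"
  assumes H[measurable]: "H \<in> borel_measurable borel"
  shows "(\<integral>\<^sup>+ z. H (Complex (Re z) (Im z + t * Re z)) \<partial>lborel) = (\<integral>\<^sup>+ z. H z \<partial>lborel)"
proof -
  have "(\<integral>\<^sup>+ z. H (Complex (Re z) (Im z + t * Re z)) \<partial>lborel) = (\<integral>\<^sup>+ x. \<integral>\<^sup>+ y. H (Complex x (y + t * x)) \<partial>lborel \<partial>lborel)"
    by (subst nn_integral_complex) simp_all
  also have "\<dots> = (\<integral>\<^sup>+ x. \<integral>\<^sup>+ y. H (Complex x y) \<partial>lborel \<partial>lborel)"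
  proof (rule nn_integral_cong)
    fix x :: real
    show "(\<integral>\<^sup>+ y. H (Complex x (y + t * x)) \<partial>lborel) = (\<integral>\<^sup>+ y. H (Complex x y) \<partial>lborel)"
      using nn_integral_real_affine[of "\<lambda>y. H (Complex x y)" 1 "t * x"] by (simp add: add.commute)
  qed
  finally show ?thesis by (simp add: nn_integral_complex)
qed

lemma nn_integral_rotate:
  fixes H :: "complex \<Rightarrow> ennreal"
  assumes H[measurable]: "H \<in> borel_measurable borel" and u: "norm u = 1"
  shows "(\<integral>\<^sup>+ z. H (u * z) \<partial>lborel) = (\<integral>\<^sup>+ z. H z \<partial>lborel)"
proof -
  have *: "(\<integral>\<^sup>+ z. H (u * z) \<partial>lborel) = (\<integral>\<^sup>+ z. H z \<partial>lborel)"
    if H[measurable]: "H \<in> borel_measurable borel" and u: "norm u = 1" "Im u \<noteq> 0" for H :: "complex \<Rightarrow> ennreal" and u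
  proof -
    \<comment> \<open>a rotation is a product of three shears\<close>
    define c s t where "c = Re u" and "s = Im u" and "t = (c - 1) / s"
    have cs: "c\<^sup>2 + s\<^sup>2 = 1" using u(1) by (simp add: c_def s_def cmod_def)
    have s0: "s \<noteq> 0" using u(2) by (simp add: s_def)
    have e1: "1 + s * t = c" using s0 by (simp add: t_def)
    have e2: "t * c + t = - s"
    proof -
      have "s * (t * c + t) = (s * t) * (c + 1)" by (simp add: algebra_simps)
      also have "\<dots> = (c - 1) * (c + 1)" using e1 by simp
      also have "\<dots> = s * (- s)" using cs by (simp add: power2_eq_square algebra_simps)
      finally have "s * (t * c + t) = s * (- s)" .
      then show ?thesis using s0 by (metis mult_left_cancel)
    qed
    have uz: "u * z = Complex ((Re z + t * Im z) + t * (Im z + s * (Re z + t * Im z))) (Im z + s * (Re z + t * Im z))" for z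
    proof (rule complex_eqI)
      have "Re (u * z) = (1 + s * t) * Re z + (t * (1 + s * t) + t) * Im z"
        unfolding e1 e2 by (simp add: c_def s_def)
      then show "Re (u * z) = Re (Complex ((Re z + t * Im z) + t * (Im z + s * (Re z + t * Im z))) (Im z + s * (Re z + t * Im z)))"
        by (simp add: algebra_simps)
      have "Im (u * z) = s * Re z + (1 + s * t) * Im z"
        unfolding e1 by (simp add: c_def s_def)
      then show "Im (u * z) = Im (Complex ((Re z + t * Im z) + t * (Im z + s * (Re z + t * Im z))) (Im z + s * (Re z + t * Im z)))"
        by (simp add: algebra_simps)
    qed
    have "(\<integral>\<^sup>+ z. H z \<partial>lborel) = (\<integral>\<^sup>+ z. H (Complex (Re z + t * Im z) (Im z)) \<partial>lborel)"
      by (rule nn_integral_shear_Re[symmetric]) measurable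
    also have "\<dots> = (\<integral>\<^sup>+ z. H (Complex (Re z + t * (Im z + s * Re z)) (Im z + s * Re z)) \<partial>lborel)"
      using nn_integral_shear_Im[of "\<lambda>z. H (Complex (Re z + t * Im z) (Im z))" s] by simp
    also have "\<dots> = (\<integral>\<^sup>+ z. H (u * z) \<partial>lborel)"
      unfolding uz using nn_integral_shear_Re[of "\<lambda>z. H (Complex (Re z + t * (Im z + s * Re z)) (Im z + s * Re z))" t] by simp
    finally show ?thesis by simp
  qed
  show ?thesis
  proof (cases "Im u = 0")
    case True
    \<comment> \<open>For \<open>u = 1\<close> or \<open>u = -1\<close> the shear parameter would
      have denominator 0. Instead \<open>u\<close> is the product of \<open>u * - \<i>\<close> and
      \<open>\<i>\<close>, both with nonzero imaginary part.\<close>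
    have "(\<integral>\<^sup>+ z. H ((u * - \<i>) * (\<i> * z)) \<partial>lborel) = (\<integral>\<^sup>+ z. H ((u * - \<i>) * z) \<partial>lborel)"
      by (rule *[of "\<lambda>z. H ((u * - \<i>) * z)" \<i>]) auto
    also have "\<dots> = (\<integral>\<^sup>+ z. H z \<partial>lborel)"
      using True u by (intro *) (auto simp: norm_mult complex_eq_iff cmod_def)
    finally show ?thesis by (simp add: mult.assoc)
  qed (use * u in auto)
qed

text \<open>Stands in for polar coordinates: an area integral may first be averaged over the angle.
  The scale \<open>k\<close> lets the angle parameter run over \<open>[0, 1]\<close> as well as over
  \<open>[0, 2 * pi]\<close>.\<close>

lemma nn_integral_rotation_average:
  fixes H :: "complex \<Rightarrow> ennreal"
  assumes H[measurable]: "H \<in> borel_measurable borel" and A[measurable]: "A \<in> sets borel"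
  shows "emeasure lborel A * (\<integral>\<^sup>+ z. H z \<partial>lborel) = (\<integral>\<^sup>+ z. (\<integral>\<^sup>+ x\<in>A. H (cis (k * x) * z) \<partial>lborel) \<partial>lborel)"
proof -
  have [measurable]: "cis \<in> borel_measurable borel"
    by (intro borel_measurable_continuous_onI continuous_intros)
  have "(\<integral>\<^sup>+ z. (\<integral>\<^sup>+ x\<in>A. H (cis (k * x) * z) \<partial>lborel) \<partial>lborel) = (\<integral>\<^sup>+ x. (\<integral>\<^sup>+ z. H (cis (k * x) * z) * indicator A x \<partial>lborel) \<partial>lborel)"
    by (rule lborel_pair.Fubini') measurable
  also have "\<dots> = (\<integral>\<^sup>+ x. (\<integral>\<^sup>+ z. H z \<partial>lborel) * indicator A x \<partial>lborel)"
    by (intro nn_integral_cong, subst nn_integral_multc) (auto simp: nn_integral_rotate)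
  also have "\<dots> = emeasure lborel A * (\<integral>\<^sup>+ z. H z \<partial>lborel)"
    by (subst nn_integral_cmult) (auto simp: mult.commute)
  finally show ?thesis by simp
qed

text \<open>For \<open>0 \<le> x < 1\<close> the part of the disc where
  \<open>(norm z)\<^sup>2 > x\<close> has area \<open>pi * (1 - x)\<close>. This is linear in
  \<open>x\<close>, so the squared radius, unlike the radius, is uniformly distributed.\<close>

lemma distr_norm_sq_unit_disc:
  "distr (density lborel (indicator unit_disc)) borel (\<lambda>z. (norm z)\<^sup>2) = density lborel (\<lambda>s. ennreal pi * indicator {0..1} s)"
    (is "?M = ?N")
proof (rule measure_eqI_lessThan)
  have M: "emeasure ?M {x<..} = emeasure lborel ({z. x < (norm z)\<^sup>2} \<inter> unit_disc)" for x
  proof -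
    have [measurable]: "{z::complex. x < (norm z)\<^sup>2} \<in> sets borel" by measurable
    have "emeasure ?M {x<..} = emeasure (density lborel (indicator unit_disc)) {z::complex. x < (norm z)\<^sup>2}"
      by (subst emeasure_distr) (auto simp: vimage_def)
    also have "\<dots> = (\<integral>\<^sup>+ z. indicator ({z. x < (norm z)\<^sup>2} \<inter> unit_disc) z \<partial>lborel)"
      by (subst emeasure_density) (auto simp del: nn_integral_indicator intro!: nn_integral_cong borel_measurable_indicator borel_open split: split_indicator)
    also have "\<dots> = emeasure lborel ({z. x < (norm z)\<^sup>2} \<inter> unit_disc)"
      by (rule nn_integral_indicator) (auto intro!: sets.Int borel_open)
    finally show ?thesis .
  qed
  have N: "emeasure ?N {x<..} = ennreal pi * emeasure lborel ({x<..} \<inter> {0..1})" for x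
    by (subst emeasure_density)
      (auto simp: mult.assoc nn_integral_cmult indicator_inter_arith[symmetric] Int_commute)
  have b: "emeasure lborel (ball (0::complex) r) = ennreal (pi * r\<^sup>2)"
    "emeasure lborel (cball (0::complex) r) = ennreal (pi * r\<^sup>2)" if "0 \<le> r" for r
    using that by (simp_all add: emeasure_ball emeasure_cball unit_ball_vol_2)
  show "emeasure ?M {x<..} = emeasure ?N {x<..}" for x
  proof -
    consider "x < 0" | "0 \<le> x" "x < 1" | "1 \<le> x" by linarith
    then show ?thesis
    proof cases
      case 1
      have "{z. x < (norm z)\<^sup>2} \<inter> unit_disc = ball (0::complex) 1"
        using 1 by (auto intro: less_le_trans)
      moreover have "{x<..} \<inter> {0..1} = {0..1}" using 1 by auto
      ultimately show ?thesis unfolding M N using b(1)[of 1] by simp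
    next
      case 2
      have "{z. x < (norm z)\<^sup>2} \<inter> unit_disc = ball (0::complex) 1 - cball 0 (sqrt x)"
        using 2 by (auto simp: not_le real_less_rsqrt real_sqrt_less_iff dest: real_sqrt_less_mono)
          (metis norm_ge_zero real_less_lsqrt not_less_iff_gr_or_eq real_sqrt_less_iff real_sqrt_abs abs_norm_cancel)+
      moreover have "sqrt x < 1" using 2 by simp
      then have sub: "cball 0 (sqrt x) \<subseteq> ball (0::complex) 1" by (metis le_less_trans mem_ball mem_cball subsetI)
      ultimately have "emeasure lborel ({z. x < (norm z)\<^sup>2} \<inter> unit_disc) = emeasure lborel (ball (0::complex) 1) - emeasure lborel (cball (0::complex) (sqrt x))"
        using b(2)[of "sqrt x"] 2 sub by (subst emeasure_Diff[symmetric]) auto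
      also have "\<dots> = ennreal (pi * (1 - x))"
        using 2 b(1)[of 1] b(2)[of "sqrt x"] by (simp add: ennreal_minus right_diff_distrib)
      finally have "emeasure ?M {x<..} = ennreal (pi * (1 - x))" unfolding M .
      moreover have "{x<..} \<inter> {0..1} = {x<..1}" using 2 by auto
      ultimately show ?thesis unfolding N using 2 by (simp add: ennreal_mult)
    next
      case 3
      have "{z. x < (norm z)\<^sup>2} \<inter> unit_disc = ({} :: complex set)"
      proof -
        have "(norm z)\<^sup>2 < 1" if "norm z < 1" for z :: complex
          using that by (simp add: power_less_one_iff abs_square_less_1)
        then show ?thesis using 3 by force
      qed
      moreover have "{x<..} \<inter> {0..1} = {}" using 3 by auto
      ultimately show ?thesis unfolding M N by simp
    qed
  qed
  show "emeasure ?M {x<..} < \<infinity>" for x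
  proof -
    have "emeasure ?M {x<..} \<le> emeasure lborel (ball (0::complex) 1)"
      unfolding M by (intro emeasure_mono) auto
    also have "\<dots> < \<infinity>" by (simp add: b)
    finally show ?thesis .
  qed
qed auto

lemma nn_integral_unit_disc_radial:
  assumes [measurable]: "h \<in> borel_measurable borel"
  shows "(\<integral>\<^sup>+ z\<in>unit_disc. h ((norm z)\<^sup>2) \<partial>lborel) = ennreal pi * (\<integral>\<^sup>+ s\<in>{0..1}. h s \<partial>lborel)"
proof -
  have "(\<integral>\<^sup>+ z\<in>unit_disc. h ((norm z)\<^sup>2) \<partial>lborel) = (\<integral>\<^sup>+ s. h s \<partial>distr (density lborel (indicator unit_disc)) borel (\<lambda>z. (norm z)\<^sup>2))"
    by (subst nn_integral_distr, simp, simp, subst nn_integral_density) (auto simp: mult.commute intro!: borel_measurable_indicator borel_open)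
  also have "\<dots> = ennreal pi * (\<integral>\<^sup>+ s\<in>{0..1}. h s \<partial>lborel)"
    unfolding distr_norm_sq_unit_disc
    by (subst nn_integral_density) (auto simp: nn_integral_cmult[symmetric] mult_ac)
  finally show ?thesis .
qed

text \<open>In the variable \<open>s = (norm z)\<^sup>2\<close> this is \<open>pi\<close> times the
  Beta integral of \<open>s ^ n * (1 - s)\<close>.\<close>

lemma nn_integral_unit_disc_power:
  "(\<integral>\<^sup>+ z\<in>unit_disc. ennreal (((norm z)\<^sup>2) ^ n * (1 - (norm z)\<^sup>2)) \<partial>lborel)
    = ennreal (pi / ((real n + 1) * (real n + 2)))"
proof -
  have d: "((\<lambda>s. s ^ Suc m / real (Suc m)) has_real_derivative x ^ m) (at x)" for m x
    by (auto intro!: derivative_eq_intros simp del: of_nat_Suc power_Suc)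
  have "(\<integral>\<^sup>+ s\<in>{0..1}. ennreal (s ^ n * (1 - s)) \<partial>lborel)
    = ennreal ((1 ^ Suc n / real (Suc n) - 1 ^ Suc (Suc n) / real (Suc (Suc n)))
        - (0 ^ Suc n / real (Suc n) - 0 ^ Suc (Suc n) / real (Suc (Suc n))))"
  proof (rule nn_integral_FTC_Icc)
    show "((\<lambda>s. s ^ Suc n / real (Suc n) - s ^ Suc (Suc n) / real (Suc (Suc n))) has_real_derivative x ^ n * (1 - x)) (at x)" for x
      using DERIV_diff[OF d[of n x] d[of "Suc n" x]] by (simp add: algebra_simps)
  qed auto
  also have "\<dots> = ennreal (1 / ((real n + 1) * (real n + 2)))"
    by (simp add: field_simps)
  finally show ?thesis
    using nn_integral_unit_disc_radial[of "\<lambda>s. ennreal (s ^ n * (1 - s))"]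
    by (simp add: ennreal_mult[symmetric])
qed

lemma circle_mean_square_ge:
  assumes G: "G holomorphic_on ball 0 r" and z: "norm z < r"
  shows "ennreal ((norm (G 0))\<^sup>2) \<le> (\<integral>\<^sup>+ x\<in>{0..1}. ennreal ((norm (G (cis (2 * pi * x) * z)))\<^sup>2) \<partial>lborel)"
proof (cases "z = 0")
  case True
  have "(\<integral>\<^sup>+ x\<in>{0..1::real}. ennreal ((norm (G 0))\<^sup>2) \<partial>lborel) = ennreal ((norm (G 0))\<^sup>2)"
    by (subst nn_integral_cmult_indicator) auto
  then show ?thesis using True by simp
next
  case False
  define H where "H w = G (z * w)" for w
  have sub: "(\<lambda>w. z * w) ` cball 0 1 \<subseteq> ball 0 r"
    using z by (auto simp: norm_mult) (meson le_less_trans mult_right_le_one_le norm_ge_zero)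
  have Hh: "continuous_on (cball 0 1) H" "H holomorphic_on ball 0 1"
  proof -
    have "(G \<circ> (\<lambda>w. z * w)) holomorphic_on cball 0 1"
      using G sub by (intro holomorphic_on_compose_gen[where t = "ball 0 r"] holomorphic_intros) auto
    then have "H holomorphic_on cball 0 1" by (simp add: H_def[abs_def] o_def)
    then show "continuous_on (cball 0 1) H" "H holomorphic_on ball 0 1"
      by (auto intro: holomorphic_on_imp_continuous_on holomorphic_on_subset)
  qed
  have e: "Re (cnj (H 0) * H 0) = (norm (H 0))\<^sup>2"
    by (simp only: cmod_power2) (simp add: power2_eq_square)
  \<comment> \<open>Cauchy's formula on the unit circle, divided by \<open>2 * pi * \<i>\<close>, is
    the mean value property of \<open>H\<close>.\<close>
  have "((\<lambda>u. H u / (u - 0)) has_contour_integral (2 * of_real pi * \<i> * H 0)) (circlepath 0 1)"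
    by (rule Cauchy_integral_circlepath) (use Hh in auto)
  then have "((\<lambda>x. H (circlepath 0 1 x) / circlepath 0 1 x * vector_derivative (circlepath 0 1) (at x))
       has_integral 2 * of_real pi * \<i> * H 0) {0..1}"
    by (simp add: has_contour_integral)
  moreover have "H (circlepath 0 1 x) / circlepath 0 1 x * vector_derivative (circlepath 0 1) (at x)
      = 2 * of_real pi * \<i> * H (cis (2 * pi * x))" for x
    unfolding vector_derivative_circlepath by (simp add: circlepath cis_conv_exp mult_ac)
  ultimately have "((\<lambda>x. 2 * of_real pi * \<i> * H (cis (2 * pi * x))) has_integral 2 * of_real pi * \<i> * H 0) {0..1}"
    by (simp only:)
  from has_integral_mult_right[OF this, of "1 / (2 * of_real pi * \<i>)"]
  have "((\<lambda>x. H (cis (2 * pi * x))) has_integral H 0) {0..1}" by simp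
  from has_integral_mult_right[OF this, of "cnj (H 0)"]
  have "((\<lambda>x. Re (cnj (H 0) * H (cis (2 * pi * x)))) has_integral Re (cnj (H 0) * H 0)) {0..1}"
    by (rule has_integral_Re)
  from has_integral_diff[OF has_integral_mult_right[OF this, of 2] has_integral_const_real[of "(norm (H 0))\<^sup>2" 0 1]]
  have 1: "((\<lambda>x. 2 * Re (cnj (H 0) * H (cis (2 * pi * x))) - (norm (H 0))\<^sup>2) has_integral (norm (H 0))\<^sup>2) {0..1}"
    unfolding e by simp
  have cont: "continuous_on {0..1} (\<lambda>x. (norm (H (cis (2 * pi * x))))\<^sup>2)"
    by (intro continuous_intros continuous_on_compose2[OF Hh(1)]) auto
  then have 2: "((\<lambda>x. (norm (H (cis (2 * pi * x))))\<^sup>2) has_integral integral {0..1} (\<lambda>x. (norm (H (cis (2 * pi * x))))\<^sup>2)) {0..1}"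
    by (intro integrable_integral integrable_continuous_real)
  \<comment> \<open>This says that \<open>norm (w - c)\<close> has nonnegative square. With
    \<open>c = H 0\<close>, the mean of the values \<open>w\<close>, integration turns it into the
    mean-square inequality.\<close>
  have "2 * Re (cnj c * w) - (norm c)\<^sup>2 \<le> (norm w)\<^sup>2" for c w :: complex
    using sum_squares_ge_zero[of "Re c - Re w" "Im c - Im w"]
    unfolding cmod_power2 by (simp add: power2_eq_square algebra_simps)
  then have "(norm (H 0))\<^sup>2 \<le> integral {0..1} (\<lambda>x. (norm (H (cis (2 * pi * x))))\<^sup>2)"
    by (intro has_integral_le[OF 1 2]) auto
  then have "ennreal ((norm (H 0))\<^sup>2) \<le> ennreal (integral {0..1} (\<lambda>x. (norm (H (cis (2 * pi * x))))\<^sup>2))"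
    by (rule ennreal_leI)
  also have "\<dots> = (\<integral>\<^sup>+ x\<in>{0..1}. ennreal ((norm (H (cis (2 * pi * x))))\<^sup>2) \<partial>lborel)"
    using nn_integral_has_integral_lebesgue'[OF _ 2] by simp
  finally show ?thesis by (simp add: H_def mult.commute)
qed

text \<open>The circle inequality holds at every radius below \<open>r\<close>; integrating it over
  the disc and undoing the rotation average turns circle means into area means.\<close>

lemma area_mean_square_ge:
  assumes G: "G holomorphic_on ball a r" and r: "r > 0"
  shows "ennreal (pi * r\<^sup>2 * (norm (G a))\<^sup>2) \<le> (\<integral>\<^sup>+ z\<in>ball a r. ennreal ((norm (G z))\<^sup>2) \<partial>lborel)"
proof -
  define g where "g z = G (a + z)" for z
  have gh: "g holomorphic_on ball 0 r"
  proof -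
    have "(G \<circ> (\<lambda>z. a + z)) holomorphic_on ball 0 r"
      by (intro holomorphic_on_compose_gen[OF _ G] holomorphic_intros) (auto simp: dist_norm)
    then show ?thesis by (simp add: g_def[abs_def] o_def)
  qed
  define H where "H z = ennreal ((norm (g z))\<^sup>2) * indicator (ball 0 r) z" for z
  have Hm[measurable]: "H \<in> borel_measurable borel"
  proof -
    have "(\<lambda>z. indicat_real (ball 0 r) z *\<^sub>R (norm (g z))\<^sup>2) \<in> borel_measurable borel"
      using gh by (intro borel_measurable_continuous_on_indicator continuous_intros holomorphic_on_imp_continuous_on) auto
    then have "(\<lambda>z. ennreal (indicat_real (ball 0 r) z *\<^sub>R (norm (g z))\<^sup>2)) \<in> borel_measurable borel" by measurable
    then show ?thesis unfolding H_def
      by (rule back_subst[of "\<lambda>f. f \<in> borel_measurable borel"]) (auto simp: indicator_def)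
  qed
  have "ennreal (pi * r\<^sup>2 * (norm (G a))\<^sup>2) = (\<integral>\<^sup>+ z. ennreal ((norm (g 0))\<^sup>2) * indicator (ball (0::complex) r) z \<partial>lborel)"
    using r by (subst nn_integral_cmult_indicator)
      (auto simp: emeasure_ball unit_ball_vol_2 g_def ennreal_mult[symmetric] mult_ac)
  also have "\<dots> \<le> (\<integral>\<^sup>+ z. (\<integral>\<^sup>+ x\<in>{0..1}. H (cis (2 * pi * x) * z) \<partial>lborel) \<partial>lborel)"
  proof (intro nn_integral_mono)
    fix z :: complex
    show "ennreal ((norm (g 0))\<^sup>2) * indicator (ball 0 r) z \<le> (\<integral>\<^sup>+ x\<in>{0..1}. H (cis (2 * pi * x) * z) \<partial>lborel)"
      using circle_mean_square_ge[OF gh, of z] by (cases "norm z < r") (auto simp: H_def norm_mult)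
  qed
  also have "\<dots> = (\<integral>\<^sup>+ z. H z \<partial>lborel)"
    using nn_integral_rotation_average[OF Hm, of "{0..1}" "2 * pi"] by simp
  also have "\<dots> = (\<integral>\<^sup>+ z. H (z - a) \<partial>lborel)"
  proof -
    have "(\<integral>\<^sup>+ z. H (z - a) \<partial>lborel) = (\<integral>\<^sup>+ z. H (z - a) \<partial>distr lborel borel ((+) a))"
      by (simp only: lborel_distr_plus)
    also have "\<dots> = (\<integral>\<^sup>+ z. H z \<partial>lborel)" by (subst nn_integral_distr) auto
    finally show ?thesis by simp
  qed
  also have "\<dots> = (\<integral>\<^sup>+ z\<in>ball a r. ennreal ((norm (G z))\<^sup>2) \<partial>lborel)"
    by (intro nn_integral_cong) (auto simp: H_def g_def indicator_def dist_norm norm_minus_commute)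
  finally show ?thesis .
qed

section \<open>Functions with Taylor coefficients of order \<open>1/n\<close>\<close>

lemma has_integral_cis_period:
  fixes k a :: real
  assumes "k \<in> \<int>"
  shows "((\<lambda>\<theta>. cis (k * \<theta>)) has_integral (if k = 0 then of_real (2 * pi) else 0)) {a..a + 2 * pi}"
proof (cases "k = 0")
  case True
  then show ?thesis using has_integral_const_real[of "1::complex" a "a + 2 * pi"] by (simp add: scaleR_conv_of_real)
next
  case False
  define F where "F z = exp (\<i> * of_real k * z) / (\<i> * of_real k)" for z
  have "((\<lambda>\<theta>. F (of_real \<theta>)) has_vector_derivative cis (k * \<theta>)) (at \<theta> within {a..a + 2 * pi})" for \<theta>
  proof (rule has_vector_derivative_real_field)
    show "(F has_field_derivative cis (k * \<theta>)) (at (of_real \<theta>))"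
      unfolding F_def using False by (auto intro!: derivative_eq_intros simp: cis_conv_exp mult_ac)
  qed
  then have "((\<lambda>\<theta>. cis (k * \<theta>)) has_integral (F (of_real (a + 2 * pi)) - F (of_real a))) {a..a + 2 * pi}"
    by (intro fundamental_theorem_of_calculus) auto
  moreover have "F (of_real (a + 2 * pi)) = F (of_real a)"
  proof -
    have "exp (\<i> * of_real k * of_real (a + 2 * pi)) = cis (k * a + 2 * pi * k)"
      by (simp add: cis_conv_exp algebra_simps)
    also have "\<dots> = cis (k * a)" using assms by (simp add: cis_mult[symmetric] cis_multiple_2pi)
    finally show ?thesis by (simp add: F_def cis_conv_exp mult_ac)
  qed
  ultimately show ?thesis using False by simp
qed

text \<open>Parseval: after expanding the square only the diagonal terms survive integration over a
  period. The period may start anywhere, so that it can be made to contain a given arc.\<close>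

lemma circle_mean_square_polynomial:
  fixes c :: "nat \<Rightarrow> complex"
  shows "(\<integral>\<^sup>+ \<theta>\<in>{a..a + 2 * pi}. ennreal ((norm (\<Sum>n<N. c n * cis (real n * \<theta>)))\<^sup>2) \<partial>lborel)
    = ennreal (2 * pi * (\<Sum>n<N. (norm (c n))\<^sup>2))"
proof -
  define S where "S \<theta> = (\<Sum>n<N. c n * cis (real n * \<theta>))" for \<theta>
  have S: "of_real ((norm (S \<theta>))\<^sup>2) = (\<Sum>n<N. \<Sum>m<N. c n * cnj (c m) * cis ((real n - real m) * \<theta>))" for \<theta>
  proof -
    have "of_real ((norm (S \<theta>))\<^sup>2) = S \<theta> * cnj (S \<theta>)"
      using complex_norm_square[of "S \<theta>"] by simp
    also have "\<dots> = (\<Sum>n<N. \<Sum>m<N. c n * cis (real n * \<theta>) * (cnj (c m) * cis (- (real m * \<theta>))))"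
      unfolding S_def by (simp add: sum_product cis_cnj)
    also have "\<dots> = (\<Sum>n<N. \<Sum>m<N. c n * cnj (c m) * cis ((real n - real m) * \<theta>))"
    proof (intro sum.cong refl)
      fix n m
      have "cis ((real n - real m) * \<theta>) = cis (real n * \<theta>) * cis (- (real m * \<theta>))"
        by (simp add: cis_mult algebra_simps)
      then show "c n * cis (real n * \<theta>) * (cnj (c m) * cis (- (real m * \<theta>))) = c n * cnj (c m) * cis ((real n - real m) * \<theta>)"
        by (simp only: mult_ac)
    qed
    finally show ?thesis .
  qed
  have "((\<lambda>\<theta>. \<Sum>n<N. \<Sum>m<N. c n * cnj (c m) * cis ((real n - real m) * \<theta>)) has_integral
      (\<Sum>n<N. \<Sum>m<N. c n * cnj (c m) * (if real n - real m = 0 then of_real (2 * pi) else 0))) {a..a + 2 * pi}"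
    by (intro has_integral_sum has_integral_mult_right has_integral_cis_period) auto
  also have "(\<Sum>n<N. \<Sum>m<N. c n * cnj (c m) * (if real n - real m = 0 then of_real (2 * pi) else 0))
      = (\<Sum>n<N. c n * cnj (c n) * of_real (2 * pi))"
    by (intro sum.cong refl) (simp add: if_distrib[where f = "\<lambda>x. _ * x"] sum.delta' cong: if_cong)
  also have "\<dots> = of_real (2 * pi * (\<Sum>n<N. (norm (c n))\<^sup>2))"
    by (simp add: complex_norm_square[symmetric] sum_distrib_left mult_ac)
  finally have "((\<lambda>\<theta>. Re (of_real ((norm (S \<theta>))\<^sup>2))) has_integral Re (of_real (2 * pi * (\<Sum>n<N. (norm (c n))\<^sup>2)))) {a..a + 2 * pi}"
    unfolding S[symmetric] by (rule has_integral_Re)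
  then have "((\<lambda>\<theta>. (norm (S \<theta>))\<^sup>2) has_integral (2 * pi * (\<Sum>n<N. (norm (c n))\<^sup>2))) {a..a + 2 * pi}"
    by (simp only: Re_complex_of_real)
  from nn_integral_has_integral_lebesgue'[OF _ this] show ?thesis by (simp add: S_def)
qed

text \<open>Parseval for the partial sums, then Fatou's lemma.\<close>

lemma circle_mean_square_le:
  fixes c :: "nat \<Rightarrow> complex"
  assumes g: "\<And>\<theta>. (\<lambda>n. c n * cis (real n * \<theta>)) sums g \<theta>"
    and c: "\<And>N. (\<Sum>n<N. (norm (c n))\<^sup>2) \<le> B"
  shows "(\<integral>\<^sup>+ \<theta>\<in>{a..a + 2 * pi}. ennreal ((norm (g \<theta>))\<^sup>2) \<partial>lborel) \<le> ennreal (2 * pi * B)"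
proof -
  define u where "u N \<theta> = ennreal ((norm (\<Sum>n<N. c n * cis (real n * \<theta>)))\<^sup>2) * indicator {a..a + 2 * pi} \<theta>" for N \<theta>
  have [measurable]: "cis \<in> borel_measurable borel"
    by (intro borel_measurable_continuous_onI continuous_intros)
  have um: "u N \<in> borel_measurable lborel" for N unfolding u_def by measurable
  have "ennreal ((norm (g \<theta>))\<^sup>2) * indicator {a..a + 2 * pi} \<theta> = liminf (\<lambda>N. u N \<theta>)" for \<theta>
  proof -
    have "(\<lambda>N. ennreal ((norm (\<Sum>n<N. c n * cis (real n * \<theta>)))\<^sup>2)) \<longlonglongrightarrow> ennreal ((norm (g \<theta>))\<^sup>2)"
      using g[of \<theta>] unfolding sums_def by (intro tendsto_intros)
    then have "(\<lambda>N. u N \<theta>) \<longlonglongrightarrow> ennreal ((norm (g \<theta>))\<^sup>2) * indicator {a..a + 2 * pi} \<theta>"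
      unfolding u_def by (cases "\<theta> \<in> {a..a + 2 * pi}") auto
    then show ?thesis by (intro lim_imp_Liminf[symmetric]) auto
  qed
  then have "(\<integral>\<^sup>+ \<theta>\<in>{a..a + 2 * pi}. ennreal ((norm (g \<theta>))\<^sup>2) \<partial>lborel) = (\<integral>\<^sup>+ \<theta>. liminf (\<lambda>N. u N \<theta>) \<partial>lborel)"
    by simp
  also have "\<dots> \<le> liminf (\<lambda>N. integral\<^sup>N lborel (u N))"
    by (rule nn_integral_liminf) (rule um)
  also have "\<dots> \<le> liminf (\<lambda>N. ennreal (2 * pi * B))"
  proof (intro Liminf_mono always_eventually allI)
    fix N
    show "integral\<^sup>N lborel (u N) \<le> ennreal (2 * pi * B)"
      unfolding u_def circle_mean_square_polynomial
      using c[of N] by (intro ennreal_leI mult_left_mono) auto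
  qed
  also have "\<dots> = ennreal (2 * pi * B)" by (simp add: Liminf_const)
  finally show ?thesis .
qed

lemma norm_cis_diff_le: "norm (cis x - cis y) \<le> \<bar>x - y\<bar>"
proof -
  have "norm (exp (\<i> * of_real x) - exp (\<i> * of_real y)) \<le> 1 * norm (\<i> * of_real x - \<i> * of_real y)"
  proof (rule field_differentiable_bound[of "closed_segment (\<i> * of_real y) (\<i> * of_real x)" exp exp 1])
    fix z assume "z \<in> closed_segment (\<i> * of_real y) (\<i> * of_real x)"
    then have "Re z = 0" by (auto simp: closed_segment_def)
    then show "norm (exp z) \<le> 1" by simp
  qed (auto intro: DERIV_exp has_field_derivative_at_within)
  also have "\<dots> = \<bar>x - y\<bar>"
    by (simp add: right_diff_distrib[symmetric] norm_mult del: of_real_diff flip: of_real_diff)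
  finally show ?thesis by (simp add: cis_conv_exp)
qed

section \<open>Derivative bounds and the Bloch norm\<close>

locale HL_function =
  fixes f :: "complex \<Rightarrow> complex" and C :: real
  assumes hol: "f holomorphic_on unit_disc"
    and coeff_bound: "real (n + 1) * norm (fps_nth (fps_expansion f 0) n) \<le> C"
begin

abbreviation coeff :: "nat \<Rightarrow> complex" where
  "coeff n \<equiv> fps_nth (fps_expansion f 0) n"

lemma C_nonneg: "0 \<le> C"
  using coeff_bound[of 0] by (simp add: order_trans[OF norm_ge_zero])

lemma norm_at_0_le: "norm (f 0) \<le> C"
  using coeff_bound[of 0] by (simp add: fps_expansion_def)

lemma deriv_holomorphic: "deriv f holomorphic_on unit_disc"
  by (intro holomorphic_deriv hol) auto

lemma norm_diffs_le: "norm (diffs coeff n) \<le> C"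
proof -
  have "norm (diffs coeff n) = real (n + 1) * norm (coeff (Suc n))"
    unfolding diffs_def norm_mult by (simp only: norm_of_nat Suc_eq_plus1)
  also have "\<dots> \<le> real (Suc n + 1) * norm (coeff (Suc n))"
    by (intro mult_right_mono) auto
  also have "\<dots> \<le> C" by (rule coeff_bound)
  finally show ?thesis .
qed

lemma norm_deriv_le:
  assumes "norm z < 1"
  shows "norm (deriv f z) \<le> C / (1 - norm z)"
proof -
  have "(\<lambda>n. C * norm z ^ n) sums (C * (1 / (1 - norm z)))"
    using assms by (intro sums_mult geometric_sums) auto
  then have "norm (deriv f z) \<le> C * (1 / (1 - norm z))"
    by (intro norm_sums_le[OF deriv_sums_on_unit_disc[OF hol assms]])
      (auto simp: norm_mult norm_power intro!: mult_right_mono norm_diffs_le)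
  then show ?thesis by simp
qed

lemma bloch_norm_le: "bloch_norm f \<le> ennreal (3 * C)"
proof -
  have "(1 - (norm z)\<^sup>2) * norm (deriv f z) \<le> 2 * C" if "norm z < 1" for z
  proof -
    have "(1 - (norm z)\<^sup>2) * norm (deriv f z) \<le> (1 - (norm z)\<^sup>2) * (C / (1 - norm z))"
      using that by (intro mult_left_mono norm_deriv_le) (auto simp: abs_square_le_1)
    also have "\<dots> = (1 + norm z) * (1 - norm z) * (C / (1 - norm z))"
      by (simp add: power2_eq_square algebra_simps)
    also have "\<dots> = (1 + norm z) * C" using that by simp
    also have "\<dots> \<le> 2 * C" using that C_nonneg by (intro mult_right_mono) auto
    finally show ?thesis .
  qed
  then have "(SUP z\<in>unit_disc. ennreal ((1 - (norm z)\<^sup>2) * norm (deriv f z))) \<le> ennreal (2 * C)"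
    by (intro SUP_least ennreal_leI) auto
  moreover have "ennreal (norm (f 0)) \<le> ennreal C" using norm_at_0_le by (rule ennreal_leI)
  ultimately have "bloch_norm f \<le> ennreal C + ennreal (2 * C)"
    unfolding bloch_norm_def by (rule add_mono[rotated])
  also have "\<dots> = ennreal (3 * C)" using C_nonneg by (simp flip: ennreal_plus)
  finally show ?thesis .
qed

section \<open>Length of the images of radii\<close>

definition radial_variation :: "real \<Rightarrow> real \<Rightarrow> ennreal" where
  "radial_variation r \<theta> = (\<integral>\<^sup>+ s\<in>{r..<1}. ennreal (norm (deriv f (of_real s * cis \<theta>))) \<partial>lborel)"

lemma deriv_polar_measurable [measurable]:
  "(\<lambda>p. ennreal (norm (deriv f (of_real (fst p) * cis (snd p)))) * indicator {0..<1} (fst p)) \<in> borel_measurable borel"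
proof -
  have "continuous_on ({0..<1} \<times> UNIV) (\<lambda>p. norm (deriv f (of_real (fst p) * cis (snd p))))"
    by (intro continuous_intros continuous_on_compose2[OF holomorphic_on_imp_continuous_on[OF deriv_holomorphic]])
      (auto simp: norm_mult)
  then have "(\<lambda>p. indicat_real ({0..<1} \<times> UNIV) p *\<^sub>R norm (deriv f (of_real (fst p) * cis (snd p)))) \<in> borel_measurable borel"
    by (intro borel_measurable_continuous_on_indicator) (auto intro!: borel_Times)
  then have "(\<lambda>p. ennreal (indicat_real ({0..<1} \<times> UNIV) p *\<^sub>R norm (deriv f (of_real (fst p) * cis (snd p))))) \<in> borel_measurable borel"
    by measurable
  then show ?thesis
    by (rule back_subst[of "\<lambda>f. f \<in> borel_measurable borel"]) (auto simp: indicator_def)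
qed

lemma deriv_polar_measurable_pair [measurable]:
  "(\<lambda>(s, \<theta>). ennreal (norm (deriv f (of_real s * cis \<theta>))) * indicator {0..<1} s) \<in> borel_measurable (borel \<Otimes>\<^sub>M borel)"
  using deriv_polar_measurable by (simp add: borel_prod split_beta')

lemma radial_variation_conv:
  assumes "0 \<le> r"
  shows "radial_variation r \<theta> = (\<integral>\<^sup>+ s. (ennreal (norm (deriv f (of_real s * cis \<theta>))) * indicator {0..<1} s) * indicator {r..<1} s \<partial>lborel)"
  unfolding radial_variation_def using assms by (intro nn_integral_cong) (auto simp: indicator_def)

lemma radial_variation_measurable [measurable]:
  assumes "0 \<le> r"
  shows "radial_variation r \<in> borel_measurable borel"
  unfolding radial_variation_conv[OF assms, abs_def] by measurable

text \<open>A weighted AM-GM inequality, \<open>x \<le> q / 2 * x\<^sup>2 + 1 / (2 * q)\<close>,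
  takes the part of Cauchy-Schwarz. The square is integrated over the whole circle, where Parseval
  gives at most \<open>2 * pi * C\<^sup>2 / (1 - s)\<close>, the constant over the arc alone. With
  \<open>q = sqrt (h * (1 - s))\<close> both contributions are multiples of
  \<open>sqrt (h / (1 - s))\<close>.\<close>

lemma arc_mean_deriv_le:
  assumes s: "0 \<le> s" "s < 1" and ab: "a < b" "b \<le> a + 2 * pi"
  shows "(\<integral>\<^sup>+ \<theta>\<in>{a..b}. ennreal (norm (deriv f (of_real s * cis \<theta>))) \<partial>lborel)
    \<le> ennreal ((pi * C\<^sup>2 + 1 / 2) * sqrt ((b - a) / (1 - s)))"
proof -
  define h where "h = b - a"
  have h: "h > 0" using ab by (simp add: h_def)
  define q where "q = sqrt (h * (1 - s))"
  have q: "q > 0" using h s by (simp add: q_def)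
  have q1: "q / (1 - s) = sqrt (h / (1 - s))" and q2: "h / q = sqrt (h / (1 - s))"
  proof -
    define x y where "x = sqrt h" and "y = sqrt (1 - s)"
    have xy: "x > 0" "y > 0" "h = x * x" "1 - s = y * y" using h s by (simp_all add: x_def y_def)
    have "q = x * y" by (simp add: q_def x_def y_def real_sqrt_mult)
    then show "q / (1 - s) = sqrt (h / (1 - s))" "h / q = sqrt (h / (1 - s))"
      using xy(1,2) unfolding xy(3,4) by (simp_all add: real_sqrt_divide)
  qed
  have gm: "(\<lambda>\<theta>. norm (deriv f (of_real s * cis \<theta>))) \<in> borel_measurable borel"
    using s by (intro borel_measurable_continuous_onI continuous_intros continuous_on_compose2[OF holomorphic_on_imp_continuous_on[OF deriv_holomorphic]])
      (auto simp: norm_mult)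
  have sq: "(\<integral>\<^sup>+ \<theta>\<in>{a..a + 2 * pi}. ennreal ((norm (deriv f (of_real s * cis \<theta>)))\<^sup>2) \<partial>lborel) \<le> ennreal (2 * pi * (C\<^sup>2 / (1 - s)))"
  proof (rule circle_mean_square_le)
    fix \<theta> :: real
    show "(\<lambda>n. diffs coeff n * of_real s ^ n * cis (real n * \<theta>)) sums deriv f (of_real s * cis \<theta>)"
    proof -
      have "norm (of_real s * cis \<theta>) < 1" using s by (simp add: norm_mult)
      from deriv_sums_on_unit_disc[OF hol this] show ?thesis by (simp only: power_mult_distrib Complex.DeMoivre mult.assoc)
    qed
  next
    fix N :: nat
    have "(\<Sum>n<N. (norm (diffs coeff n * of_real s ^ n))\<^sup>2) \<le> (\<Sum>n<N. C\<^sup>2 * s ^ n)"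
    proof (intro sum_mono)
      fix n
      have "(norm (diffs coeff n * of_real s ^ n))\<^sup>2 = (norm (diffs coeff n))\<^sup>2 * (s ^ n * s ^ n)"
        using s by (simp add: norm_mult norm_power power_mult_distrib power2_eq_square)
      \<comment> \<open>One of the two factors \<open>s ^ n\<close> is replaced by 1, which leaves
        the geometric sum \<open>1 / (1 - s)\<close>.\<close>
      also have "\<dots> \<le> C\<^sup>2 * (s ^ n * 1)"
        using s by (intro mult_mono power_mono norm_diffs_le power_le_one) auto
      finally show "(norm (diffs coeff n * of_real s ^ n))\<^sup>2 \<le> C\<^sup>2 * s ^ n" by simp
    qed
    also have "\<dots> = C\<^sup>2 * (\<Sum>n<N. s ^ n)" by (simp add: sum_distrib_left)
    also have "\<dots> \<le> C\<^sup>2 * (\<Sum>n. s ^ n)"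
      using s by (intro mult_left_mono sum_le_suminf summable_geometric) auto
    also have "\<dots> = C\<^sup>2 / (1 - s)" using s by (simp add: suminf_geometric)
    finally show "(\<Sum>n<N. (norm (diffs coeff n * of_real s ^ n))\<^sup>2) \<le> C\<^sup>2 / (1 - s)" .
  qed
  have amgm: "x \<le> q / 2 * x\<^sup>2 + 1 / (2 * q)" for x :: real
  proof -
    have "0 \<le> (q * x - 1)\<^sup>2 / (2 * q)" using q by simp
    also have "\<dots> = q / 2 * x\<^sup>2 + 1 / (2 * q) - x" using q by (simp add: power2_eq_square field_simps)
    finally show ?thesis by simp
  qed
  have "(\<integral>\<^sup>+ \<theta>\<in>{a..b}. ennreal (norm (deriv f (of_real s * cis \<theta>))) \<partial>lborel)
     \<le> (\<integral>\<^sup>+ \<theta>. ennreal (q / 2) * (ennreal ((norm (deriv f (of_real s * cis \<theta>)))\<^sup>2) * indicator {a..a + 2 * pi} \<theta>) + ennreal (1 / (2 * q)) * indicator {a..b} \<theta> \<partial>lborel)"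
  proof (intro nn_integral_mono)
    fix \<theta> :: real
    have "ennreal (norm (deriv f (of_real s * cis \<theta>))) \<le> ennreal (q / 2) * ennreal ((norm (deriv f (of_real s * cis \<theta>)))\<^sup>2) + ennreal (1 / (2 * q))"
      using amgm[of "norm (deriv f (of_real s * cis \<theta>))"] q by (simp add: ennreal_mult[symmetric] ennreal_plus[symmetric] ennreal_leI del: ennreal_plus)
    then show "ennreal (norm (deriv f (of_real s * cis \<theta>))) * indicator {a..b} \<theta> \<le> ennreal (q / 2) * (ennreal ((norm (deriv f (of_real s * cis \<theta>)))\<^sup>2) * indicator {a..a + 2 * pi} \<theta>) + ennreal (1 / (2 * q)) * indicator {a..b} \<theta>"
      using ab by (auto simp: indicator_def)
  qed
  also have "\<dots> = ennreal (q / 2) * (\<integral>\<^sup>+ \<theta>\<in>{a..a + 2 * pi}. ennreal ((norm (deriv f (of_real s * cis \<theta>)))\<^sup>2) \<partial>lborel) + ennreal (1 / (2 * q)) * ennreal h"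
    using gm ab by (subst nn_integral_add) (auto simp: nn_integral_cmult nn_integral_cmult_indicator h_def)
  also have "\<dots> \<le> ennreal (q / 2) * ennreal (2 * pi * (C\<^sup>2 / (1 - s))) + ennreal (1 / (2 * q)) * ennreal h"
    by (intro add_mono mult_left_mono sq) auto
  also have "\<dots> = ennreal (q / 2 * (2 * pi * (C\<^sup>2 / (1 - s))) + 1 / (2 * q) * h)"
    using q s h by (simp add: ennreal_mult[symmetric] ennreal_plus[symmetric] del: ennreal_plus)
  also have "q / 2 * (2 * pi * (C\<^sup>2 / (1 - s))) + 1 / (2 * q) * h = pi * C\<^sup>2 * (q / (1 - s)) + 1 / 2 * (h / q)"
    by simp
  also have "\<dots> = (pi * C\<^sup>2 + 1 / 2) * sqrt (h / (1 - s))" unfolding q1 q2 by (simp only: distrib_right)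
  finally show ?thesis by (simp only: h_def)
qed

text \<open>By Tonelli the arc estimate may be integrated over the radii \<open>s\<close>, and
  \<open>1 / sqrt (1 - s)\<close> has integral \<open>2 * sqrt (1 - r)\<close> over
  \<open>[r, 1]\<close>. When \<open>1 - r\<close> is at most the arc length, the bound is
  proportional to the arc length.\<close>

lemma arc_mean_radial_variation_le:
  assumes r: "0 \<le> r" "r < 1" and ab: "a < b" "b \<le> a + 2 * pi"
  shows "(\<integral>\<^sup>+ \<theta>\<in>{a..b}. radial_variation r \<theta> \<partial>lborel)
    \<le> ennreal (2 * (pi * C\<^sup>2 + 1 / 2) * sqrt ((b - a) * (1 - r)))"
proof -
  define K where "K = (pi * C\<^sup>2 + 1 / 2) * sqrt (b - a)"
  have K: "K \<ge> 0" using ab by (simp add: K_def)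
  have "(\<integral>\<^sup>+ \<theta>\<in>{a..b}. radial_variation r \<theta> \<partial>lborel)
     = (\<integral>\<^sup>+ \<theta>. (\<integral>\<^sup>+ s. (ennreal (norm (deriv f (of_real s * cis \<theta>))) * indicator {0..<1} s) * indicator {r..<1} s * indicator {a..b} \<theta> \<partial>lborel) \<partial>lborel)"
    unfolding radial_variation_conv[OF r(1)] by (intro nn_integral_cong nn_integral_multc[symmetric]) measurable
  also have "\<dots> = (\<integral>\<^sup>+ s. (\<integral>\<^sup>+ \<theta>. (ennreal (norm (deriv f (of_real s * cis \<theta>))) * indicator {0..<1} s) * indicator {r..<1} s * indicator {a..b} \<theta> \<partial>lborel) \<partial>lborel)"
    by (rule lborel_pair.Fubini') measurable
  also have "\<dots> \<le> (\<integral>\<^sup>+ s. ennreal (K * (1 / sqrt (1 - s))) * indicator {r..1} s \<partial>lborel)"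
  proof (rule nn_integral_mono)
    fix s :: real
    show "(\<integral>\<^sup>+ \<theta>. (ennreal (norm (deriv f (of_real s * cis \<theta>))) * indicator {0..<1} s) * indicator {r..<1} s * indicator {a..b} \<theta> \<partial>lborel) \<le> ennreal (K * (1 / sqrt (1 - s))) * indicator {r..1} s"
    proof (cases "s \<in> {r..<1}")
      case True
      have "(pi * C\<^sup>2 + 1 / 2) * sqrt ((b - a) / (1 - s)) = K * (1 / sqrt (1 - s))"
        by (simp add: K_def real_sqrt_divide)
      then show ?thesis using True r arc_mean_deriv_le[of s a b] ab by simp
    qed auto
  qed
  also have "\<dots> = ennreal (K * (2 * sqrt (1 - r)))"
  proof (rule nn_integral_has_integral_lebesgue')
    have "((\<lambda>s. K * (1 / sqrt (1 - s))) has_integral (- (K * (2 * sqrt (1 - 1))) - (- (K * (2 * sqrt (1 - r)))))) {r..1}"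
    \<comment> \<open>The integrand is singular at 1 but its primitive is continuous there, so
      derivatives in the open interval suffice.\<close>
    proof (rule fundamental_theorem_of_calculus_interior)
      show "continuous_on {r..1} (\<lambda>s. - (K * (2 * sqrt (1 - s))))"
        by (intro continuous_intros)
      show "((\<lambda>s. - (K * (2 * sqrt (1 - s)))) has_vector_derivative K * (1 / sqrt (1 - s))) (at s)" if "s \<in> {r<..<1}" for s
        using that by (auto intro!: derivative_eq_intros simp: has_real_derivative_iff_has_vector_derivative[symmetric] field_simps)
    qed (use r in auto)
    then show "((\<lambda>s. K * (1 / sqrt (1 - s))) has_integral K * (2 * sqrt (1 - r))) {r..1}" by simp
  qed (use K in auto)
  also have "K * (2 * sqrt (1 - r)) = 2 * (pi * C\<^sup>2 + 1 / 2) * sqrt ((b - a) * (1 - r))"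
    by (simp add: K_def real_sqrt_mult)
  finally show ?thesis .
qed

lemma radial_increment_le:
  assumes r: "0 \<le> r" "r \<le> r'" "r' < 1"
  shows "ennreal (norm (f (of_real r' * cis \<theta>) - f (of_real r * cis \<theta>))) \<le> radial_variation r \<theta>"
proof -
  define \<psi> where "\<psi> s = deriv f (of_real s * cis \<theta>) * cis \<theta>" for s
  have "((\<lambda>s. f (of_real s * cis \<theta>)) has_vector_derivative \<psi> s) (at s within {r..r'})" if "s \<in> {r..r'}" for s
  proof (rule has_vector_derivative_real_field)
    have "(f has_field_derivative deriv f (of_real s * cis \<theta>)) (at (of_real s * cis \<theta>))"
      using r that by (intro holomorphic_derivI[OF hol]) (auto simp: norm_mult)
    then have "((f \<circ> (\<lambda>w. w * cis \<theta>)) has_field_derivative deriv f (of_real s * cis \<theta>) * cis \<theta>) (at (of_real s))"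
      by (rule DERIV_chain) (auto intro!: derivative_eq_intros)
    then show "((\<lambda>w. f (w * cis \<theta>)) has_field_derivative \<psi> s) (at (of_real s))"
      by (simp add: \<psi>_def o_def)
  qed
  then have 1: "(\<psi> has_integral (f (of_real r' * cis \<theta>) - f (of_real r * cis \<theta>))) {r..r'}"
    using r by (intro fundamental_theorem_of_calculus) auto
  have "continuous_on {r..r'} (\<lambda>s. norm (\<psi> s))"
    unfolding \<psi>_def using r
    by (intro continuous_intros continuous_on_compose2[OF holomorphic_on_imp_continuous_on[OF deriv_holomorphic]])
      (auto simp: norm_mult)
  then have 2: "((\<lambda>s. norm (\<psi> s)) has_integral integral {r..r'} (\<lambda>s. norm (\<psi> s))) {r..r'}"
    by (intro integrable_integral integrable_continuous_real)
  have "norm (integral {r..r'} \<psi>) \<le> integral {r..r'} (\<lambda>s. norm (\<psi> s))"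
    using 1 2 by (intro Henstock_Kurzweil_Integration.integral_norm_bound_integral) auto
  then have "ennreal (norm (f (of_real r' * cis \<theta>) - f (of_real r * cis \<theta>))) \<le> ennreal (integral {r..r'} (\<lambda>s. norm (\<psi> s)))"
    using 1 by (intro ennreal_leI) (simp add: integral_unique)
  also have "\<dots> = (\<integral>\<^sup>+ s\<in>{r..r'}. ennreal (norm (\<psi> s)) \<partial>lborel)"
    using nn_integral_has_integral_lebesgue'[OF _ 2] by simp
  also have "\<dots> \<le> radial_variation r \<theta>"
    unfolding radial_variation_def using r
    by (intro nn_integral_mono) (auto simp: indicator_def \<psi>_def norm_mult)
  finally show ?thesis .
qed

section \<open>Boundary values and their mean oscillation\<close>

lemma radial_variation_tendsto_0:
  assumes "radial_variation 0 \<theta> < \<infinity>"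
  shows "(\<lambda>k. radial_variation (1 - 1 / real (Suc k)) \<theta>) \<longlonglongrightarrow> 0"
proof -
  define w where "w s = ennreal (norm (deriv f (of_real s * cis \<theta>))) * indicator {0..<1} s" for s
  have [measurable]: "w \<in> borel_measurable borel" unfolding w_def by measurable
  have "(\<lambda>k. \<integral>\<^sup>+ s. w s * indicator {1 - 1 / real (Suc k)..<1} s \<partial>lborel) \<longlonglongrightarrow> (\<integral>\<^sup>+ s. 0 \<partial>(lborel :: real measure))"
  proof (rule nn_integral_dominated_convergence[where w = w])
    show "integral\<^sup>N lborel w < \<infinity>"
      using assms by (simp add: radial_variation_def w_def[abs_def])
    show "AE s in lborel. (\<lambda>k. w s * indicator {1 - 1 / real (Suc k)..<1} s) \<longlonglongrightarrow> 0"
    proof (intro AE_I2)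
      fix s :: real
      have "\<forall>\<^sub>F k in sequentially. w s * indicator {1 - 1 / real (Suc k)..<1} s = 0"
      proof (cases "s < 1")
        case True
        have "(\<lambda>k. 1 - 1 / real (Suc k)) \<longlonglongrightarrow> 1" by real_asymp
        from order_tendstoD(1)[OF this True] show ?thesis
          by eventually_elim (auto simp: indicator_def)
      qed (simp add: w_def)
      then show "(\<lambda>k. w s * indicator {1 - 1 / real (Suc k)..<1} s) \<longlonglongrightarrow> 0"
        by (rule tendsto_eventually)
    qed
  qed (auto simp: indicator_def intro!: AE_I2)
  moreover have "(\<integral>\<^sup>+ s. w s * indicator {1 - 1 / real (Suc k)..<1} s \<partial>lborel) = radial_variation (1 - 1 / real (Suc k)) \<theta>" for k
    unfolding w_def by (rule radial_variation_conv[symmetric]) (simp add: field_simps)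
  ultimately show ?thesis by simp
qed

text \<open>Increments beyond \<open>r\<close> are at most
  \<open>radial_variation r \<theta>\<close>, which tends to 0 along
  \<open>r = 1 - 1 / (k + 1)\<close>. The radial values are therefore Cauchy, and the
  \<open>Lim\<close> in \<open>boundary_value\<close> is a true limit.\<close>

lemma boundary_value_limit:
  assumes fin: "radial_variation 0 \<theta> < \<infinity>"
  shows "((\<lambda>r. f (of_real r * cis \<theta>)) \<longlongrightarrow> boundary_value f (cis \<theta>)) (at_left (1::real))"
proof -
  define \<rho> where "\<rho> k = 1 - 1 / real (Suc k)" for k
  have \<rho>: "0 \<le> \<rho> k" "\<rho> k < 1" for k by (auto simp: \<rho>_def field_simps)
  have small: "\<exists>k. radial_variation (\<rho> k) \<theta> < ennreal e" if "e > 0" for e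
  proof -
    have "\<forall>\<^sub>F k in sequentially. radial_variation (\<rho> k) \<theta> < ennreal e"
      using radial_variation_tendsto_0[OF fin] that unfolding \<rho>_def by (intro order_tendstoD(2)) auto
    then show ?thesis by (auto simp: eventually_at_top_linorder)
  qed
  have close: "norm (f (of_real r * cis \<theta>) - f (of_real (\<rho> k) * cis \<theta>)) < e"
    if "radial_variation (\<rho> k) \<theta> < ennreal e" "\<rho> k \<le> r" "r < 1" for k r e
  proof -
    have "ennreal (norm (f (of_real r * cis \<theta>) - f (of_real (\<rho> k) * cis \<theta>))) < ennreal e"
      using radial_increment_le[of "\<rho> k" r \<theta>] \<rho>[of k] that by (auto intro: le_less_trans)
    then show ?thesis by (simp add: ennreal_less_iff)
  qed
  have "Cauchy (\<lambda>k. f (of_real (\<rho> k) * cis \<theta>))"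
  proof (rule CauchyI)
    fix e :: real assume "e > 0"
    then obtain k where k: "radial_variation (\<rho> k) \<theta> < ennreal (e / 2)" using small[of "e / 2"] by auto
    have "norm (f (of_real (\<rho> m) * cis \<theta>) - f (of_real (\<rho> n) * cis \<theta>)) < e" if "m \<ge> k" "n \<ge> k" for m n
    proof -
      have "\<rho> k \<le> \<rho> m" "\<rho> k \<le> \<rho> n" using that by (auto simp: \<rho>_def field_simps)
      then have "norm (f (of_real (\<rho> m) * cis \<theta>) - f (of_real (\<rho> k) * cis \<theta>)) < e / 2"
        "norm (f (of_real (\<rho> n) * cis \<theta>) - f (of_real (\<rho> k) * cis \<theta>)) < e / 2"
        using close[OF k] \<rho> by auto
      then show ?thesis
        using norm_triangle_ineq4[of "f (of_real (\<rho> m) * cis \<theta>) - f (of_real (\<rho> k) * cis \<theta>)" "f (of_real (\<rho> n) * cis \<theta>) - f (of_real (\<rho> k) * cis \<theta>)"]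
        by simp
    qed
    then show "\<exists>M. \<forall>m\<ge>M. \<forall>n\<ge>M. norm (f (of_real (\<rho> m) * cis \<theta>) - f (of_real (\<rho> n) * cis \<theta>)) < e" by blast
  qed
  then obtain L where L: "(\<lambda>k. f (of_real (\<rho> k) * cis \<theta>)) \<longlonglongrightarrow> L"
    by (auto simp: Cauchy_convergent_iff convergent_def)
  have "((\<lambda>r. f (of_real r * cis \<theta>)) \<longlongrightarrow> L) (at_left 1)"
  proof (rule tendstoI)
    fix e :: real assume "e > 0"
    then obtain k where k: "radial_variation (\<rho> k) \<theta> < ennreal (e / 2)" using small[of "e / 2"] by auto
    have "norm (L - f (of_real (\<rho> k) * cis \<theta>)) \<le> e / 2"
    proof (rule tendsto_upperbound)
      show "(\<lambda>n. norm (f (of_real (\<rho> n) * cis \<theta>) - f (of_real (\<rho> k) * cis \<theta>))) \<longlonglongrightarrow> norm (L - f (of_real (\<rho> k) * cis \<theta>))"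
        by (intro tendsto_intros L)
      show "\<forall>\<^sub>F n in sequentially. norm (f (of_real (\<rho> n) * cis \<theta>) - f (of_real (\<rho> k) * cis \<theta>)) \<le> e / 2"
        using eventually_ge_at_top[of k]
      proof eventually_elim
        case (elim n)
        then have "\<rho> k \<le> \<rho> n" by (auto simp: \<rho>_def field_simps)
        then show ?case using close[OF k] \<rho> by (simp add: less_imp_le)
      qed
    qed auto
    then have "dist (f (of_real r * cis \<theta>)) L < e" if "\<rho> k < r" "r < 1" for r
      using close[OF k, of r] that
        norm_triangle_ineq4[of "f (of_real r * cis \<theta>) - f (of_real (\<rho> k) * cis \<theta>)" "L - f (of_real (\<rho> k) * cis \<theta>)"]
      by (simp add: dist_norm)
    then show "\<forall>\<^sub>F r in at_left 1. dist (f (of_real r * cis \<theta>)) L < e"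
      using \<rho>[of k] unfolding eventually_at_left_field by blast
  qed
  then show ?thesis
    unfolding boundary_value_def by (simp add: tendsto_Lim)
qed

lemma boundary_value_diff_le:
  assumes fin: "radial_variation 0 \<theta> < \<infinity>" and r: "0 \<le> r" "r < 1"
  shows "ennreal (norm (boundary_value f (cis \<theta>) - f (of_real r * cis \<theta>))) \<le> radial_variation r \<theta>"
proof (rule tendsto_upperbound)
  show "((\<lambda>r'. ennreal (norm (f (of_real r' * cis \<theta>) - f (of_real r * cis \<theta>)))) \<longlongrightarrow> ennreal (norm (boundary_value f (cis \<theta>) - f (of_real r * cis \<theta>)))) (at_left (1::real))"
    by (intro tendsto_intros boundary_value_limit fin)
  show "\<forall>\<^sub>F r' in at_left 1. ennreal (norm (f (of_real r' * cis \<theta>) - f (of_real r * cis \<theta>))) \<le> radial_variation r \<theta>"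
    unfolding eventually_at_left_field using r by (intro exI[of _ r]) (auto intro!: radial_increment_le)
qed auto

text \<open>Over one period the variation has finite integral, and countably many periods cover the
  line. All real angles are treated because the arcs in \<open>circle_BMO\<close> are arbitrary
  intervals.\<close>

lemma AE_radial_variation_finite: "AE \<theta> in lborel. radial_variation 0 \<theta> < \<infinity>"
proof -
  have "AE \<theta> in lborel. radial_variation 0 \<theta> * indicator {real_of_int k * (2 * pi)..real_of_int k * (2 * pi) + 2 * pi} \<theta> \<noteq> \<infinity>" for k
  proof (rule nn_integral_PInf_AE)
    show "(\<integral>\<^sup>+ \<theta>\<in>{real_of_int k * (2 * pi)..real_of_int k * (2 * pi) + 2 * pi}. radial_variation 0 \<theta> \<partial>lborel) \<noteq> \<infinity>"
      using arc_mean_radial_variation_le[of 0 "real_of_int k * (2 * pi)" "real_of_int k * (2 * pi) + 2 * pi"]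
      by (auto simp: top_unique)
  qed measurable
  then have "AE \<theta> in lborel. \<forall>k. radial_variation 0 \<theta> * indicator {real_of_int k * (2 * pi)..real_of_int k * (2 * pi) + 2 * pi} \<theta> \<noteq> \<infinity>"
    by (simp add: AE_all_countable)
  then show ?thesis
  proof eventually_elim
    case (elim \<theta>)
    define k where "k = \<lfloor>\<theta> / (2 * pi)\<rfloor>"
    have "real_of_int k \<le> \<theta> / (2 * pi)" "\<theta> / (2 * pi) \<le> real_of_int k + 1" unfolding k_def by linarith+
    then have "\<theta> \<in> {real_of_int k * (2 * pi)..real_of_int k * (2 * pi) + 2 * pi}"
      by (simp add: field_simps)
    then show ?case using elim[rule_format, of k] by (simp add: less_top)
  qed
qed

text \<open>Off a null set of angles the boundary value is a limit of continuous functions of the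
  angle; on that set it may be unspecified, which completeness of Lebesgue measure
  tolerates.\<close>

lemma boundary_value_measurable:
  "(\<lambda>\<theta>. boundary_value f (cis \<theta>)) \<in> borel_measurable lebesgue"
proof -
  define v where "v k \<theta> = f (of_real (1 - 1 / real (Suc k)) * cis \<theta>)" for k \<theta>
  have "v k \<in> borel_measurable borel" for k
  proof -
    define \<rho> where "\<rho> = 1 - 1 / real (Suc k)"
    have "0 \<le> \<rho>" "\<rho> < 1" by (auto simp: \<rho>_def field_simps)
    then show ?thesis
      unfolding v_def \<rho>_def[symmetric]
      by (intro borel_measurable_continuous_onI continuous_intros continuous_on_compose2[OF holomorphic_on_imp_continuous_on[OF hol]])
      (auto simp: norm_mult)
  qed
  then have "(\<lambda>\<theta>. lim (\<lambda>k. v k \<theta>)) \<in> borel_measurable lebesgue"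
    by (intro measurable_completion borel_measurable_lim_metric) auto
  moreover have "AE \<theta> in lebesgue. lim (\<lambda>k. v k \<theta>) = boundary_value f (cis \<theta>)"
    using AE_completion[OF AE_radial_variation_finite]
  proof eventually_elim
    case (elim \<theta>)
    have "filterlim (\<lambda>k. 1 - 1 / real (Suc k)) (at_left 1) sequentially" by real_asymp
    from filterlim_compose[OF boundary_value_limit[OF elim] this]
    show ?case unfolding v_def by (rule limI)
  qed
  ultimately show ?thesis by (rule borel_measurable_AE)
qed

text \<open>Compare with the circle of radius \<open>r\<close>, where \<open>1 - r\<close> is the
  arc length \<open>h\<close>, or \<open>r = 0\<close> for long arcs. The radial part costs a
  multiple of \<open>sqrt (h * (1 - r)) \<le> h\<close>. Between two points of the inner arc, at
  distance at most \<open>r * h\<close>, the derivative is at most \<open>C / (1 - r)\<close>, so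
  \<open>f\<close> changes by at most \<open>C\<close>.\<close>

lemma arc_oscillation_le:
  assumes ab: "a < b" "b \<le> a + 2 * pi"
  obtains c where
    "(\<integral>\<^sup>+ \<theta>\<in>{a..b}. ennreal (norm (boundary_value f (cis \<theta>) - c)) \<partial>lebesgue)
      \<le> ennreal ((2 * (pi * C\<^sup>2 + 1 / 2) + C) * (b - a))"
proof -
  define h where "h = b - a"
  have h: "h > 0" using ab by (simp add: h_def)
  define r where "r = max 0 (1 - h)"
  have r: "0 \<le> r" "r < 1" "1 - r \<le> h" using h by (auto simp: r_def)
  define c where "c = f (of_real r * cis a)"
  have inner: "norm (f (of_real r * cis \<theta>) - c) \<le> C" if "\<theta> \<in> {a..b}" for \<theta>
  proof -
    have "norm (f (of_real r * cis \<theta>) - f (of_real r * cis a)) \<le> C / (1 - r) * norm (of_real r * cis \<theta> - of_real r * cis a)"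
    proof (rule field_differentiable_bound[of "cball 0 r" f "deriv f"])
      fix z :: complex assume z: "z \<in> cball 0 r"
      show "(f has_field_derivative deriv f z) (at z within cball 0 r)"
        using z r by (intro has_field_derivative_at_within[OF holomorphic_derivI[OF hol]]) auto
      have "norm (deriv f z) \<le> C / (1 - norm z)" using z r by (intro norm_deriv_le) auto
      also have "\<dots> \<le> C / (1 - r)" using z r C_nonneg by (intro divide_left_mono mult_pos_pos) auto
      finally show "norm (deriv f z) \<le> C / (1 - r)" .
    qed (use r in \<open>auto simp: norm_mult\<close>)
    also have "norm (of_real r * cis \<theta> - of_real r * cis a) = r * norm (cis \<theta> - cis a)"
      using r by (simp add: norm_mult flip: right_diff_distrib)
    also have "C / (1 - r) * (r * norm (cis \<theta> - cis a)) \<le> C / (1 - r) * (r * h)"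
      using r C_nonneg that order_trans[OF norm_cis_diff_le[of \<theta> a], of h]
      by (intro mult_left_mono) (auto simp: h_def)
    also have "\<dots> \<le> C"
    proof (cases "h < 1")
      case True
      then have "1 - r = h" "r \<le> 1" by (auto simp: r_def h less_imp_le)
      then show ?thesis using h C_nonneg by (simp add: mult_left_le)
    next
      case False
      then show ?thesis using C_nonneg by (simp add: r_def)
    qed
    finally show ?thesis by (simp add: c_def)
  qed
  have "(\<integral>\<^sup>+ \<theta>\<in>{a..b}. ennreal (norm (boundary_value f (cis \<theta>) - c)) \<partial>lebesgue)
     \<le> (\<integral>\<^sup>+ \<theta>. radial_variation r \<theta> * indicator {a..b} \<theta> + ennreal C * indicator {a..b} \<theta> \<partial>lebesgue)"
    using AE_completion[OF AE_radial_variation_finite]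
  proof (intro nn_integral_mono_AE, eventually_elim)
    case (elim \<theta>)
    show ?case
    proof (cases "\<theta> \<in> {a..b}")
      case True
      have "norm (boundary_value f (cis \<theta>) - c) \<le> norm (boundary_value f (cis \<theta>) - f (of_real r * cis \<theta>)) + norm (f (of_real r * cis \<theta>) - c)"
        by (rule order_trans[OF _ norm_triangle_ineq]) simp
      also have "\<dots> \<le> norm (boundary_value f (cis \<theta>) - f (of_real r * cis \<theta>)) + C"
        using inner[OF True] by simp
      finally have "ennreal (norm (boundary_value f (cis \<theta>) - c)) \<le> ennreal (norm (boundary_value f (cis \<theta>) - f (of_real r * cis \<theta>))) + ennreal C"
        using C_nonneg by (simp flip: ennreal_plus add: ennreal_leI)
      also have "\<dots> \<le> radial_variation r \<theta> + ennreal C"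
        by (intro add_mono boundary_value_diff_le elim r) auto
      finally show ?thesis using True by simp
    qed auto
  qed
  also have "\<dots> = (\<integral>\<^sup>+ \<theta>. radial_variation r \<theta> * indicator {a..b} \<theta> + ennreal C * indicator {a..b} \<theta> \<partial>lborel)"
    using r(1) by (intro nn_integral_completion) measurable
  also have "\<dots> = (\<integral>\<^sup>+ \<theta>\<in>{a..b}. radial_variation r \<theta> \<partial>lborel) + ennreal C * ennreal h"
    using r(1) ab by (subst nn_integral_add) (auto simp: nn_integral_cmult_indicator h_def)
  also have "\<dots> \<le> ennreal (2 * (pi * C\<^sup>2 + 1 / 2) * sqrt (h * (1 - r))) + ennreal C * ennreal h"
    unfolding h_def by (intro add_mono arc_mean_radial_variation_le r ab) auto
  also have "\<dots> = ennreal (2 * (pi * C\<^sup>2 + 1 / 2) * sqrt (h * (1 - r)) + C * h)"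
    using C_nonneg h r by (simp flip: ennreal_plus ennreal_mult)
  also have "\<dots> \<le> ennreal (2 * (pi * C\<^sup>2 + 1 / 2) * h + C * h)"
  proof (intro ennreal_leI add_right_mono mult_left_mono)
    show "sqrt (h * (1 - r)) \<le> h"
      using h r by (intro real_le_lsqrt) (auto simp: power2_eq_square)
  qed auto
  finally have "(\<integral>\<^sup>+ \<theta>\<in>{a..b}. ennreal (norm (boundary_value f (cis \<theta>) - c)) \<partial>lebesgue)
      \<le> ennreal ((2 * (pi * C\<^sup>2 + 1 / 2) + C) * (b - a))"
    by (simp add: h_def distrib_right)
  then show ?thesis using that by blast
qed

lemma boundary_value_integrable:
  assumes ab: "a < b" "b \<le> a + 2 * pi"
  shows "set_integrable lebesgue {a..b} (\<lambda>\<theta>. boundary_value f (cis \<theta>))"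
proof -
  obtain c where c: "(\<integral>\<^sup>+ \<theta>\<in>{a..b}. ennreal (norm (boundary_value f (cis \<theta>) - c)) \<partial>lebesgue)
      \<le> ennreal ((2 * (pi * C\<^sup>2 + 1 / 2) + C) * (b - a))" using arc_oscillation_le[OF ab] .
  note [measurable] = boundary_value_measurable
  have [measurable]: "{a..b} \<in> sets lebesgue" by simp
  have "integrable lebesgue (\<lambda>\<theta>. indicat_real {a..b} \<theta> *\<^sub>R (boundary_value f (cis \<theta>) - c))"
  proof (rule integrableI_bounded)
    have "(\<integral>\<^sup>+ \<theta>. ennreal (norm (indicat_real {a..b} \<theta> *\<^sub>R (boundary_value f (cis \<theta>) - c))) \<partial>lebesgue)
        = (\<integral>\<^sup>+ \<theta>\<in>{a..b}. ennreal (norm (boundary_value f (cis \<theta>) - c)) \<partial>lebesgue)"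
      by (intro nn_integral_cong) (auto simp: indicator_def)
    also have "\<dots> < \<infinity>" using c by (auto intro: le_less_trans)
    finally show "(\<integral>\<^sup>+ \<theta>. ennreal (norm (indicat_real {a..b} \<theta> *\<^sub>R (boundary_value f (cis \<theta>) - c))) \<partial>lebesgue) < \<infinity>" .
  qed measurable
  moreover have "integrable lebesgue (\<lambda>\<theta>. indicat_real {a..b} \<theta> *\<^sub>R c)"
    using absolutely_integrable_on_const[of "{a..b}" c] by (simp add: set_integrable_def lmeasurable_interval)
  ultimately have "integrable lebesgue (\<lambda>\<theta>. indicat_real {a..b} \<theta> *\<^sub>R (boundary_value f (cis \<theta>) - c) + indicat_real {a..b} \<theta> *\<^sub>R c)"
    by (rule Bochner_Integration.integrable_add)
  then show ?thesis unfolding set_integrable_def by (simp add: algebra_simps)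
qed

text \<open>Passing from the constant \<open>c\<close> to the mean \<open>m\<close> at most doubles
  the oscillation, because \<open>(b - a) * norm (m - c)\<close> is itself bounded by the integral
  of the distance to \<open>c\<close>.\<close>

lemma boundary_value_BMO: "boundary_value f \<in> circle_BMO"
proof -
  let ?u = "\<lambda>\<theta>. boundary_value f (cis \<theta>)"
  let ?K = "2 * (pi * C\<^sup>2 + 1 / 2) + C"
  have "(LINT \<theta>:{a..b}|lebesgue. norm (?u \<theta> - arc_mean (boundary_value f) a b)) / (b - a) \<le> 2 * ?K"
    if ab: "a < b" "b \<le> a + 2 * pi" for a b
  proof -
    obtain c where c: "(\<integral>\<^sup>+ \<theta>\<in>{a..b}. ennreal (norm (?u \<theta> - c)) \<partial>lebesgue) \<le> ennreal (?K * (b - a))"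
      using arc_oscillation_le[OF ab] .
    have cst: "set_integrable lebesgue {a..b} (\<lambda>\<theta>. d)" for d :: complex
      by (intro absolutely_integrable_on_const lmeasurable_interval)
    have cI: "(LINT \<theta>:{a..b}|lebesgue. d) = of_real (b - a) * d" for d :: complex
      using ab by (subst set_integral_const) (auto simp: scaleR_conv_of_real measure_completion)
    have cIr: "(LINT \<theta>:{a..b}|lebesgue. d) = (b - a) * d" for d :: real
      using ab by (subst set_integral_const) (auto simp: measure_completion)
    have cstr: "set_integrable lebesgue {a..b} (\<lambda>\<theta>. d)" for d :: real
      by (intro absolutely_integrable_on_const lmeasurable_interval)
    have di: "set_integrable lebesgue {a..b} (\<lambda>\<theta>. ?u \<theta> - d)" for d
      by (intro set_integral_diff boundary_value_integrable ab cst)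
    define J where "J = (LINT \<theta>:{a..b}|lebesgue. norm (?u \<theta> - c))"
    have J0: "0 \<le> J" unfolding J_def set_lebesgue_integral_def by (intro integral_nonneg_AE) auto
    have "ennreal J = (\<integral>\<^sup>+ \<theta>\<in>{a..b}. ennreal (norm (?u \<theta> - c)) \<partial>lebesgue)"
    proof -
      have "ennreal J = (\<integral>\<^sup>+ \<theta>. ennreal (indicat_real {a..b} \<theta> *\<^sub>R norm (?u \<theta> - c)) \<partial>lebesgue)"
        unfolding J_def set_lebesgue_integral_def using set_integrable_norm[OF di[of c]]
        by (intro nn_integral_eq_integral[symmetric]) (auto simp: set_integrable_def)
      also have "\<dots> = (\<integral>\<^sup>+ \<theta>\<in>{a..b}. ennreal (norm (?u \<theta> - c)) \<partial>lebesgue)"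
        by (intro nn_integral_cong) (auto simp: indicator_def)
      finally show ?thesis .
    qed
    then have "ennreal J \<le> ennreal (?K * (b - a))" using c by (simp only:)
    moreover have "0 \<le> ?K * (b - a)" using C_nonneg ab by (intro mult_nonneg_nonneg) auto
    ultimately have J: "J \<le> ?K * (b - a)" by (simp only: ennreal_le_iff)
    define m where "m = arc_mean (boundary_value f) a b"
    have "of_real (b - a) * (m - c) = (LINT \<theta>:{a..b}|lebesgue. ?u \<theta> - c)"
      using ab set_integral_diff(2)[OF boundary_value_integrable[OF ab] cst[of c]]
      by (simp add: cI m_def arc_mean_def right_diff_distrib)
    then have "norm (of_real (b - a) * (m - c)) \<le> J"
      unfolding J_def using set_integral_norm_bound[OF di[of c]] by simp
    then have m: "(b - a) * norm (m - c) \<le> J" using ab by (simp add: norm_mult del: of_real_diff)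
    have "(LINT \<theta>:{a..b}|lebesgue. norm (?u \<theta> - m)) \<le> (LINT \<theta>:{a..b}|lebesgue. norm (?u \<theta> - c) + norm (m - c))"
    proof (rule set_integral_mono)
      show "set_integrable lebesgue {a..b} (\<lambda>\<theta>. norm (?u \<theta> - m))" by (rule set_integrable_norm[OF di])
      show "set_integrable lebesgue {a..b} (\<lambda>\<theta>. norm (?u \<theta> - c) + norm (m - c))"
        by (intro set_integral_add set_integrable_norm[OF di] cstr)
      show "norm (?u \<theta> - m) \<le> norm (?u \<theta> - c) + norm (m - c)" for \<theta>
        using norm_triangle_ineq4[of "?u \<theta> - c" "m - c"] by simp
    qed
    also have "\<dots> = J + (b - a) * norm (m - c)"
      unfolding J_def by (subst set_integral_add(2)[OF set_integrable_norm[OF di] cstr]) (simp add: cIr)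
    also have "\<dots> \<le> 2 * ?K * (b - a)" using m J mult.assoc[of 2 ?K "b - a"] by linarith
    finally show ?thesis using ab by (simp add: m_def pos_divide_le_eq)
  qed
  moreover have "set_integrable lebesgue {0..2 * pi} ?u"
    using boundary_value_integrable[of 0 "2 * pi"] by simp
  ultimately show ?thesis unfolding circle_BMO_def by blast
qed

text \<open>\<open>norm (f 0) + radial_variation 0 \<theta>\<close> majorises \<open>norm f\<close>
  along the whole radius and is integrable in \<open>\<theta>\<close>, which bounds the circle means
  uniformly in \<open>r\<close>.\<close>

lemma in_hardy_H1: "f \<in> hardy_H1"
proof -
  have "(\<integral>\<^sup>+ \<theta>\<in>{0..2 * pi}. ennreal (norm (f (of_real r * cis \<theta>)) / (2 * pi)) \<partial>lebesgue)
      \<le> (\<integral>\<^sup>+ \<theta>. ennreal (norm (f 0)) * indicator {0..2 * pi} \<theta> + radial_variation 0 \<theta> * indicator {0..2 * pi} \<theta> \<partial>lborel)"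
    if r: "r \<in> {0..<1}" for r
  proof -
    have "(\<integral>\<^sup>+ \<theta>\<in>{0..2 * pi}. ennreal (norm (f (of_real r * cis \<theta>)) / (2 * pi)) \<partial>lebesgue)
      \<le> (\<integral>\<^sup>+ \<theta>. ennreal (norm (f 0)) * indicator {0..2 * pi} \<theta> + radial_variation 0 \<theta> * indicator {0..2 * pi} \<theta> \<partial>lebesgue)"
    proof (rule nn_integral_mono)
      fix \<theta> :: real
      have "norm (f (of_real r * cis \<theta>)) / (2 * pi) \<le> norm (f (of_real r * cis \<theta>)) / 1"
        using pi_gt3 by (intro divide_left_mono) auto
      also have "\<dots> \<le> norm (f 0) + norm (f (of_real r * cis \<theta>) - f (of_real 0 * cis \<theta>))"
        by (simp add: norm_triangle_sub)
      finally have "ennreal (norm (f (of_real r * cis \<theta>)) / (2 * pi)) \<le> ennreal (norm (f 0)) + ennreal (norm (f (of_real r * cis \<theta>) - f (of_real 0 * cis \<theta>)))"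
        by (simp flip: ennreal_plus add: ennreal_leI)
      also have "\<dots> \<le> ennreal (norm (f 0)) + radial_variation 0 \<theta>"
        using r by (intro add_mono radial_increment_le) auto
      finally show "ennreal (norm (f (of_real r * cis \<theta>)) / (2 * pi)) * indicator {0..2 * pi} \<theta> \<le> ennreal (norm (f 0)) * indicator {0..2 * pi} \<theta> + radial_variation 0 \<theta> * indicator {0..2 * pi} \<theta>"
        by (auto simp: indicator_def)
    qed
    also have "\<dots> = (\<integral>\<^sup>+ \<theta>. ennreal (norm (f 0)) * indicator {0..2 * pi} \<theta> + radial_variation 0 \<theta> * indicator {0..2 * pi} \<theta> \<partial>lborel)"
      by (intro nn_integral_completion) measurable
    finally show ?thesis .
  qed
  then have "(SUP r\<in>{0..<1}. \<integral>\<^sup>+ \<theta>\<in>{0..2 * pi}. ennreal (norm (f (of_real r * cis \<theta>)) / (2 * pi)) \<partial>lebesgue)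
     \<le> (\<integral>\<^sup>+ \<theta>. ennreal (norm (f 0)) * indicator {0..2 * pi} \<theta> + radial_variation 0 \<theta> * indicator {0..2 * pi} \<theta> \<partial>lborel)"
    by (rule SUP_least)
  also have "\<dots> = ennreal (norm (f 0)) * ennreal (2 * pi) + (\<integral>\<^sup>+ \<theta>\<in>{0..2 * pi}. radial_variation 0 \<theta> \<partial>lborel)"
    by (subst nn_integral_add) (auto simp: nn_integral_cmult_indicator)
  also have "\<dots> < top"
    using arc_mean_radial_variation_le[of 0 0 "2 * pi"]
    by (auto simp: ennreal_mult[symmetric] less_top[symmetric] top_unique)
  finally show ?thesis unfolding hardy_H1_def using hol by simp
qed

lemma in_BMOA: "f \<in> BMOA"
  unfolding BMOA_def using in_hardy_H1 boundary_value_BMO by simp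

end

section \<open>The Garsia norm\<close>

text \<open>Isolates the radial factor \<open>1 - (norm z)\<^sup>2\<close>, so that the denominator
  can be attached to the derivative.\<close>

lemma one_minus_norm_disc_aut_sq:
  assumes "norm a < 1" "norm z < 1"
  shows "1 - (norm (disc_aut a z))\<^sup>2 = (1 - (norm a)\<^sup>2) * (1 - (norm z)\<^sup>2) / (norm (1 - cnj a * z))\<^sup>2"
proof -
  have "norm (cnj a * z) < 1"
    using assms mult_strict_mono'[of "norm a" 1 "norm z" 1] by (simp add: norm_mult)
  then have n0: "norm (1 - cnj a * z) \<noteq> 0" by auto
  have "(norm (1 - cnj a * z))\<^sup>2 - (norm (a - z))\<^sup>2 = (1 - (norm a)\<^sup>2) * (1 - (norm z)\<^sup>2)"
    unfolding cmod_power2 by (simp add: power2_eq_square algebra_simps)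
  then show ?thesis using n0
    by (simp add: disc_aut_def norm_divide power_divide diff_divide_eq_iff)
qed

lemma borel_measurable_indicator_mult_continuous:
  assumes "continuous_on A h" "A \<in> sets borel"
  shows "(\<lambda>z. ennreal (h z) * indicator A z) \<in> borel_measurable borel"
proof -
  have "(\<lambda>z. ennreal (indicat_real A z *\<^sub>R h z)) \<in> borel_measurable borel"
    using borel_measurable_continuous_on_indicator[OF assms(2,1)] by measurable
  then show ?thesis
    by (rule back_subst[of "\<lambda>f. f \<in> borel_measurable borel"]) (auto simp: indicator_def)
qed

text \<open>After averaging over rotations, Parseval on each circle reduces the claim to the
  integrals of \<open>nn_integral_unit_disc_power\<close>. The bound \<open>B\<close> makes the
  coefficient sums converge on circles of radius below 1.\<close>

lemma area_square_integral_le: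
  fixes d :: "nat \<Rightarrow> complex"
  assumes g: "\<And>z. norm z < 1 \<Longrightarrow> (\<lambda>n. d n * z ^ n) sums g z"
    and d: "\<And>n. norm (d n) \<le> B"
    and s: "summable (\<lambda>n. (norm (d n))\<^sup>2 / ((real n + 1) * (real n + 2)))"
  shows "(\<integral>\<^sup>+ z\<in>unit_disc. ennreal ((norm (g z))\<^sup>2 * (1 - (norm z)\<^sup>2)) \<partial>lborel)
    \<le> ennreal (pi * (\<Sum>n. (norm (d n))\<^sup>2 / ((real n + 1) * (real n + 2))))"
proof -
  define H where "H z = ennreal ((norm (g z))\<^sup>2 * (1 - (norm z)\<^sup>2)) * indicator unit_disc z" for z
  have hol: "g holomorphic_on unit_disc" using g by (rule power_series_on_unit_disc)
  have Hm: "H \<in> borel_measurable borel" unfolding H_def[abs_def]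
    by (intro borel_measurable_indicator_mult_continuous continuous_intros holomorphic_on_imp_continuous_on hol borel_open) auto
  have B0: "B \<ge> 0" using order_trans[OF norm_ge_zero d[of 0]] .
  have sm: "summable (\<lambda>n. (norm (d n))\<^sup>2 * ((norm z)\<^sup>2) ^ n)" if "norm z < 1" for z :: complex
  proof (rule summable_comparison_test')
    show "summable (\<lambda>n. B\<^sup>2 * ((norm z)\<^sup>2) ^ n)"
      using that by (intro summable_mult summable_geometric) (simp add: abs_square_less_1)
    show "norm ((norm (d n))\<^sup>2 * ((norm z)\<^sup>2) ^ n) \<le> B\<^sup>2 * ((norm z)\<^sup>2) ^ n" for n
      using d[of n] by (auto simp: abs_mult intro!: mult_right_mono power_mono)
  qed
  have inner: "(\<integral>\<^sup>+ x\<in>{0..2 * pi}. H (cis (1 * x) * z) \<partial>lborel)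
      \<le> (\<Sum>n. ennreal (2 * pi * (norm (d n))\<^sup>2) * (ennreal (((norm z)\<^sup>2) ^ n * (1 - (norm z)\<^sup>2)) * indicator unit_disc z))" for z
  proof (cases "norm z < 1")
    case True
    have z1: "(norm z)\<^sup>2 \<le> 1" using True by (simp add: abs_square_le_1)
    define G where "G x = (norm (g (cis x * z)))\<^sup>2" for x
    have [measurable]: "G \<in> borel_measurable borel"
      unfolding G_def using True by (intro borel_measurable_continuous_onI continuous_intros continuous_on_compose2[OF holomorphic_on_imp_continuous_on[OF hol]]) (auto simp: norm_mult)
    have "(\<integral>\<^sup>+ x\<in>{0..2 * pi}. H (cis (1 * x) * z) \<partial>lborel)
       = (\<integral>\<^sup>+ x. ennreal (1 - (norm z)\<^sup>2) * (ennreal (G x) * indicator {0..0 + 2 * pi} x) \<partial>lborel)"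
      using True z1 by (intro nn_integral_cong) (auto simp: G_def H_def norm_mult ennreal_mult mult_ac)
    also have "\<dots> = ennreal (1 - (norm z)\<^sup>2) * (\<integral>\<^sup>+ x\<in>{0..0 + 2 * pi}. ennreal ((norm (g (cis x * z)))\<^sup>2) \<partial>lborel)"
      unfolding G_def[symmetric] by (intro nn_integral_cmult) measurable
    also have "\<dots> \<le> ennreal (1 - (norm z)\<^sup>2) * ennreal (2 * pi * (\<Sum>n. (norm (d n))\<^sup>2 * ((norm z)\<^sup>2) ^ n))"
    proof (intro mult_left_mono circle_mean_square_le[where c = "\<lambda>n. d n * z ^ n"])
      fix \<theta>
      have "norm (cis \<theta> * z) < 1" using True by (simp add: norm_mult)
      from g[OF this] show "(\<lambda>n. d n * z ^ n * cis (real n * \<theta>)) sums g (cis \<theta> * z)"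
        by (simp only: power_mult_distrib Complex.DeMoivre mult_ac)
    next
      fix N
      have "(\<Sum>n<N. (norm (d n * z ^ n))\<^sup>2) = (\<Sum>n<N. (norm (d n))\<^sup>2 * ((norm z)\<^sup>2) ^ n)"
        by (simp add: norm_mult norm_power power_mult_distrib mult.commute flip: power_mult)
      also have "\<dots> \<le> (\<Sum>n. (norm (d n))\<^sup>2 * ((norm z)\<^sup>2) ^ n)"
        by (intro sum_le_suminf sm True) auto
      finally show "(\<Sum>n<N. (norm (d n * z ^ n))\<^sup>2) \<le> (\<Sum>n. (norm (d n))\<^sup>2 * ((norm z)\<^sup>2) ^ n)" .
    qed auto
    also have "\<dots> = ennreal (2 * pi * (1 - (norm z)\<^sup>2)) * (\<Sum>n. ennreal ((norm (d n))\<^sup>2 * ((norm z)\<^sup>2) ^ n))"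
      using z1 suminf_nonneg[OF sm[OF True]] by (subst suminf_ennreal2[OF _ sm[OF True]]) (auto simp: ennreal_mult[symmetric] mult_ac)
    also have "\<dots> = (\<Sum>n. ennreal (2 * pi * (1 - (norm z)\<^sup>2)) * ennreal ((norm (d n))\<^sup>2 * ((norm z)\<^sup>2) ^ n))"
      by (rule ennreal_suminf_cmult[symmetric])
    also have "\<dots> = (\<Sum>n. ennreal (2 * pi * (norm (d n))\<^sup>2) * (ennreal (((norm z)\<^sup>2) ^ n * (1 - (norm z)\<^sup>2)) * indicator unit_disc z))"
      using True z1 by (intro suminf_cong) (simp add: ennreal_mult[symmetric] mult_ac)
    finally show ?thesis .
  qed (auto simp: H_def norm_mult)
  have "ennreal (2 * pi) * (\<integral>\<^sup>+ z. H z \<partial>lborel) = (\<integral>\<^sup>+ z. (\<integral>\<^sup>+ x\<in>{0..2 * pi}. H (cis (1 * x) * z) \<partial>lborel) \<partial>lborel)"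
    using nn_integral_rotation_average[OF Hm, of "{0..2 * pi}" 1] by simp
  also have "\<dots> \<le> (\<integral>\<^sup>+ z. (\<Sum>n. ennreal (2 * pi * (norm (d n))\<^sup>2) * (ennreal (((norm z)\<^sup>2) ^ n * (1 - (norm z)\<^sup>2)) * indicator unit_disc z)) \<partial>lborel)"
    by (intro nn_integral_mono inner)
  also have "\<dots> = (\<Sum>n. ennreal (2 * pi * (norm (d n))\<^sup>2) * ennreal (pi / ((real n + 1) * (real n + 2))))"
  proof -
    have m: "(\<lambda>z::complex. ennreal (((norm z)\<^sup>2) ^ n * (1 - (norm z)\<^sup>2)) * indicator unit_disc z) \<in> borel_measurable borel" for n
      by (intro borel_measurable_indicator_mult_continuous continuous_intros borel_open) auto
    then show ?thesis
      by (subst nn_integral_suminf) (auto simp: nn_integral_cmult nn_integral_unit_disc_power)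
  qed
  also have "\<dots> = (\<Sum>n. ennreal (2 * pi) * ennreal (pi * ((norm (d n))\<^sup>2 / ((real n + 1) * (real n + 2)))))"
    by (intro suminf_cong) (simp add: ennreal_mult[symmetric] mult_ac)
  also have "\<dots> = ennreal (2 * pi) * (\<Sum>n. ennreal (pi * ((norm (d n))\<^sup>2 / ((real n + 1) * (real n + 2)))))"
    by (rule ennreal_suminf_cmult)
  also have "(\<Sum>n. ennreal (pi * ((norm (d n))\<^sup>2 / ((real n + 1) * (real n + 2))))) = ennreal (\<Sum>n. pi * ((norm (d n))\<^sup>2 / ((real n + 1) * (real n + 2))))"
    using s by (intro suminf_ennreal2 summable_mult) auto
  also have "(\<Sum>n. pi * ((norm (d n))\<^sup>2 / ((real n + 1) * (real n + 2)))) = pi * (\<Sum>n. (norm (d n))\<^sup>2 / ((real n + 1) * (real n + 2)))"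
    by (rule suminf_mult[OF s])
  finally show ?thesis
    unfolding H_def by (subst (asm) ennreal_mult_le_mult_iff) auto
qed

section \<open>Garsia integrals of functions with coefficients of order 1/n\<close>

context HL_function
begin

text \<open>With \<open>M = 1 / (1 - \<rho>)\<close>, the coefficients of \<open>g\<close> are at
  most \<open>C\<close> times both \<open>n + 1\<close> and \<open>M\<close>. Their squares, divided
  by \<open>(n + 1) * (n + 2)\<close>, give about \<open>M\<close> terms of bounded size and a tail
  of order \<open>M\<close>. As \<open>(1 - \<rho>\<^sup>2) * M = 1 + \<rho> \<le> 2\<close>, the
  result is uniform in \<open>\<alpha>\<close>.\<close>

lemma garsia_integral_le:
  assumes \<alpha>: "norm \<alpha> < 1"
  shows "(\<integral>\<^sup>+ z\<in>unit_disc. ennreal ((norm (deriv f z))\<^sup>2 * (1 - (norm (disc_aut \<alpha> z))\<^sup>2) / pi) \<partial>lebesgue)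
    \<le> ennreal (8 * C\<^sup>2)"
proof -
  define \<rho> where "\<rho> = norm \<alpha>"
  have \<rho>: "0 \<le> \<rho>" "\<rho> < 1" using \<alpha> by (auto simp: \<rho>_def)
  define M where "M = 1 / (1 - \<rho>)"
  have M: "M > 0" "(1 - \<rho>) * M = 1" using \<rho> by (auto simp: M_def)
  \<comment> \<open>Cauchy product of the series of \<open>deriv f\<close> with the geometric series
    of \<open>1 / (1 - cnj \<alpha> * z)\<close>.\<close>
  define d where "d n = (\<Sum>k\<le>n. diffs coeff k * cnj \<alpha> ^ (n - k))" for n
  define g where "g z = deriv f z * (1 / (1 - cnj \<alpha> * z))" for z
  have az: "norm (cnj \<alpha> * z) < 1" if "norm z < 1" for z
    using that \<alpha> mult_strict_mono'[of "norm \<alpha>" 1 "norm z" 1] by (simp add: norm_mult)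
  have gs: "(\<lambda>n. d n * z ^ n) sums g z" if z: "norm z < 1" for z
  proof -
    have s1: "summable (\<lambda>k. norm (diffs coeff k * z ^ k))"
    proof (rule summable_comparison_test')
      show "summable (\<lambda>k. C * norm z ^ k)" using z by (intro summable_mult summable_geometric) auto
      show "norm (norm (diffs coeff k * z ^ k)) \<le> C * norm z ^ k" for k
        by (auto simp: norm_mult norm_power intro!: mult_right_mono norm_diffs_le)
    qed
    have s2: "summable (\<lambda>k. norm ((cnj \<alpha> * z) ^ k))"
      using az[OF z] by (simp add: norm_power summable_geometric)
    have "(\<lambda>n. \<Sum>k\<le>n. diffs coeff k * z ^ k * (cnj \<alpha> * z) ^ (n - k)) sums
        ((\<Sum>k. diffs coeff k * z ^ k) * (\<Sum>k. (cnj \<alpha> * z) ^ k))"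
      by (rule Cauchy_product_sums[OF s1 s2])
    also have "(\<Sum>k. diffs coeff k * z ^ k) = deriv f z"
      using deriv_sums_on_unit_disc[OF hol z] by (rule sums_unique[symmetric])
    also have "(\<Sum>k. (cnj \<alpha> * z) ^ k) = 1 / (1 - cnj \<alpha> * z)"
      using az[OF z] by (rule suminf_geometric)
    also have "(\<lambda>n. \<Sum>k\<le>n. diffs coeff k * z ^ k * (cnj \<alpha> * z) ^ (n - k)) = (\<lambda>n. d n * z ^ n)"
    proof (rule ext)
      fix n
      show "(\<Sum>k\<le>n. diffs coeff k * z ^ k * (cnj \<alpha> * z) ^ (n - k)) = d n * z ^ n"
        unfolding d_def sum_distrib_right
      proof (intro sum.cong refl)
        fix k assume "k \<in> {..n}"
        then have "z ^ n = z ^ k * z ^ (n - k)" by (simp flip: power_add)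
        then show "diffs coeff k * z ^ k * (cnj \<alpha> * z) ^ (n - k) = diffs coeff k * cnj \<alpha> ^ (n - k) * z ^ n"
          by (simp add: power_mult_distrib mult_ac)
      qed
    qed
    finally show ?thesis by (simp add: g_def)
  qed
  define \<sigma> where "\<sigma> n = (\<Sum>k\<le>n. \<rho> ^ (n - k))" for n
  have \<sigma>: "0 \<le> \<sigma> n" "\<sigma> n \<le> real n + 1" "\<sigma> n \<le> M" for n
  proof -
    have eq: "\<sigma> n = (\<Sum>k<Suc n. \<rho> ^ k)"
      unfolding \<sigma>_def lessThan_Suc_atMost by (rule sum.reindex_bij_witness[of _ "\<lambda>k. n - k" "\<lambda>k. n - k"]) auto
    show "0 \<le> \<sigma> n" unfolding eq using \<rho> by (intro sum_nonneg) auto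
    have "\<sigma> n \<le> (\<Sum>k<Suc n. 1)" unfolding eq using \<rho> by (intro sum_mono power_le_one) auto
    then show "\<sigma> n \<le> real n + 1" by simp
    have "\<sigma> n \<le> (\<Sum>k. \<rho> ^ k)" unfolding eq using \<rho> by (intro sum_le_suminf summable_geometric) auto
    then show "\<sigma> n \<le> M" using \<rho> by (simp add: suminf_geometric M_def)
  qed
  have dn: "norm (d n) \<le> C * \<sigma> n" for n
  proof -
    have "norm (d n) \<le> (\<Sum>k\<le>n. C * \<rho> ^ (n - k))"
      unfolding d_def using C_nonneg by (intro sum_norm_le) (auto simp: norm_mult norm_power \<rho>_def intro!: mult_right_mono norm_diffs_le)
    then show ?thesis by (simp add: \<sigma>_def sum_distrib_left)
  qed
  \<comment> \<open>The differences are \<open>1 / ((n + M) * (n + 1 + M))\<close> and sum to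
    \<open>1 / M\<close>.\<close>
  define t where "t n = - 1 / (real n + M)" for n
  have tsum: "(\<lambda>n. t (Suc n) - t n) sums (0 - t 0)"
    unfolding t_def using M(1) by (intro telescope_sums) real_asymp
  have term_le: "(norm (d n))\<^sup>2 / ((real n + 1) * (real n + 2)) \<le> 4 * C\<^sup>2 * M\<^sup>2 * (t (Suc n) - t n)" for n
  proof -
    define x where "x = real n + 1"
    have x: "x \<ge> 1" by (simp add: x_def)
    \<comment> \<open>the harmonic mean of \<open>n + 1\<close> and \<open>M\<close> dominates their minimum and makes the bound telescope\<close>
    have "\<sigma> n * x + \<sigma> n * M \<le> M * x + x * M"
      using \<sigma>[of n] x M by (intro add_mono mult_right_mono) (auto simp: x_def)
    then have "\<sigma> n \<le> 2 * x * M / (x + M)" using x M by (simp add: field_simps)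
    then have "norm (d n) \<le> C * (2 * x * M / (x + M))"
      using dn[of n] C_nonneg by (meson mult_left_mono order_trans)
    then have "(norm (d n))\<^sup>2 \<le> (C * (2 * x * M / (x + M)))\<^sup>2" by (intro power_mono) auto
    then have "(norm (d n))\<^sup>2 / (x * (x + 1)) \<le> (C * (2 * x * M / (x + M)))\<^sup>2 / (x * (x + 1))"
      using x by (intro divide_right_mono) auto
    also have "\<dots> = 4 * C\<^sup>2 * M\<^sup>2 * (x / ((x + 1) * (x + M)\<^sup>2))"
      using x M by (simp add: power2_eq_square divide_simps)
    also have "\<dots> \<le> 4 * C\<^sup>2 * M\<^sup>2 * (1 / ((x + M - 1) * (x + M)))"
    proof (rule mult_left_mono)
      define p q where "p = (x + 1) * (x + M)\<^sup>2" and "q = (x + M - 1) * (x + M)"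
      have "x * q \<le> p"
        unfolding p_def q_def power2_eq_square using x M by (intro mult_mono) auto
      moreover have "p > 0" "q > 0" unfolding p_def q_def using x M by (auto intro!: mult_pos_pos)
      ultimately have "x / p \<le> 1 / q" by (simp add: field_simps)
      then show "x / ((x + 1) * (x + M)\<^sup>2) \<le> 1 / ((x + M - 1) * (x + M))"
        by (simp only: p_def q_def)
    qed (use M in auto)
    also have "1 / ((x + M - 1) * (x + M)) = t (Suc n) - t n"
      using M by (simp add: t_def x_def divide_simps)
    finally show ?thesis by (simp add: x_def add.commute)
  qed
  have ss: "summable (\<lambda>n. (norm (d n))\<^sup>2 / ((real n + 1) * (real n + 2)))"
    by (rule summable_comparison_test'[OF summable_mult[OF sums_summable[OF tsum]]]) (use term_le in auto)
  have "(\<Sum>n. (norm (d n))\<^sup>2 / ((real n + 1) * (real n + 2))) \<le> (\<Sum>n. 4 * C\<^sup>2 * M\<^sup>2 * (t (Suc n) - t n))"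
    by (intro suminf_le term_le ss summable_mult sums_summable[OF tsum])
  also have "\<dots> = 4 * C\<^sup>2 * M\<^sup>2 * (0 - t 0)"
    using sums_unique[OF sums_mult[OF tsum]] by simp
  also have "\<dots> = 4 * C\<^sup>2 * M" using M by (simp add: t_def power2_eq_square)
  finally have sum_le: "(\<Sum>n. (norm (d n))\<^sup>2 / ((real n + 1) * (real n + 2))) \<le> 4 * C\<^sup>2 * M" .
  have g_hol: "g holomorphic_on unit_disc" using gs by (rule power_series_on_unit_disc)
  define H where "H z = ennreal ((norm (g z))\<^sup>2 * (1 - (norm z)\<^sup>2)) * indicator unit_disc z" for z
  have Hm: "H \<in> borel_measurable borel" unfolding H_def[abs_def]
    by (intro borel_measurable_indicator_mult_continuous continuous_intros holomorphic_on_imp_continuous_on g_hol borel_open) auto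
  have r1: "0 \<le> (1 - \<rho>\<^sup>2) / pi" using \<rho> by (simp add: abs_square_le_1)
  have "(\<integral>\<^sup>+ z\<in>unit_disc. ennreal ((norm (deriv f z))\<^sup>2 * (1 - (norm (disc_aut \<alpha> z))\<^sup>2) / pi) \<partial>lebesgue)
     = (\<integral>\<^sup>+ z. ennreal ((1 - \<rho>\<^sup>2) / pi) * H z \<partial>lebesgue)"
  proof (intro nn_integral_cong)
    fix z :: complex
    show "ennreal ((norm (deriv f z))\<^sup>2 * (1 - (norm (disc_aut \<alpha> z))\<^sup>2) / pi) * indicator unit_disc z = ennreal ((1 - \<rho>\<^sup>2) / pi) * H z"
    proof (cases "norm z < 1")
      case True
      have "(norm (deriv f z))\<^sup>2 * (1 - (norm (disc_aut \<alpha> z))\<^sup>2) / pi = (1 - \<rho>\<^sup>2) / pi * ((norm (g z))\<^sup>2 * (1 - (norm z)\<^sup>2))"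
        unfolding one_minus_norm_disc_aut_sq[OF \<alpha> True]
        by (simp add: g_def \<rho>_def norm_mult norm_divide power_divide mult_ac)
      then show ?thesis using True r1 by (simp add: H_def ennreal_mult[symmetric] abs_square_le_1)
    qed (simp add: H_def)
  qed
  also have "\<dots> = (\<integral>\<^sup>+ z. ennreal ((1 - \<rho>\<^sup>2) / pi) * H z \<partial>lborel)"
    using Hm by (intro nn_integral_completion) measurable
  also have "\<dots> = ennreal ((1 - \<rho>\<^sup>2) / pi) * (\<integral>\<^sup>+ z. H z \<partial>lborel)"
    using Hm by (intro nn_integral_cmult) measurable
  also have "\<dots> \<le> ennreal ((1 - \<rho>\<^sup>2) / pi) * ennreal (pi * (4 * C\<^sup>2 * M))"
  proof (rule mult_left_mono)
    have "(\<integral>\<^sup>+ z. H z \<partial>lborel) \<le> ennreal (pi * (\<Sum>n. (norm (d n))\<^sup>2 / ((real n + 1) * (real n + 2))))"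
      unfolding H_def
    proof (rule area_square_integral_le[OF gs _ ss])
      show "norm (d n) \<le> C * M" for n
        using dn[of n] \<sigma>(3)[of n] C_nonneg by (meson mult_left_mono order_trans)
    qed
    also have "\<dots> \<le> ennreal (pi * (4 * C\<^sup>2 * M))"
      by (intro ennreal_leI mult_left_mono sum_le) auto
    finally show "(\<integral>\<^sup>+ z. H z \<partial>lborel) \<le> ennreal (pi * (4 * C\<^sup>2 * M))" .
  qed simp
  also have "\<dots> = ennreal ((1 - \<rho>\<^sup>2) / pi * (pi * (4 * C\<^sup>2 * M)))"
    using r1 M by (intro ennreal_mult[symmetric]) auto
  also have "(1 - \<rho>\<^sup>2) / pi * (pi * (4 * C\<^sup>2 * M)) = (1 + \<rho>) * (4 * C\<^sup>2) * ((1 - \<rho>) * M)"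
  proof -
    have "(1 - \<rho>\<^sup>2) / pi * (pi * y) = (1 - \<rho>\<^sup>2) * y" for y by simp
    then show ?thesis by (simp only:) (simp add: power2_eq_square algebra_simps)
  qed
  also have "\<dots> = (1 + \<rho>) * (4 * C\<^sup>2)" unfolding M(2) by simp
  also have "ennreal \<dots> \<le> ennreal (2 * (4 * C\<^sup>2))"
    using \<rho> by (intro ennreal_leI mult_right_mono) auto
  finally show ?thesis by simp
qed

text \<open>The value at 0 contributes \<open>C\<^sup>2\<close> and the Garsia integrals
  \<open>8 * C\<^sup>2\<close>, together \<open>(3 * C)\<^sup>2\<close>; the constant is the same as
  for the Bloch norm.\<close>

lemma BMOA_norm_le: "BMOA_norm f \<le> ennreal (3 * C)"
proof -
  have "(SUP a\<in>unit_disc. \<integral>\<^sup>+ z\<in>unit_disc.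
        ennreal ((norm (deriv f z))\<^sup>2 * (1 - (norm (disc_aut a z))\<^sup>2) / pi) \<partial>lebesgue) \<le> ennreal (8 * C\<^sup>2)"
    by (intro SUP_least garsia_integral_le) auto
  moreover have "ennreal ((norm (f 0))\<^sup>2) \<le> ennreal (C\<^sup>2)"
    by (intro ennreal_leI power_mono norm_at_0_le) auto
  ultimately have "BMOA_norm_sq f \<le> ennreal (C\<^sup>2) + ennreal (8 * C\<^sup>2)"
    unfolding BMOA_norm_sq_def by (rule add_mono[rotated])
  also have "\<dots> = ennreal ((3 * C)\<^sup>2)" by (simp add: power_mult_distrib flip: ennreal_plus)
  finally have *: "BMOA_norm_sq f \<le> ennreal ((3 * C)\<^sup>2)" .
  then have "enn2real (BMOA_norm_sq f) \<le> (3 * C)\<^sup>2"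
    by (metis enn2real_ennreal enn2real_mono ennreal_less_top zero_le_power2)
  then have "sqrt (enn2real (BMOA_norm_sq f)) \<le> 3 * C"
    using C_nonneg by (intro real_le_lsqrt) auto
  moreover have "BMOA_norm_sq f \<noteq> top" using * by (auto simp: top_unique)
  ultimately show ?thesis unfolding BMOA_norm_def by (simp add: ennreal_leI)
qed

end

text \<open>On the disc of radius \<open>r = (1 - norm a) / 2\<close> about \<open>a\<close> the
  denominator \<open>1 - cnj a * z\<close> has modulus at least \<open>2 * r\<close>, so
  \<open>disc_aut a z\<close> has modulus at most 1/2 and the weight is at least 3/4. The area mean
  inequality bounds \<open>(r * norm (deriv f a))\<^sup>2\<close> by \<open>4 * N / 3\<close>, and
  \<open>1 - (norm a)\<^sup>2 \<le> 4 * r\<close>; the 64 is a rounded constant.\<close>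

lemma deriv_le_BMOA_norm_sq:
  assumes hol: "f holomorphic_on unit_disc" and N: "BMOA_norm_sq f \<le> ennreal N" "N \<ge> 0"
    and a: "norm a < 1"
  shows "(1 - (norm a)\<^sup>2) * norm (deriv f a) \<le> sqrt (64 * N)"
proof -
  define r where "r = (1 - norm a) / 2"
  have r: "r > 0" using a by (simp add: r_def)
  have in_disc: "norm z < 1" if "z \<in> ball a r" for z
    using that norm_triangle_sub[of z a] a by (simp add: r_def dist_norm norm_minus_commute field_simps)
  have dh: "deriv f holomorphic_on ball a r"
    by (rule holomorphic_on_subset[OF holomorphic_deriv[OF hol]]) (use in_disc in auto)
  have aut: "3 / 4 \<le> 1 - (norm (disc_aut a z))\<^sup>2" if z: "z \<in> ball a r" for z
  proof -
    have "norm (cnj a * z) \<le> norm a * 1"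
      using in_disc[OF z] by (simp add: norm_mult mult_left_le)
    then have "2 * r \<le> norm (1 - cnj a * z)"
      using norm_triangle_ineq2[of 1 "cnj a * z"] by (simp add: r_def)
    then have "norm (disc_aut a z) \<le> r / (2 * r)"
      unfolding disc_aut_def norm_divide using z r
      by (intro frac_le) (auto simp: dist_norm)
    then have "norm (disc_aut a z) \<le> 1 / 2" using r by simp
    then have "(norm (disc_aut a z))\<^sup>2 \<le> (1 / 2)\<^sup>2" by (intro power_mono) auto
    then show ?thesis by (simp add: power2_eq_square)
  qed
  define X where "X z = ennreal ((norm (deriv f z))\<^sup>2) * indicator (ball a r) z" for z
  have Xm: "X \<in> borel_measurable borel" unfolding X_def[abs_def]
    by (intro borel_measurable_indicator_mult_continuous continuous_intros holomorphic_on_imp_continuous_on dh borel_open) auto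
  have "ennreal (3 / (4 * pi)) * ennreal (pi * r\<^sup>2 * (norm (deriv f a))\<^sup>2) \<le> ennreal (3 / (4 * pi)) * (\<integral>\<^sup>+ z. X z \<partial>lborel)"
    unfolding X_def by (intro mult_left_mono area_mean_square_ge dh r) auto
  also have "\<dots> = (\<integral>\<^sup>+ z. ennreal (3 / (4 * pi)) * X z \<partial>lborel)"
    using Xm by (intro nn_integral_cmult[symmetric]) measurable
  also have "\<dots> = (\<integral>\<^sup>+ z. ennreal (3 / (4 * pi)) * X z \<partial>lebesgue)"
    using Xm by (intro nn_integral_completion[symmetric]) measurable
  also have "\<dots> \<le> (\<integral>\<^sup>+ z\<in>unit_disc. ennreal ((norm (deriv f z))\<^sup>2 * (1 - (norm (disc_aut a z))\<^sup>2) / pi) \<partial>lebesgue)"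
  proof (rule nn_integral_mono)
    fix z :: complex
    show "ennreal (3 / (4 * pi)) * X z \<le> ennreal ((norm (deriv f z))\<^sup>2 * (1 - (norm (disc_aut a z))\<^sup>2) / pi) * indicator unit_disc z"
    proof (cases "z \<in> ball a r")
      case True
      have "3 / (4 * pi) * (norm (deriv f z))\<^sup>2 = (norm (deriv f z))\<^sup>2 * (3 / 4) / pi" by simp
      also have "\<dots> \<le> (norm (deriv f z))\<^sup>2 * (1 - (norm (disc_aut a z))\<^sup>2) / pi"
        by (intro divide_right_mono mult_left_mono aut True) auto
      finally show ?thesis using True in_disc[OF True]
        by (simp add: X_def ennreal_mult[symmetric] ennreal_leI)
    qed (simp add: X_def)
  qed
  also have "\<dots> \<le> (SUP a\<in>unit_disc. \<integral>\<^sup>+ z\<in>unit_disc.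
        ennreal ((norm (deriv f z))\<^sup>2 * (1 - (norm (disc_aut a z))\<^sup>2) / pi) \<partial>lebesgue)"
    using a by (intro SUP_upper) auto
  also have "\<dots> \<le> BMOA_norm_sq f" unfolding BMOA_norm_sq_def by simp
  also note N(1)
  finally have "ennreal (3 / (4 * pi) * (pi * r\<^sup>2 * (norm (deriv f a))\<^sup>2)) \<le> ennreal N"
    by (simp add: ennreal_mult[symmetric])
  then have "3 / (4 * pi) * (pi * r\<^sup>2 * (norm (deriv f a))\<^sup>2) \<le> N"
    using N(2) by (subst (asm) ennreal_le_iff) auto
  then have b: "3 / 4 * (r\<^sup>2 * (norm (deriv f a))\<^sup>2) \<le> N" by simp
  have "1 - (norm a)\<^sup>2 = (1 + norm a) * (2 * r)"
    by (simp add: r_def power2_eq_square algebra_simps)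
  also have "\<dots> \<le> 2 * (2 * r)" using a r by (intro mult_right_mono) auto
  finally have "(1 - (norm a)\<^sup>2) * norm (deriv f a) \<le> 4 * r * norm (deriv f a)"
    by (intro mult_right_mono) auto
  moreover have "4 * r * norm (deriv f a) \<le> sqrt (64 * N)"
  proof (rule real_le_rsqrt)
    have "(4 * r * norm (deriv f a))\<^sup>2 = 16 * (r\<^sup>2 * (norm (deriv f a))\<^sup>2)"
      by (simp add: power2_eq_square)
    then show "(4 * r * norm (deriv f a))\<^sup>2 \<le> 64 * N" using b N(2) by simp
  qed
  ultimately show ?thesis by simp
qed

section \<open>Boundedness of the operators\<close>

context weight
begin

definition radial_op :: "(real \<Rightarrow> complex) \<Rightarrow> complex \<Rightarrow> complex" where
  "radial_op F z = (LINT t:{0..<1}|lebesgue. F t * kernel_average \<omega> t z * of_real (\<omega> t))"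

lemma radial_op_power_series:
  assumes F: "set_borel_measurable lebesgue {0..<1} F" "\<And>t. t \<in> {0..<1} \<Longrightarrow> norm (F t) \<le> B"
  shows "radial_op F holomorphic_on unit_disc"
    and "fps_nth (fps_expansion (radial_op F) 0) n = op_coeff F n"
proof -
  have "(\<lambda>n. op_coeff F n * z ^ n) sums radial_op F z" if "norm z < 1" for z
    unfolding radial_op_def using op_sums[OF F that] .
  note ps = power_series_on_unit_disc[OF this]
  show "radial_op F holomorphic_on unit_disc" by (rule ps)
  show "fps_nth (fps_expansion (radial_op F) 0) n = op_coeff F n" by (rule ps)
qed

text \<open>The factor \<open>n + 1\<close> of the norm cancels the one in
  \<open>kernel_denom\<close>, and \<open>M\<close> controls the remaining quotient of
  moments.\<close>

lemma radial_op_HL_function: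
  assumes F: "set_borel_measurable lebesgue {0..<1} F" "\<And>t. t \<in> {0..<1} \<Longrightarrow> norm (F t) \<le> B"
    and M: "\<And>n. moment \<omega> n \<le> M * moment \<omega> (2 * n + 1)"
  shows "HL_function (radial_op F) (B * M / 2)"
proof
  show "radial_op F holomorphic_on unit_disc" by (rule radial_op_power_series[OF F])
  fix n
  have "real (n + 1) * norm (fps_nth (fps_expansion (radial_op F) 0) n) \<le> real (n + 1) * (B * moment \<omega> n / kernel_denom n)"
  proof (rule mult_left_mono)
    show "norm (fps_nth (fps_expansion (radial_op F) 0) n) \<le> B * moment \<omega> n / kernel_denom n"
      using norm_op_coeff_le[OF F, of n] radial_op_power_series(2)[OF F, of n] by simp
  qed simp
  also have "\<dots> = B * moment \<omega> n / (2 * moment \<omega> (2 * n + 1))"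
  proof -
    have *: "k * (x / (2 * k * y)) = x / (2 * y)" if "k > 0" for k x y :: real
      using that by simp
    show ?thesis unfolding kernel_denom_def by (rule *) simp
  qed
  also have "\<dots> \<le> B * (M * moment \<omega> (2 * n + 1)) / (2 * moment \<omega> (2 * n + 1))"
    using bound_nonneg[OF F] moment_pos[of "2 * n + 1"] M[of n]
    by (intro divide_right_mono mult_left_mono) auto
  also have "\<dots> = B * M / 2" using moment_pos[of "2 * n + 1"] by simp
  finally show "real (n + 1) * norm (fps_nth (fps_expansion (radial_op F) 0) n) \<le> B * M / 2" .
qed

section \<open>Necessity of doubling: the image of the constant 1\<close>

lemma one_bounded:
  "set_borel_measurable lebesgue {0..<1} (\<lambda>_::real. 1 :: complex)" "\<And>t::real. t \<in> {0..<1} \<Longrightarrow> norm (1 :: complex) \<le> 1"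
  by (auto intro!: set_borel_measurable_continuous_lebesgue continuous_intros)

lemma radial_op_one:
  "radial_op (\<lambda>_. 1) holomorphic_on unit_disc"
  "fps_nth (fps_expansion (radial_op (\<lambda>_. 1)) 0) n = of_real (moment \<omega> n / kernel_denom n)"
  using radial_op_power_series[OF one_bounded] by (auto simp: op_coeff_one)

text \<open>All coefficients of the derivative are positive, so at a point \<open>x\<close> of the
  radius its value dominates any block of its series. For \<open>3 * m \<le> n < 4 * m\<close> one
  has \<open>n + 1 \<le> 4 * m\<close> and \<open>2 * n + 3 \<ge> 6 * m\<close>, so each quotient of
  moments is at least the quotient at \<open>4 * m\<close> and \<open>6 * m\<close>.\<close>

lemma moment_le_of_bloch:
  assumes K: "\<And>z. norm z < 1 \<Longrightarrow> (1 - (norm z)\<^sup>2) * norm (deriv (radial_op (\<lambda>_. 1)) z) \<le> K"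
    and m: "m \<ge> 1"
  shows "moment \<omega> (4 * m) \<le> 64 * K * moment \<omega> (6 * m)"
proof -
  \<comment> \<open>Bernoulli gives \<open>x ^ (4 * m) \<ge> 1 - 4 * m / (8 * m) = 1/2\<close>,
    while \<open>1 - x\<^sup>2\<close> is still at least \<open>1 / (8 * m)\<close>.\<close>
  define x where "x = 1 - 1 / (8 * real m)"
  have x: "0 \<le> x" "x < 1" using m by (auto simp: x_def field_simps)
  define p where "p n = real (Suc n) * (moment \<omega> (Suc n) / kernel_denom (Suc n))" for n
  have p0: "0 \<le> p n" for n unfolding p_def
    using moment_pos[of "Suc n"] kernel_denom_pos[of "Suc n"] by simp
  have "(\<lambda>n. diffs (fps_nth (fps_expansion (radial_op (\<lambda>_. 1)) 0)) n * of_real x ^ n) sums deriv (radial_op (\<lambda>_. 1)) (of_real x)"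
    using x by (intro deriv_sums_on_unit_disc radial_op_one) auto
  also have "(\<lambda>n. diffs (fps_nth (fps_expansion (radial_op (\<lambda>_. 1)) 0)) n * of_real x ^ n) = (\<lambda>n. of_real (p n * x ^ n))"
    unfolding diffs_def radial_op_one p_def by (simp only: of_real_mult of_real_of_nat_eq of_real_power)
  finally have "(\<lambda>n. Re (of_real (p n * x ^ n))) sums Re (deriv (radial_op (\<lambda>_. 1)) (of_real x))"
    by (rule sums_Re)
  then have s: "(\<lambda>n. p n * x ^ n) sums Re (deriv (radial_op (\<lambda>_. 1)) (of_real x))"
    by (simp only: Re_complex_of_real)
  \<comment> \<open>The 8 is 4 from \<open>(n + 1) / (2 * (n + 2)) \<ge> 1/4\<close> times 2 from
    \<open>x ^ n \<ge> 1/2\<close>. A further 8 from \<open>1 - x\<^sup>2\<close> makes up the final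
    64.\<close>
  define Q where "Q = moment \<omega> (4 * m) / (8 * moment \<omega> (6 * m))"
  have term_ge: "Q \<le> p n * x ^ n" if n: "n \<in> {3 * m..<4 * m}" for n
  proof -
    have "1 / 2 \<le> 1 + real (4 * m) * (- (1 / (8 * real m)))" using m by simp
    also have "\<dots> \<le> (1 + - (1 / (8 * real m))) ^ (4 * m)"
      using m by (intro Bernoulli_inequality) (simp add: field_simps)
    also have "\<dots> = x ^ (4 * m)" by (simp add: x_def)
    also have "\<dots> \<le> x ^ n" using n x by (intro power_decreasing) auto
    finally have xn: "1 / 2 \<le> x ^ n" .
    have "moment \<omega> (4 * m) / (4 * moment \<omega> (6 * m)) \<le> (real (Suc n) / (2 * real (Suc n + 1))) * (moment \<omega> (Suc n) / moment \<omega> (2 * Suc n + 1))"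
    proof -
      have "moment \<omega> (4 * m) / moment \<omega> (6 * m) \<le> moment \<omega> (Suc n) / moment \<omega> (2 * Suc n + 1)"
        using n moment_pos by (intro frac_le moment_antimono) (auto simp: less_imp_le)
      moreover have "1 / 4 \<le> real (Suc n) / (2 * real (Suc n + 1))" by (simp add: field_simps)
      ultimately have "1 / 4 * (moment \<omega> (4 * m) / moment \<omega> (6 * m)) \<le> (real (Suc n) / (2 * real (Suc n + 1))) * (moment \<omega> (Suc n) / moment \<omega> (2 * Suc n + 1))"
        using moment_pos by (intro mult_mono) (auto simp: less_imp_le)
      then show ?thesis by simp
    qed
    also have "\<dots> = p n" unfolding p_def kernel_denom_def by simp
    finally have "moment \<omega> (4 * m) / (4 * moment \<omega> (6 * m)) * (1 / 2) \<le> p n * x ^ n"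
      using xn p0[of n] by (intro mult_mono) auto
    then show ?thesis by (simp add: Q_def)
  qed
  have "real m * Q = (\<Sum>n\<in>{3 * m..<4 * m}. Q)" by simp
  also have "\<dots> \<le> (\<Sum>n\<in>{3 * m..<4 * m}. p n * x ^ n)" by (intro sum_mono term_ge)
  also have "\<dots> \<le> (\<Sum>n. p n * x ^ n)"
    using s x p0 by (intro sum_le_suminf) (auto simp: sums_iff)
  also have "\<dots> = Re (deriv (radial_op (\<lambda>_. 1)) (of_real x))" using s by (simp add: sums_iff)
  also have "\<dots> \<le> norm (deriv (radial_op (\<lambda>_. 1)) (of_real x))" by (rule complex_Re_le_cmod)
  finally have 1: "real m * Q \<le> norm (deriv (radial_op (\<lambda>_. 1)) (of_real x))" .
  have "1 / (8 * real m) = 1 - x" by (simp add: x_def)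
  also have "\<dots> \<le> 1 - x\<^sup>2" using x by (simp add: power2_eq_square mult_left_le)
  finally have 2: "1 / (8 * real m) \<le> 1 - x\<^sup>2" .
  have "Q / 8 = 1 / (8 * real m) * (real m * Q)" using m by simp
  also have "\<dots> \<le> (1 - x\<^sup>2) * norm (deriv (radial_op (\<lambda>_. 1)) (of_real x))"
    using 1 2 moment_pos[of "4 * m"] moment_pos[of "6 * m"] x
    by (intro mult_mono) (auto simp: Q_def abs_square_le_1)
  also have "\<dots> \<le> K" using K[of "of_real x"] x by simp
  finally show ?thesis using moment_pos[of "6 * m"] by (simp add: Q_def field_simps)
qed

lemma bloch_imp_doubling:
  assumes "bloch_norm (radial_op (\<lambda>_. 1)) < top"
  shows "\<omega> \<in> doubling_weights"
proof -
  define S where "S = (SUP z\<in>unit_disc. ennreal ((1 - (norm z)\<^sup>2) * norm (deriv (radial_op (\<lambda>_. 1)) z)))"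
  have S: "S < top" using assms unfolding bloch_norm_def S_def by (simp add: less_top)
  have "(1 - (norm z)\<^sup>2) * norm (deriv (radial_op (\<lambda>_. 1)) z) \<le> enn2real S" if "norm z < 1" for z
  proof -
    have "ennreal ((1 - (norm z)\<^sup>2) * norm (deriv (radial_op (\<lambda>_. 1)) z)) \<le> S"
      unfolding S_def using that by (intro SUP_upper) auto
    then have "enn2real (ennreal ((1 - (norm z)\<^sup>2) * norm (deriv (radial_op (\<lambda>_. 1)) z))) \<le> enn2real S"
      using S by (intro enn2real_mono) auto
    then show ?thesis using that by (simp add: abs_square_le_1)
  qed
  then have "moment \<omega> (4 * m) \<le> 64 * enn2real S * moment \<omega> (6 * m)" if "m \<ge> 1" for m
    using that by (rule moment_le_of_bloch)
  then show ?thesis by (rule doubling_weightsI)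
qed

text \<open>Goes through the Bloch space, with the norm itself as the coefficient bound.\<close>

lemma HLinf_imp_doubling:
  assumes "HLinf_norm (radial_op (\<lambda>_. 1)) < top"
  shows "\<omega> \<in> doubling_weights"
proof -
  let ?g = "radial_op (\<lambda>_. 1)"
  have "HL_function ?g (enn2real (HLinf_norm ?g))"
  proof
    show "real (n + 1) * norm (fps_nth (fps_expansion ?g 0) n) \<le> enn2real (HLinf_norm ?g)" for n
    proof -
      have "ennreal (real (n + 1) * norm (fps_nth (fps_expansion ?g 0) n)) \<le> HLinf_norm ?g"
        unfolding HLinf_norm_def by (rule SUP_upper) simp
      then have "enn2real (ennreal (real (n + 1) * norm (fps_nth (fps_expansion ?g 0) n))) \<le> enn2real (HLinf_norm ?g)"
        using assms by (intro enn2real_mono) auto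
      then show ?thesis by simp
    qed
  qed (rule radial_op_one)
  then have "bloch_norm ?g < top"
    by (rule le_less_trans[OF HL_function.bloch_norm_le]) simp
  then show ?thesis by (rule bloch_imp_doubling)
qed

lemma BMOA_imp_doubling:
  assumes "BMOA_norm (radial_op (\<lambda>_. 1)) < top"
  shows "\<omega> \<in> doubling_weights"
proof -
  let ?g = "radial_op (\<lambda>_. 1)"
  define N where "N = enn2real (BMOA_norm_sq ?g)"
  have "BMOA_norm_sq ?g \<noteq> top" using assms by (auto simp: BMOA_norm_def)
  then have N: "BMOA_norm_sq ?g \<le> ennreal N" "N \<ge> 0" by (auto simp: N_def ennreal_enn2real_if)
  have "moment \<omega> (4 * m) \<le> 64 * sqrt (64 * N) * moment \<omega> (6 * m)" if "m \<ge> 1" for m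
    using deriv_le_BMOA_norm_sq[OF radial_op_one(1) N] that by (rule moment_le_of_bloch)
  then show ?thesis by (rule doubling_weightsI)
qed

end

section \<open>Bounded analytic functions on the radius and the equivalence\<close>

lemma one_in_Hinf: "(\<lambda>_. 1) \<in> Hinf" "Hinf_norm (\<lambda>_. 1) \<le> 1"
  by (auto simp: Hinf_def Hinf_norm_def intro!: SUP_least le_less_trans[OF SUP_least[of _ _ 1]])

lemma Hinf_radial:
  assumes "f \<in> Hinf"
  shows "set_borel_measurable lebesgue {0..<1} (\<lambda>t. f (of_real t))"
    and "set_borel_measurable lebesgue {0..<1} (\<lambda>t. complex_of_real (norm (f (of_real t))))"
    and "t \<in> {0..<1} \<Longrightarrow> norm (f (of_real t)) \<le> enn2real (Hinf_norm f)"
proof -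
  have h: "f holomorphic_on unit_disc" and fin: "Hinf_norm f < top" using assms by (auto simp: Hinf_def)
  have c: "continuous_on {0..<1} (\<lambda>t. f (of_real t))"
    by (intro continuous_on_compose2[OF holomorphic_on_imp_continuous_on[OF h]] continuous_intros) auto
  then show "set_borel_measurable lebesgue {0..<1} (\<lambda>t. f (of_real t))"
    by (rule set_borel_measurable_continuous_lebesgue) auto
  show "set_borel_measurable lebesgue {0..<1} (\<lambda>t. complex_of_real (norm (f (of_real t))))"
    by (intro set_borel_measurable_continuous_lebesgue continuous_intros c) auto
  assume "t \<in> {0..<1}"
  then have "ennreal (norm (f (of_real t))) \<le> Hinf_norm f"
    unfolding Hinf_norm_def by (intro SUP_upper) auto
  then have "enn2real (ennreal (norm (f (of_real t)))) \<le> enn2real (Hinf_norm f)"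
    using fin by (intro enn2real_mono) auto
  then show "norm (f (of_real t)) \<le> enn2real (Hinf_norm f)" by simp
qed

text \<open>The constant 1 lies in the unit ball of \<open>Hinf\<close>; it is the single test
  function on which the necessity of doubling rests.\<close>

lemma bounded_operatorD:
  assumes "bounded_operator T D Hinf Hinf_norm Y nY"
  shows "nY (T (\<lambda>_. 1)) < top"
proof -
  have "nY (T (\<lambda>_. 1)) \<le> (SUP f\<in>{f\<in>Hinf. Hinf_norm f \<le> 1}. nY (T f))"
    by (rule SUP_upper) (use one_in_Hinf in auto)
  also have "\<dots> < top" using assms by (simp add: bounded_operator_def)
  finally show ?thesis .
qed

theorem theorem4:
  fixes \<omega> :: "real \<Rightarrow> real"
    and T :: "(complex \<Rightarrow> complex) \<Rightarrow> complex \<Rightarrow> complex"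
    and D :: "(complex \<Rightarrow> complex) set"
  assumes "radial_weight \<omega>"
    and "(T, D) \<in> {(hilbert_op \<omega>, hilbert_dom \<omega>), (hilbert_abs_op \<omega>, hilbert_abs_dom \<omega>)}"
  shows "(bounded_operator T D Hinf Hinf_norm HLinf HLinf_norm \<longleftrightarrow>
            bounded_operator T D Hinf Hinf_norm BMOA BMOA_norm) \<and>
         (bounded_operator T D Hinf Hinf_norm BMOA BMOA_norm \<longleftrightarrow>
            bounded_operator T D Hinf Hinf_norm bloch_space bloch_norm) \<and>
         (bounded_operator T D Hinf Hinf_norm bloch_space bloch_norm \<longleftrightarrow>
            \<omega> \<in> doubling_weights)"
proof -
  interpret weight \<omega> by standard (rule assms(1))
  \<comment> \<open>\<open>R f\<close> is \<open>f\<close> or \<open>norm f\<close> on the radius,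
    according to the operator. Both have the modulus of \<open>f\<close> there and turn the constant
    1 into 1.\<close>
  obtain R :: "(complex \<Rightarrow> complex) \<Rightarrow> real \<Rightarrow> complex" where
    T: "T f = radial_op (R f)" and D: "D = {f. \<forall>z\<in>unit_disc. set_integrable lebesgue {0..<1} (\<lambda>t. R f t * kernel_average \<omega> t z * of_real (\<omega> t))}"
    and R: "f \<in> Hinf \<Longrightarrow> set_borel_measurable lebesgue {0..<1} (R f)"
      "norm (R f t) = norm (f (of_real t))" and R1: "R (\<lambda>_. 1) = (\<lambda>_. 1)" for f t
  proof -
    consider "T = hilbert_op \<omega>" "D = hilbert_dom \<omega>" | "T = hilbert_abs_op \<omega>" "D = hilbert_abs_dom \<omega>"
      using assms(2) by auto
    then show ?thesis
    proof cases
      case 1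
      show ?thesis
        by (rule that[of "\<lambda>f t. f (of_real t)"])
          (auto simp: 1 hilbert_op_def hilbert_dom_def radial_op_def fun_eq_iff intro: Hinf_radial)
    next
      case 2
      show ?thesis
        by (rule that[of "\<lambda>f t. of_real (norm (f (of_real t)))"])
          (auto simp: 2 hilbert_abs_op_def hilbert_abs_dom_def radial_op_def fun_eq_iff intro: Hinf_radial)
    qed
  qed
  have Rb: "norm (R f t) \<le> enn2real (Hinf_norm f)" if "f \<in> Hinf" "t \<in> {0..<1}" for f t
    using Hinf_radial(3)[OF that] R(2) by simp
  have HD: "Hinf \<subseteq> D"
    unfolding D using op_integrable[OF R(1) Rb] by auto
  have T1: "T (\<lambda>_. 1) = radial_op (\<lambda>_. 1)" by (simp add: T R1)
  have bdd: "bounded_operator T D Hinf Hinf_norm HLinf HLinf_norm \<and>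
      bounded_operator T D Hinf Hinf_norm BMOA BMOA_norm \<and>
      bounded_operator T D Hinf Hinf_norm bloch_space bloch_norm" if dw: "\<omega> \<in> doubling_weights"
  proof -
    obtain M where M: "M \<ge> 0" "\<And>n. moment \<omega> n \<le> M * moment \<omega> (2 * n + 1)"
      using moment_ratio_bounded[OF dw] by blast
    define K where "K f = enn2real (Hinf_norm f) * M / 2" for f
    have HL: "HL_function (T f) (K f)" if "f \<in> Hinf" for f
      unfolding T K_def using R(1)[OF that] Rb[OF that] M(2) by (rule radial_op_HL_function)
    \<comment> \<open>The factor 3 is slack: it gives all three norms the common bound
      \<open>3 * K f\<close>, so that one argument bounds all three suprema.\<close>
    have n1: "HLinf_norm (T f) \<le> ennreal (3 * K f)" if "f \<in> Hinf" for f
    proof -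
      have "HLinf_norm (T f) \<le> ennreal (K f)"
        unfolding HLinf_norm_def
        by (intro SUP_least ennreal_leI HL_function.coeff_bound HL that)
      also have "\<dots> \<le> ennreal (3 * K f)" using HL_function.C_nonneg[OF HL[OF that]] by (intro ennreal_leI) auto
      finally show ?thesis .
    qed
    note n2 = HL_function.BMOA_norm_le[OF HL] and n3 = HL_function.bloch_norm_le[OF HL]
    have lt: "x < top" if "x \<le> ennreal y" for x y using that by (rule le_less_trans) simp
    have fin: "(SUP f\<in>{f\<in>Hinf. Hinf_norm f \<le> 1}. nY (T f)) < top"
      if nY: "\<And>f. f \<in> Hinf \<Longrightarrow> nY (T f) \<le> ennreal (3 * K f)" for nY
    proof (rule lt[OF SUP_least])
      fix f assume "f \<in> {f\<in>Hinf. Hinf_norm f \<le> 1}"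
      then have f: "f \<in> Hinf" "Hinf_norm f \<le> 1" by auto
      have "enn2real (Hinf_norm f) \<le> 1" using enn2real_mono[OF f(2)] by simp
      then have "K f \<le> 1 * M / 2" unfolding K_def using M(1) by (intro divide_right_mono mult_right_mono) auto
      then show "nY (T f) \<le> ennreal (3 * (M / 2))"
        using nY[OF f(1)] by (auto intro!: ennreal_leI elim!: order_trans)
    qed
    have hol: "T f holomorphic_on unit_disc" if "f \<in> Hinf" for f
      using HL_function.hol[OF HL[OF that]] .
    show ?thesis
      unfolding bounded_operator_def
      using HD fin[OF n1] fin[OF n2] fin[OF n3] hol lt[OF n1] lt[OF n3] HL_function.in_BMOA[OF HL]
      by (auto simp: HLinf_def bloch_space_def)
  qed
  show ?thesis
    using bdd bounded_operatorD[of T D _ HLinf_norm] bounded_operatorD[of T D _ BMOA_norm] bounded_operatorD[of T D _ bloch_norm]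
      HLinf_imp_doubling BMOA_imp_doubling bloch_imp_doubling
    unfolding T1 by blast
qed

end
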